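(* Let $V\subseteq Y\subseteq X\subseteq H\subseteq X'\subseteq Y'\subseteq V'$ be a chain of spaces with continuous imbeddings, where $V,H$ are Hilbert spaces ($V$ dense in $H$, $H$ identified with its dual) and $X,Y$ are Banach spaces. Let $0<\alpha<\beta$ be real numbers, and let $F:V\to\mathbb{R}$ and $g:(0,+\infty)\times V\to V'$ be functions such that: (i) $F$ is of class $C^1$, with gradient $\nabla F\in C^0(V,V')$; (ii) for every $T>0$ and every $v\in L^\infty((0,T),V)$ the function $t\mapsto g(t,v(t))$ belongs to $L^1((0,T),V')$; (iii) there exists $\delta_1>0$ such that $F(u)\ge \delta_1\|u\|_Y^{\beta+2}$ for all $u\in V$; (iv) there exists $\delta_2>0$ such that $\langle\nabla F(u),u\rangle_{V',V}\ge\delta_2F(u)$ for all $u\in V$; (v) there exists $\delta_3>0$ such that $\langle g(t,v),v\rangle_{V',V}\ge\delta_3\|v\|_X^{\alpha+2}$ for every $v\in V$ and almost every $t>0$; (vi) $g(t,v)\in X'$ for every $(t,v)\in(0,+\infty)\times V$, and there exists $D_4>0$ such that $\|g(t,v)\|_{X'}\le D_4\|v\|_X^{\alpha+1}$ for every $v\in V$ and almost every $t>0$. Set $$\gamma:=\max\left\{\frac{\alpha}{2},\ \frac{\beta-\alpha}{(\alpha+1)(\beta+2)}\right\}.$$ Then there exists a real number $D$, depending only on $\alpha$, $\beta$, the imbeddings in the chain of spaces, and the constants $\delta_1,\delta_2,\delta_3,D_4$ (in particular independent of $u$), such that every strong solution $u$ on $(0,+\infty)$ of $$u''(t)+\nabla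 F(u(t))+g(t,u'(t))=0$$ satisfies $$\|u'(t)\|_H^2+F(u(t))\le D\,t^{-1/\gamma}\qquad\forall t\ge 1.$$
   Context: In the chain $V\subseteq Y\subseteq X\subseteq H\subseteq X'\subseteq Y'\subseteq V'$, primes denote dual spaces; $V\subseteq H\subseteq V'$ is the usual Hilbert triple obtained by identifying $H$ with $H'$, all inclusions are continuous imbeddings, and the duality pairings are compatible (for $w\in X'$ and $u\in V$, $\langle w,u\rangle_{V',V}=\langle w,u\rangle_{X',X}$). For $0<T<+\infty$, a strong solution on $(0,T)$ of $u''(t)+\nabla F(u(t))+g(t,u'(t))=0$ is a function $u\in W^{1,\infty}((0,T),V)\cap W^{2,1}((0,T),V')$ for which the equation holds as an equality in $L^1((0,T),V')$. A strong solution on $(0,+\infty)$ is a function whose restriction to $(0,T)$ is a strong solution on $(0,T)$ for every $T>0$. Every strong solution belongs to $C^0([0,T],V)\cap C^1([0,T],H)$ for every $T>0$, so the values $u(t)\in V$ and $u'(t)\in H$ are well defined. *)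

theory Defs
  imports "HOL-Analysis.Analysis"
begin

section \<open>Bochner spaces without separability\<close>

text \<open>
  The integral of \<open>HOL-Analysis.Bochner_Integration\<close> requires a second countable
  target type. No separability is assumed here, so Borel measurability is replaced by
  strong measurability; otherwise \<open>bochner_has_integral\<close> follows \<open>has_bochner_integral\<close>.
\<close>

definition strongly_measurable :: "'a measure \<Rightarrow> ('a \<Rightarrow> 'b::real_normed_vector) \<Rightarrow> bool" where
  "strongly_measurable M f \<longleftrightarrow>
     (\<exists>s. (\<forall>n. simple_function M (s n)) \<and> (AE t in M. (\<lambda>n::nat. s n t) \<longlonglongrightarrow> f t))"

definition bochner_has_integral ::
    "'a measure \<Rightarrow> ('a \<Rightarrow> 'b::real_normed_vector) \<Rightarrow> 'b \<Rightarrow> bool" where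
  "bochner_has_integral M f I \<longleftrightarrow>
     strongly_measurable M f \<and>
     (\<exists>s. (\<forall>n. Bochner_Integration.simple_bochner_integrable M (s n)) \<and>
          (\<lambda>n::nat. \<integral>\<^sup>+ t. ennreal (norm (f t - s n t)) \<partial>M) \<longlonglongrightarrow> 0 \<and>
          (\<lambda>n. Bochner_Integration.simple_bochner_integral M (s n)) \<longlonglongrightarrow> I)"

definition L_one :: "'a measure \<Rightarrow> ('a \<Rightarrow> 'b::real_normed_vector) \<Rightarrow> bool" where
  "L_one M f \<longleftrightarrow>
     strongly_measurable M f \<and> (\<integral>\<^sup>+ t. ennreal (norm (f t)) \<partial>M) < \<infinity>"

definition L_infinity :: "'a measure \<Rightarrow> ('a \<Rightarrow> 'b::real_normed_vector) \<Rightarrow> bool" where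
  "L_infinity M f \<longleftrightarrow>
     strongly_measurable M f \<and> (\<exists>C. AE t in M. norm (f t) \<le> C)"


section \<open>Weak derivatives on $(0,T)$\<close>

definition test_function :: "real \<Rightarrow> (real \<Rightarrow> real) \<Rightarrow> bool" where
  "test_function T \<phi> \<longleftrightarrow>
     (\<forall>n t. (deriv ^^ n) \<phi> field_differentiable at t) \<and>
     (\<exists>a b. 0 < a \<and> b < T \<and> (\<forall>t. t \<notin> {a..b} \<longrightarrow> \<phi> t = 0))"

definition weak_derivative :: "real \<Rightarrow> (real \<Rightarrow> 'b::real_normed_vector) \<Rightarrow> (real \<Rightarrow> 'b) \<Rightarrow> bool" where
  "weak_derivative T f f' \<longleftrightarrow>
     (\<forall>\<phi>. test_function T \<phi> \<longrightarrow>
        (\<exists>I. bochner_has_integral (lebesgue_on {0<..<T}) (\<lambda>t. deriv \<phi> t *\<^sub>R f t) I \<and>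
             bochner_has_integral (lebesgue_on {0<..<T}) (\<lambda>t. \<phi> t *\<^sub>R f' t) (- I)))"


section \<open>The chain of spaces\<close>

text \<open>
  The spaces $V$, $Y$, $X$, $H$ are types, and the inclusions \<open>V \<subseteq> Y \<subseteq> X \<subseteq> H\<close> are injective
  bounded linear maps \<open>iVY\<close>, \<open>iYX\<close>, \<open>iXH\<close>. The dual of a space is the type of bounded
  functionals on it. Compatibility of the pairings forces the inclusions of the duals to be
  restriction of functionals; the Riesz map identifies $H$ with $H'$.
\<close>

definition restrict_functional ::
    "('a::real_normed_vector \<Rightarrow>\<^sub>L 'b::real_normed_vector) \<Rightarrow> ('b \<Rightarrow>\<^sub>L real) \<Rightarrow> ('a \<Rightarrow>\<^sub>L real)" where
  "restrict_functional i w = w o\<^sub>L i"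

definition hilbert_to_dual ::
    "('a::real_normed_vector \<Rightarrow>\<^sub>L 'h::real_inner) \<Rightarrow> 'h \<Rightarrow> ('a \<Rightarrow>\<^sub>L real)" where
  "hilbert_to_dual i h = restrict_functional i (blinfun_inner_right h)"

text \<open>
  The last three clauses say that \<open>H \<subseteq> X' \<subseteq> Y' \<subseteq> V'\<close> are imbeddings as well; their continuity
  is automatic.
\<close>

definition chain_of_spaces ::
    "('v::{real_inner,complete_space} \<Rightarrow>\<^sub>L 'y::banach) \<Rightarrow> ('y \<Rightarrow>\<^sub>L 'x::banach) \<Rightarrow>
     ('x \<Rightarrow>\<^sub>L 'h::{real_inner,complete_space}) \<Rightarrow> bool" where
  "chain_of_spaces iVY iYX iXH \<longleftrightarrow>
     inj (blinfun_apply iVY) \<and> inj (blinfun_apply iYX) \<and> inj (blinfun_apply iXH) \<and>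
     closure (range (blinfun_apply (iXH o\<^sub>L iYX o\<^sub>L iVY))) = UNIV \<and>
     inj (hilbert_to_dual iXH) \<and>
     inj (restrict_functional iYX) \<and>
     inj (restrict_functional iVY)"


section \<open>Strong solutions\<close>

text \<open>
  Here \<open>i\<close> is the imbedding of $V$ into $H$, so \<open>hilbert_to_dual i \<circ> i\<close> is the inclusion of $V$
  into $V'$, and \<open>dF\<close> is the gradient of $F$. An element of $W^{1,\infty}((0,T),V)$ is a class of
  functions modulo null sets; the continuity clause only selects its continuous representative,
  so that the values $u(t)$ make sense.
\<close>

definition strong_solution_on ::
    "('v::real_normed_vector \<Rightarrow>\<^sub>L 'h::real_inner) \<Rightarrow> ('v \<Rightarrow> 'v \<Rightarrow>\<^sub>L real) \<Rightarrow>
     (real \<Rightarrow> 'v \<Rightarrow> 'v \<Rightarrow>\<^sub>L real) \<Rightarrow> real \<Rightarrow> (real \<Rightarrow> 'v) \<Rightarrow> bool" where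
  "strong_solution_on i dF g T u \<longleftrightarrow>
     (let M = lebesgue_on {0<..<T}; J = (\<lambda>v. hilbert_to_dual i (i v)) in
      continuous_on {0..T} u \<and>
      (\<exists>u' u''.
         \<comment> \<open>u in W(1,infinity)((0,T), V), with derivative \<open>u'\<close>\<close>
         L_infinity M u \<and> L_infinity M u' \<and> weak_derivative T u u' \<and>
         \<comment> \<open>u in W(2,1)((0,T), V'), with derivatives \<open>u'\<close> and \<open>u''\<close>\<close>
         L_one M (\<lambda>t. J (u t)) \<and> L_one M (\<lambda>t. J (u' t)) \<and> L_one M u'' \<and>
         weak_derivative T (\<lambda>t. J (u t)) (\<lambda>t. J (u' t)) \<and>
         weak_derivative T (\<lambda>t. J (u' t)) u'' \<and>
         L_one M (\<lambda>t. dF (u t)) \<and> L_one M (\<lambda>t. g t (u' t)) \<and>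
         (AE t in M. u'' t + dF (u t) + g t (u' t) = 0)))"

definition strong_solution ::
    "('v::real_normed_vector \<Rightarrow>\<^sub>L 'h::real_inner) \<Rightarrow> ('v \<Rightarrow> 'v \<Rightarrow>\<^sub>L real) \<Rightarrow>
     (real \<Rightarrow> 'v \<Rightarrow> 'v \<Rightarrow>\<^sub>L real) \<Rightarrow> (real \<Rightarrow> 'v) \<Rightarrow> bool" where
  "strong_solution i dF g u \<longleftrightarrow> (\<forall>T>0. strong_solution_on i dF g T u)"

end

theory Submission
  imports Defs
begin

text \<open>
  Let \<open>E = \<bar>u'\<bar>\<^sup>2 / 2 + F u\<close> be the energy; it decreases at rate at least
  \<open>\<delta>3 \<parallel>u'\<parallel>\<^sub>X\<^bsup>\<alpha> + 2\<^esup>\<close>. On a time window on which the energy stays between \<open>e / 2\<close> and \<open>e\<close>, integrate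
  the derivative of \<open>u' \<bullet> u\<close>: the gradient contributes at least \<open>\<delta>2 e / 2\<close> per unit of time, while
  \<open>\<bar>u'\<bar>\<^sup>2\<close> and the damping term are absorbed by the dissipated energy, which is at most \<open>e / 2\<close>. So the
  window has length \<open>O(e\<^bsup>-g1\<^esup> + e\<^bsup>-g2\<^esup>)\<close>, where \<open>g1\<close> and \<open>g2\<close> are the two numbers whose maximum is
  \<open>\<gamma>\<close>. Summing over dyadic energy levels bounds the time at which the energy is \<open>e\<close>, whatever the
  initial energy was.

  The regularity needed for these computations is obtained by testing with functionals. The weak
  form of the equation gives Lipschitz bounds for \<open>u'\<close> in \<open>V'\<close>, and interpolation with the bound of
  \<open>u'\<close> in \<open>V\<close> makes \<open>u'\<close> Hoelder continuous in \<open>H\<close>.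
\<close>

section \<open>Smooth ramps and test functions\<close>

text \<open>The obstacle is regularity: a strong solution has \<open>u'\<close> merely bounded and
  measurable in V and \<open>u''\<close> merely integrable in V', and V need not be separable. So
  weak derivatives are tested with one functional at a time, and the resulting real functions are
  handled by a theorem on weak second derivatives. Along a given solution the equation itself makes
  \<open>u''\<close> bounded in V', because the damping is bounded by a power of the norm of
  \<open>u'\<close> in X. The bounds so obtained depend on the solution, but they only justify the
  identities; the constants of the energy estimates come from the hypotheses alone.

  The exponents come from balancing. With m = 1/(\<beta>+2), the norm of u in X is at most a
  multiple of e^m on a window of level e. Against a gain of order e per unit of time, the
  interpolated integral of the squared velocity costs e^(-\<alpha>/2), the damping tested with u
  costs e^(-(\<beta>-\<alpha>)/((\<alpha>+1)(\<beta>+2))), and the end values of the pairing of u'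
  and u cost e^(m-1/2), an exponent that lies between the other two.\<close>

definition smooth :: "(real \<Rightarrow> real) \<Rightarrow> bool" where
  "smooth f \<longleftrightarrow> (\<forall>n t. (deriv ^^ n) f field_differentiable at t)"

text \<open>An invariant \<open>S\<close> replaces an induction over all derivatives: it suffices to
  exhibit a family of differentiable functions that \<open>deriv\<close> does not leave. Most
  closure properties below only name such a family.\<close>

lemma smooth_if_closed_under_deriv:
  assumes "f \<in> S" and "\<And>f t. f \<in> S \<Longrightarrow> f field_differentiable at t"
    and "\<And>f. f \<in> S \<Longrightarrow> deriv f \<in> S"
  shows "smooth f"
proof -
  have "(deriv ^^ n) f \<in> S" for n
    using assms by (induction n) auto
  then show ?thesis
    using assms(2) unfolding smooth_def by blast
qed

lemma smooth_imp_differentiable: "smooth f \<Longrightarrow> (f has_real_derivative deriv f t) (at t)"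
  unfolding smooth_def by (metis DERIV_deriv_iff_field_differentiable funpow_0)

lemma smooth_deriv: "smooth f \<Longrightarrow> smooth (deriv f)"
  unfolding smooth_def by (metis comp_apply funpow_Suc_right)

lemma smooth_antideriv:
  assumes "\<And>t. (f has_real_derivative f' t) (at t)" "smooth f'"
  shows "smooth f"
proof -
  have f': "deriv f = f'" using assms(1) DERIV_imp_deriv by blast
  have "(deriv ^^ n) f field_differentiable at t" for n t
  proof (cases n)
    case 0
    then show ?thesis using assms(1) unfolding field_differentiable_def by auto
  next
    case (Suc m)
    then have "(deriv ^^ n) f = (deriv ^^ m) f'" using f' by (metis comp_apply funpow_Suc_right)
    then show ?thesis using assms(2) by (simp add: smooth_def)
  qed
  then show ?thesis by (simp add: smooth_def)
qed

text \<open>Replaces the Leibniz formula: differentiating a generator gives a sum of two generators,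
  so closure under \<open>deriv\<close> involves no binomial coefficients.\<close>

inductive_set leibniz_span :: "(real \<Rightarrow> real) \<Rightarrow> (real \<Rightarrow> real) \<Rightarrow> (real \<Rightarrow> real) set" for f g where
  base: "(\<lambda>x. (deriv ^^ m) f x * (deriv ^^ n) g x) \<in> leibniz_span f g"
| sum: "a \<in> leibniz_span f g \<Longrightarrow> b \<in> leibniz_span f g \<Longrightarrow> (\<lambda>x. a x + b x) \<in> leibniz_span f g"

lemma smooth_mult:
  assumes "smooth f" "smooth g"
  shows "smooth (\<lambda>x. f x * g x)"
proof (rule smooth_if_closed_under_deriv[of _ "leibniz_span f g"])
  show "(\<lambda>x. f x * g x) \<in> leibniz_span f g"
    using leibniz_span.base[of 0 f 0 g] by simp
  have *: "(\<forall>t. a field_differentiable at t) \<and> deriv a \<in> leibniz_span f g" if "a \<in> leibniz_span f g" for a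
    using that
  proof induction
    case (base m n)
    have df: "((deriv ^^ m) f has_real_derivative (deriv ^^ Suc m) f x) (at x)"
      and dg: "((deriv ^^ n) g has_real_derivative (deriv ^^ Suc n) g x) (at x)" for x
      using assms unfolding smooth_def by (auto simp: DERIV_deriv_iff_field_differentiable)
    have d: "((\<lambda>x. (deriv ^^ m) f x * (deriv ^^ n) g x) has_real_derivative
      (deriv ^^ m) f x * (deriv ^^ Suc n) g x + (deriv ^^ Suc m) f x * (deriv ^^ n) g x) (at x)" for x
      using DERIV_mult'[OF df dg] by simp
    have e: "deriv (\<lambda>x. (deriv ^^ m) f x * (deriv ^^ n) g x) =
      (\<lambda>x. (deriv ^^ m) f x * (deriv ^^ Suc n) g x + (deriv ^^ Suc m) f x * (deriv ^^ n) g x)"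
      using DERIV_imp_deriv[OF d] by blast
    show ?case
    proof
      show "\<forall>t. (\<lambda>x. (deriv ^^ m) f x * (deriv ^^ n) g x) field_differentiable at t"
        unfolding field_differentiable_def using d by blast
      show "deriv (\<lambda>x. (deriv ^^ m) f x * (deriv ^^ n) g x) \<in> leibniz_span f g"
        unfolding e by (intro leibniz_span.intros)
    qed
  next
    case (sum a b)
    have "deriv (\<lambda>x. a x + b x) = (\<lambda>x. deriv a x + deriv b x)"
      using sum.IH by auto
    then show ?case
      using sum.IH by (auto intro!: leibniz_span.sum field_differentiable_add)
  qed
  show "\<And>a t. a \<in> leibniz_span f g \<Longrightarrow> a field_differentiable at t"
    "\<And>a. a \<in> leibniz_span f g \<Longrightarrow> deriv a \<in> leibniz_span f g"
    using * by blast+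
qed

lemma smooth_add:
  assumes "smooth f" "smooth g"
  shows "smooth (\<lambda>x. f x + g x)"
proof (rule smooth_if_closed_under_deriv[of _ "{\<lambda>x. f x + g x | f g. smooth f \<and> smooth g}"])
  fix a assume "a \<in> {\<lambda>x. f x + g x | f g. smooth f \<and> smooth g}"
  then obtain f g where a: "a = (\<lambda>x. f x + g x)" and s: "smooth f" "smooth g" by blast
  have d: "(a has_real_derivative deriv f x + deriv g x) (at x)" for x
    unfolding a using s by (intro DERIV_add smooth_imp_differentiable)
  then show "a field_differentiable at t" for t unfolding field_differentiable_def by blast
  have "deriv a = (\<lambda>x. deriv f x + deriv g x)" using d DERIV_imp_deriv by blast
  then show "deriv a \<in> {\<lambda>x. f x + g x | f g. smooth f \<and> smooth g}" using s smooth_deriv by blast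
qed (use assms in blast)

lemma smooth_affine_compose:
  assumes "smooth f"
  shows "smooth (\<lambda>x. c * f (m * x + b))"
proof (rule smooth_if_closed_under_deriv[of _ "{\<lambda>x. c * f (m * x + b) | c f. smooth f}"])
  fix a assume "a \<in> {\<lambda>x. c * f (m * x + b) | c f. smooth f}"
  then obtain c f where a: "a = (\<lambda>x. c * f (m * x + b))" and s: "smooth f" by blast
  have d: "(a has_real_derivative (c * m) * deriv f (m * x + b)) (at x)" for x
    unfolding a
    by (rule derivative_eq_intros DERIV_chain2[OF smooth_imp_differentiable[OF s]] refl | simp)+
  then show "a field_differentiable at t" for t unfolding field_differentiable_def by blast
  have "deriv a = (\<lambda>x. (c * m) * deriv f (m * x + b))" using d DERIV_imp_deriv by blast
  then show "deriv a \<in> {\<lambda>x. c * f (m * x + b) | c f. smooth f}" using s smooth_deriv by blast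
qed (use assms in blast)

text \<open>The flat function \<open>exp (- (1 / x))\<close>, extended by 0, with a polynomial in
  \<open>1 / x\<close> as a factor; carrying the polynomial along makes the family closed under
  differentiation.\<close>

definition flat_exp :: "real poly \<Rightarrow> real \<Rightarrow> real" where
  "flat_exp p x = (if x > 0 then poly p (1 / x) * exp (- (1 / x)) else 0)"

lemma flat_exp_tendsto_0:
  fixes p :: "real poly"
  shows "((\<lambda>x. poly p (1 / x) * exp (- (1 / x))) \<longlongrightarrow> 0) (at_right 0)"
proof -
  have "((\<lambda>y. poly p y * exp (- y)) \<longlongrightarrow> 0) at_top"
  proof -
    have 1: "((\<lambda>y. coeff p i * (y ^ i / exp y)) \<longlongrightarrow> coeff p i * 0) at_top" for i :: nat
      by (rule tendsto_mult_left[OF tendsto_power_div_exp_0])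
    have "((\<lambda>y. \<Sum>i\<le>degree p. coeff p i * (y ^ i / exp y)) \<longlongrightarrow> (\<Sum>i\<le>degree p. coeff p i * 0)) at_top"
      by (intro tendsto_sum 1)
    moreover have "(\<Sum>i\<le>degree p. coeff p i * (y ^ i / exp y)) = poly p y * exp (- y)" for y
      by (simp add: poly_altdef sum_distrib_right exp_minus divide_inverse mult.assoc)
    ultimately show ?thesis by simp
  qed
  then show ?thesis
    using filterlim_compose[OF _ filterlim_inverse_at_top_right] by (simp add: divide_inverse filterlim_at_top_to_right)
qed

text \<open>With y = 1/x one has d/dx = -y^2 d/dy, which turns p(y) e^(-y) into y^2 (p(y) - p'(y))
  e^(-y).\<close>

lemma flat_exp_DERIV:
  "(flat_exp p has_real_derivative flat_exp (monom 1 2 * (p - pderiv p)) x) (at x)"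
proof -
  consider "x > 0" | "x < 0" | "x = 0" by linarith
  then show ?thesis
  proof cases
    case 1
    have "((\<lambda>x. poly p (1 / x) * exp (- (1 / x))) has_real_derivative
       flat_exp (monom 1 2 * (p - pderiv p)) x) (at x)"
      using 1
      by (auto intro!: derivative_eq_intros DERIV_chain2[OF poly_DERIV] simp: flat_exp_def poly_monom
          field_simps power2_eq_square)
    then show ?thesis
      by (rule has_field_derivative_transform_within_open[of _ _ _ "{0<..}"]) (use 1 in \<open>auto simp: flat_exp_def\<close>)
  next
    case 2
    have "((\<lambda>x. 0) has_real_derivative flat_exp (monom 1 2 * (p - pderiv p)) x) (at x)"
      using 2 by (auto simp: flat_exp_def)
    then show ?thesis
      by (rule has_field_derivative_transform_within_open[of _ _ _ "{..<0}"]) (use 2 in \<open>auto simp: flat_exp_def\<close>)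
  next
    case 3
    have l: "((\<lambda>y. (flat_exp p y - flat_exp p 0) / (y - 0)) \<longlongrightarrow> 0) (at_left 0)"
      by (rule Lim_transform_eventually[OF tendsto_const])
        (auto simp: eventually_at_filter flat_exp_def)
    \<comment> \<open>Dividing by \<open>y\<close> multiplies the polynomial by one more power of
      \<open>1 / y\<close>, so the limit at 0 applies again.\<close>
    have r: "((\<lambda>y. (flat_exp p y - flat_exp p 0) / (y - 0)) \<longlongrightarrow> 0) (at_right 0)"
      by (rule Lim_transform_eventually[OF flat_exp_tendsto_0[of "monom 1 1 * p"]])
        (auto simp: eventually_at_filter flat_exp_def poly_monom)
    show ?thesis
      unfolding has_field_derivative_iff 3 using filterlim_split_at_real[OF l r] by (simp add: flat_exp_def)
  qed
qed

lemma smooth_flat_exp: "smooth (flat_exp p)"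
proof (rule smooth_if_closed_under_deriv[of _ "range flat_exp"])
  fix f assume "f \<in> range flat_exp"
  then obtain p where f: "f = flat_exp p" by blast
  show "f field_differentiable at t" for t
    unfolding f field_differentiable_def using flat_exp_DERIV by blast
  show "deriv f \<in> range flat_exp"
    unfolding f using DERIV_imp_deriv[OF flat_exp_DERIV[of p]] by (metis ext rangeI)
qed auto

section \<open>Smooth steps, ramps and approximate identities\<close>

lemma antiderivative_real:
  fixes f :: "real \<Rightarrow> real"
  assumes "\<And>x. isCont f x"
  obtains F where "\<And>x. (F has_real_derivative f x) (at x)" "F 0 = 0"
proof -
  obtain F where F: "\<And>x. (F has_vector_derivative f x) (at x)"
    using einterval_antiderivative[of "-\<infinity>" "\<infinity>" f] assms by auto
  show thesis
  proof
    show "((\<lambda>x. F x - F 0) has_real_derivative f x) (at x)" for x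
      using F[of x] by (auto simp: has_real_derivative_iff_has_vector_derivative intro!: derivative_eq_intros)
  qed simp
qed

lemma smooth_isCont: "smooth f \<Longrightarrow> isCont f x"
  using smooth_imp_differentiable DERIV_isCont by blast

text \<open>\<open>\<rho>\<close> is a bump of mass 1, \<open>B\<close> the step that integrates it
  and \<open>C\<close> the ramp that integrates \<open>B\<close>. Rescaled as
  \<open>C (n * x) / n\<close>, the ramp tends to \<open>max 0 x\<close> while its second derivative
  \<open>n * \<rho> (n * x)\<close> is an approximate identity; the offset \<open>c\<close> is what
  the rounding near 0 costs.\<close>

lemma smooth_ramp_exists:
  obtains C B \<rho> :: "real \<Rightarrow> real" and c :: real
  where "smooth C" "\<And>x. (C has_real_derivative B x) (at x)" "\<And>x. (B has_real_derivative \<rho> x) (at x)"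
    "smooth \<rho>" "\<And>x. \<rho> x \<ge> 0" "\<And>x. x \<notin> {0..1} \<Longrightarrow> \<rho> x = 0"
    "\<And>x. x \<le> 0 \<Longrightarrow> B x = 0" "\<And>x. x \<ge> 1 \<Longrightarrow> B x = 1"
    "\<And>x. \<bar>C x\<bar> \<le> \<bar>x\<bar>" "\<And>x. x \<le> 0 \<Longrightarrow> C x = 0" "\<And>x. x \<ge> 1 \<Longrightarrow> C x = x - c"
proof -
  define r where "r x = flat_exp 1 x * flat_exp 1 (1 - x)" for x
  have "smooth (\<lambda>x. flat_exp 1 (1 - x))"
    using smooth_affine_compose[OF smooth_flat_exp[of 1], of 1 "-1" 1] by simp
  then have sr: "smooth r"
    unfolding r_def[abs_def] by (intro smooth_mult smooth_flat_exp)
  have rpos: "r x > 0" if "0 < x" "x < 1" for x using that by (simp add: r_def flat_exp_def)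
  have r0: "r x = 0" if "x \<le> 0 \<or> x \<ge> 1" for x using that by (auto simp: r_def flat_exp_def)
  have rge: "r x \<ge> 0" for x using rpos[of x] r0[of x] by force
  have incr: "f a \<le> f b" if "\<And>x. (f has_real_derivative f' x) (at x)" "\<And>x. f' x \<ge> 0" "a \<le> b"
    for f f' :: "real \<Rightarrow> real" and a b
    by (rule DERIV_nonneg_imp_nondecreasing[OF \<open>a \<le> b\<close>]) (use that(1,2) in blast)
  have const: "f a = f b" if der: "\<And>x. (f has_real_derivative f' x) (at x)"
      and z: "\<And>x. a < x \<Longrightarrow> x < b \<Longrightarrow> f' x = 0" and "a \<le> b"
    for f f' :: "real \<Rightarrow> real" and a b
  proof (cases "a = b")
    case False
    then have "a < b" using \<open>a \<le> b\<close> by simp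
    obtain z where "a < z" "z < b" "f b - f a = (b - a) * f' z"
      using MVT2[OF \<open>a < b\<close>, of f f'] der by metis
    then show ?thesis using z[of z] by simp
  qed auto
  obtain B0 where B0: "\<And>x. (B0 has_real_derivative r x) (at x)" "B0 0 = 0"
    using antiderivative_real[of r, OF smooth_isCont[OF sr]] by blast
  define Z where "Z = B0 1"
  have "Z > 0"
  proof -
    have "B0 0 < B0 1"
    proof (rule DERIV_pos_imp_increasing_open[of 0 1 B0])
      show "continuous_on {0..1} B0"
        using DERIV_isCont[OF B0(1)] by (intro continuous_at_imp_continuous_on) auto
    qed (use B0(1) rpos in \<open>auto intro!: exI\<close>)
    then show ?thesis using B0(2) by (simp add: Z_def)
  qed
  define B where "B x = B0 x / Z" for x
  define \<rho> where "\<rho> x = r x / Z" for x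
  have B: "(B has_real_derivative \<rho> x) (at x)" for x
    unfolding B_def[abs_def] \<rho>_def using B0(1) by (intro DERIV_cdivide)
  have s\<rho>: "smooth \<rho>"
    using smooth_affine_compose[OF sr, of "1 / Z" 1 0] by (simp add: \<rho>_def[abs_def])
  have \<rho>ge: "\<rho> x \<ge> 0" for x using rge \<open>Z > 0\<close> by (simp add: \<rho>_def)
  have B1: "B x = 0" if "x \<le> 0" for x
    using const[of B \<rho> x 0] B that r0 B0 by (auto simp: \<rho>_def B_def)
  have B2: "B x = 1" if "x \<ge> 1" for x
    using const[of B \<rho> 1 x] B that r0 \<open>Z > 0\<close> by (auto simp: \<rho>_def B_def Z_def)
  have B01: "B x \<in> {0..1}" for x
  proof (cases "0 \<le> x \<and> x \<le> 1")
    case True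
    then show ?thesis
      using incr[of B \<rho> 0 x] incr[of B \<rho> x 1] B \<rho>ge B1[of 0] B2[of 1] by auto
  next
    case False
    then show ?thesis using B1[of x] B2[of x] by auto
  qed
  have sB: "smooth B" by (rule smooth_antideriv[OF B s\<rho>])
  obtain C where C: "\<And>x. (C has_real_derivative B x) (at x)" "C 0 = 0"
    using antiderivative_real[of B, OF smooth_isCont[OF sB]] by blast
  have C1: "C x = 0" if "x \<le> 0" for x
    using const[of C B x 0] C that B1 by auto
  have CB: "((\<lambda>x. C x - x) has_real_derivative B x - 1) (at x)" for x
    by (intro DERIV_diff C DERIV_ident)
  have C2: "C x = x - (1 - C 1)" if "x \<ge> 1" for x
  proof -
    have "C 1 - 1 = C x - x"
      by (rule const[OF CB]) (use B2 that in auto)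
    then show ?thesis by simp
  qed
  have C3: "\<bar>C x\<bar> \<le> \<bar>x\<bar>" for x
  proof (cases "x \<ge> 0")
    case True
    have "0 - C 0 \<le> x - C x"
      by (rule incr[of "\<lambda>x. x - C x" "\<lambda>x. 1 - B x"])
        (use B01 True C(1) in \<open>auto intro!: DERIV_diff DERIV_ident\<close>)
    moreover have "C 0 \<le> C x" by (rule incr[OF C(1)]) (use B01 True in auto)
    ultimately show ?thesis using C(2) by auto
  qed (use C1[of x] in auto)
  show thesis
  proof (rule that[of C B \<rho> "1 - C 1"])
    show "smooth C" by (rule smooth_antideriv[OF C(1) sB])
    show "\<rho> x = 0" if "x \<notin> {0..1}" for x using that r0[of x] by (auto simp: \<rho>_def)
  qed (fact C(1) B s\<rho> \<rho>ge B1 B2 C3 C1 C2)+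
qed

lemma bounded_measurable_integrable_on:
  fixes p :: "real \<Rightarrow> real"
  assumes "p \<in> borel_measurable (lebesgue_on {0<..<T})" "\<And>x. x \<in> {0<..<T} \<Longrightarrow> \<bar>p x\<bar> \<le> K"
  shows "p integrable_on {0<..<T}"
proof (rule measurable_bounded_by_integrable_imp_integrable[OF assms(1), of "\<lambda>x. K"])
  show "(\<lambda>x. K) integrable_on {0<..<T}"
    using integrable_const_ivl[of K 0 T] integrable_on_open_interval_real[of "\<lambda>x. K" 0 T] by auto
qed (use assms in auto)

lemma integral_eq_on_support:
  fixes f :: "real \<Rightarrow> real"
  assumes "S \<subseteq> U" "\<And>x. x \<in> U \<Longrightarrow> x \<notin> S \<Longrightarrow> f x = 0"
  shows "integral U f = integral S f"
proof -
  have "integral U f = integral UNIV (\<lambda>x. if x \<in> U then f x else 0)"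
    by (simp add: integral_restrict_UNIV)
  also have "(\<lambda>x. if x \<in> U then f x else 0) = (\<lambda>x. if x \<in> S then f x else 0)"
    by (rule ext) (use assms in auto)
  finally show ?thesis by (simp add: integral_restrict_UNIV)
qed

text \<open>The kernel has mass 1, being the derivative of a step from 0 to 1, and lives on
  \<open>{a..a + 1 / n}\<close>, where \<open>f\<close> is close to \<open>f a\<close>.\<close>

lemma bump_integral_tendsto:
  fixes f :: "real \<Rightarrow> real"
  assumes f: "continuous_on {0..T} f" and a: "0 < a" "a < T"
    and \<rho>: "\<And>x. isCont \<rho> x" "\<And>x. \<rho> x \<ge> 0" "\<And>x. x \<notin> {0..1} \<Longrightarrow> \<rho> x = 0"
    and B: "\<And>x. (B has_real_derivative \<rho> x) (at x)" "\<And>x. x \<le> 0 \<Longrightarrow> B x = 0" "\<And>x. x \<ge> 1 \<Longrightarrow> B x = 1"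
  shows "(\<lambda>n. integral {0<..<T} (\<lambda>x. real n * \<rho> (real n * (x - a)) * f x)) \<longlonglongrightarrow> f a"
proof (rule LIMSEQ_I)
  fix e :: real assume "0 < e"
  have "isCont f a" using f a by (simp add: continuous_on_interior)
  then obtain d where d: "d > 0" "\<And>x. \<bar>x - a\<bar> < d \<Longrightarrow> \<bar>f x - f a\<bar> < e / 2"
    using \<open>0 < e\<close> unfolding continuous_at_real_range by (metis half_gt_zero real_norm_def)
  \<comment> \<open>Beyond \<open>N\<close> the support \<open>{a..a + 1 / n}\<close> is shorter
    than \<open>d\<close> and remains inside \<open>{0<..<T}\<close>.\<close>
  obtain N :: nat where N: "1 / min d (T - a) < real N" using reals_Archimedean2 by blast
  have "norm (integral {0<..<T} (\<lambda>x. real n * \<rho> (real n * (x - a)) * f x) - f a) < e" if "n \<ge> N" for n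
  proof -
    define m where "m = real n"
    have m: "1 / min d (T - a) < m" using N that by (simp add: m_def)
    have mp: "m > 0" using m d a by (smt (verit) divide_pos_pos)
    have "min d (T - a) > 0" using d(1) a by simp
    then have m1: "1 / m < min d (T - a)"
      using m mp unfolding divide_less_eq by (simp add: mult.commute del: min_less_iff_conj)
    define k where "k x = m * \<rho> (m * (x - a))" for x
    have k0: "k x = 0" if "x \<notin> {a..a + 1 / m}" for x
    proof -
      have "m * (x - a) \<notin> {0..1}"
        using that mp by (auto simp: zero_le_mult_iff field_simps)
      then show ?thesis using \<rho>(3) by (simp add: k_def)
    qed
    have kge: "k x \<ge> 0" for x using \<rho>(2) mp by (simp add: k_def)
    have kc: "continuous_on A k" for A
    proof -
      have "continuous_on A (\<lambda>x. \<rho> (m * (x - a)))"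
        by (intro continuous_at_imp_continuous_on ballI isCont_o2[OF _ \<rho>(1)] continuous_intros)
      then show ?thesis
        unfolding k_def[abs_def] by (intro continuous_on_mult continuous_on_const)
    qed
    have k1: "(k has_integral 1) {a..a + 1 / m}"
    proof -
      have "((\<lambda>x. B (m * (x - a))) has_real_derivative k x) (at x within {a..a + 1 / m})" for x
      proof -
        have "((\<lambda>x. B (m * (x - a))) has_real_derivative \<rho> (m * (x - a)) * m) (at x)"
          by (rule DERIV_chain2[OF B(1)]) (auto intro!: derivative_eq_intros)
        then show ?thesis
          by (simp add: k_def mult.commute has_field_derivative_at_within)
      qed
      then have "(k has_integral B (m * (a + 1 / m - a)) - B (m * (a - a))) {a..a + 1 / m}"
        using mp by (intro fundamental_theorem_of_calculus)
          (auto simp: has_real_derivative_iff_has_vector_derivative)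
      then show ?thesis using B(2)[of 0] B(3)[of 1] mp by simp
    qed
    have fc: "continuous_on {a..a + 1 / m} f"
      using f by (rule continuous_on_subset) (use a m1 in auto)
    have sup: "integral {0<..<T} (\<lambda>x. k x * f x) = integral {a..a + 1 / m} (\<lambda>x. k x * f x)"
      by (rule integral_eq_on_support) (use a m1 k0 in auto)
    have "integral {0<..<T} (\<lambda>x. k x * f x) - f a = integral {a..a + 1 / m} (\<lambda>x. k x * f x) - integral {a..a + 1 / m} (\<lambda>x. k x * f a)"
      using integral_unique[OF k1] sup by simp
    also have "\<dots> = integral {a..a + 1 / m} (\<lambda>x. k x * (f x - f a))"
      by (subst integral_diff[symmetric])
        (auto simp: algebra_simps intro!: integrable_continuous_real continuous_intros fc kc)
    finally have eq: "integral {0<..<T} (\<lambda>x. k x * f x) - f a = integral {a..a + 1 / m} (\<lambda>x. k x * (f x - f a))" .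
    have "norm (integral {a..a + 1 / m} (\<lambda>x. k x * (f x - f a))) \<le> integral {a..a + 1 / m} (\<lambda>x. k x * (e / 2))"
    proof (rule integral_norm_bound_integral)
      show "norm (k x * (f x - f a)) \<le> k x * (e / 2)" if "x \<in> {a..a + 1 / m}" for x
      proof -
        have "\<bar>x - a\<bar> < d" using that m1 by auto
        then have "\<bar>f x - f a\<bar> \<le> e / 2" using d(2)[of x] by simp
        from mult_left_mono[OF this kge[of x]] show ?thesis using kge[of x] by (simp add: abs_mult)
      qed
    qed (auto intro!: integrable_continuous_real continuous_intros fc kc)
    also have "\<dots> = e / 2"
      using integral_unique[OF k1] by simp
    finally show ?thesis using eq \<open>0 < e\<close> by (simp add: k_def m_def)
  qed
  then show "\<exists>N. \<forall>n\<ge>N. norm (integral {0<..<T} (\<lambda>x. real n * \<rho> (real n * (x - a)) * f x) - f a) < e"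
    by blast
qed

section \<open>Classical regularity of real functions from weak derivatives\<close>

lemma test_function_iff_smooth:
  "test_function T \<phi> \<longleftrightarrow> smooth \<phi> \<and> (\<exists>a b. 0 < a \<and> b < T \<and> (\<forall>t. t \<notin> {a..b} \<longrightarrow> \<phi> t = 0))"
  by (simp add: test_function_def smooth_def)

lemma test_function_deriv:
  assumes "test_function T \<phi>"
  shows "test_function T (deriv \<phi>)"
proof -
  obtain a b where ab: "0 < a" "b < T" "\<And>t. t \<notin> {a..b} \<Longrightarrow> \<phi> t = 0"
    using assms by (auto simp: test_function_iff_smooth)
  have "deriv \<phi> t = 0" if "t \<notin> {a..b}" for t
  proof -
    have "(\<phi> has_real_derivative 0) (at t)"
      by (rule has_field_derivative_transform_within_open[of "\<lambda>x. 0" _ _ "- {a..b}"])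
        (use that ab in auto)
    then show ?thesis by (rule DERIV_imp_deriv)
  qed
  then show ?thesis
    using assms ab smooth_deriv unfolding test_function_iff_smooth by blast
qed

lemma DERIV_if_linear_approximation:
  fixes f :: "real \<Rightarrow> real"
  assumes "\<And>e. e > 0 \<Longrightarrow> \<exists>d>0. \<forall>y. \<bar>y - x\<bar> < d \<longrightarrow> \<bar>f y - f x - D * (y - x)\<bar> \<le> e * \<bar>y - x\<bar>"
  shows "(f has_real_derivative D) (at x)"
  unfolding has_field_derivative_def has_derivative_at_alt
  using assms by (simp add: bounded_linear_mult_right)

text \<open>Cauchy's formula for repeated integration, with \<open>q\<close> merely bounded.
  Splitting \<open>z - x\<close> as \<open>(y - x) + (z - y)\<close> leaves as error the integral of
  \<open>(z - x) * q x\<close> between \<open>y\<close> and \<open>z\<close>, which is quadratic in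
  \<open>z - y\<close>.\<close>

lemma double_primitive_DERIV:
  fixes q :: "real \<Rightarrow> real"
  assumes q: "\<And>c d. {c..d} \<subseteq> {a..b} \<Longrightarrow> q integrable_on {c..d}"
    and K: "\<And>x. x \<in> {a..b} \<Longrightarrow> \<bar>q x\<bar> \<le> K"
    and xq: "\<And>c d. {c..d} \<subseteq> {a..b} \<Longrightarrow> (\<lambda>x. x * q x) integrable_on {c..d}"
    and y: "a < y" "y < b"
  shows "((\<lambda>y. integral {a..y} (\<lambda>x. (y - x) * q x)) has_real_derivative integral {a..y} q) (at y)"
proof (rule DERIV_if_linear_approximation)
  fix e :: real assume e: "e > 0"
  define L where "L y = integral {a..y} (\<lambda>x. (y - x) * q x)" for y
  have "K \<ge> 0" using K[of y] y by auto
  \<comment> \<open>The last bound gives \<open>K * d \<le> e\<close>, which absorbs the quadratic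
    error; the 1 covers \<open>K = 0\<close>.\<close>
  define d where "d = min (min (y - a) (b - y)) (e / (K + 1))"
  have d: "d > 0" using y e \<open>K \<ge> 0\<close> by (simp add: d_def)
  have int: "(\<lambda>x. (z - x) * q x) integrable_on {c..d}" if "{c..d} \<subseteq> {a..b}" for z c d
  proof -
    have "(\<lambda>x. z * q x - x * q x) integrable_on {c..d}"
      using integrable_diff[OF integrable_on_cmult_left[OF q[OF that], of z] xq[OF that]] by simp
    then show ?thesis by (simp add: left_diff_distrib)
  qed
  have bd: "\<bar>integral {c..d} (\<lambda>x. (z - x) * q x)\<bar> \<le> K * (d - c) * (d - c)"
    if "{c..d} \<subseteq> {a..b}" "c \<le> d" "z \<in> {c, d}" for z c d
  proof -
    have "norm (integral {c..d} (\<lambda>x. (z - x) * q x)) \<le> integral {c..d} (\<lambda>x. (d - c) * K)"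
    proof (rule integral_norm_bound_integral)
      show "norm ((z - x) * q x) \<le> (d - c) * K" if x: "x \<in> {c..d}" for x
      proof -
        have "\<bar>z - x\<bar> \<le> d - c" using x \<open>z \<in> {c, d}\<close> by auto
        moreover have "\<bar>q x\<bar> \<le> K" using K x \<open>{c..d} \<subseteq> {a..b}\<close> by blast
        ultimately show ?thesis by (simp add: abs_mult mult_mono)
      qed
    qed (use int that in auto)
    also have "\<dots> = K * (d - c) * (d - c)" using that by simp
    finally show ?thesis by simp
  qed
  have "\<bar>L z - L y - integral {a..y} q * (z - y)\<bar> \<le> e * \<bar>z - y\<bar>" if z: "\<bar>z - y\<bar> < d" for z
  proof -
    have zab: "a < z" "z < b" using z by (auto simp: d_def)
    have eq: "L z - L y - integral {a..y} q * (z - y)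
      = integral {a..z} (\<lambda>x. (z - x) * q x) - integral {a..y} (\<lambda>x. (z - x) * q x)"
    proof -
      have "integral {a..y} (\<lambda>x. (z - x) * q x) = integral {a..y} (\<lambda>x. (y - x) * q x + (z - y) * q x)"
        by (simp add: algebra_simps)
      also have "\<dots> = L y + (z - y) * integral {a..y} q"
        unfolding L_def using int[of a y y] integrable_on_cmult_left[OF q[of a y], of "z - y"] y
        by (subst integral_add) auto
      finally show ?thesis by (simp add: L_def)
    qed
    have "\<bar>integral {a..z} (\<lambda>x. (z - x) * q x) - integral {a..y} (\<lambda>x. (z - x) * q x)\<bar> \<le> K * \<bar>z - y\<bar> * \<bar>z - y\<bar>"
    proof (cases "y \<le> z")
      case True
      have "integral {a..y} (\<lambda>x. (z - x) * q x) + integral {y..z} (\<lambda>x. (z - x) * q x) = integral {a..z} (\<lambda>x. (z - x) * q x)"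
        by (rule Henstock_Kurzweil_Integration.integral_combine) (use True y zab int in auto)
      then show ?thesis using bd[of y z z] True y zab by auto
    next
      case False
      have "integral {a..z} (\<lambda>x. (z - x) * q x) + integral {z..y} (\<lambda>x. (z - x) * q x) = integral {a..y} (\<lambda>x. (z - x) * q x)"
        by (rule Henstock_Kurzweil_Integration.integral_combine) (use False y zab int in auto)
      then show ?thesis using bd[of z y z] False y zab by auto
    qed
    also have "\<dots> \<le> e * \<bar>z - y\<bar>"
    proof -
      have "\<bar>z - y\<bar> * (K + 1) \<le> e" using z \<open>K \<ge> 0\<close> by (simp add: d_def field_simps)
      then have "K * \<bar>z - y\<bar> \<le> e" by (simp add: algebra_simps)
      then show ?thesis by (rule mult_right_mono) simp
    qed
    finally show ?thesis using eq by simp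
  qed
  then show "\<exists>d>0. \<forall>z. \<bar>z - y\<bar> < d \<longrightarrow>
     \<bar>integral {a..z} (\<lambda>x. (z - x) * q x) - integral {a..y} (\<lambda>x. (y - x) * q x) - integral {a..y} q * (z - y)\<bar> \<le> e * \<bar>z - y\<bar>"
    unfolding L_def[symmetric] using d by blast
qed

text \<open>Tested with smooth approximations of the hat function with nodes \<open>a < y < b\<close>.\<close>

lemma weak_second_derivative_hat:
  fixes f q :: "real \<Rightarrow> real"
  assumes f: "continuous_on {0..T} f"
    and q: "q \<in> borel_measurable (lebesgue_on {0<..<T})" "\<And>x. x \<in> {0<..<T} \<Longrightarrow> \<bar>q x\<bar> \<le> K"
    and weak: "\<And>\<phi>. test_function T \<phi> \<Longrightarrow>
       integral {0<..<T} (\<lambda>x. deriv (deriv \<phi>) x * f x) = integral {0<..<T} (\<lambda>x. \<phi> x * q x)"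
    and ab: "0 < a" "a \<le> y" "y \<le> b" "b < T" and l: "l1 + l2 = 1" "l1 * a + l2 * b = y"
  shows "l1 * f a - f y + l2 * f b
    = integral {0<..<T} (\<lambda>x. (l1 * max 0 (x - a) - max 0 (x - y) + l2 * max 0 (x - b)) * q x)"
proof -
  obtain C B \<rho> c where C: "smooth C" "\<And>x. (C has_real_derivative B x) (at x)"
    and B: "\<And>x. (B has_real_derivative \<rho> x) (at x)"
    and \<rho>: "smooth \<rho>" "\<And>x. \<rho> x \<ge> 0" "\<And>x. x \<notin> {0..1} \<Longrightarrow> \<rho> x = 0"
    and B01: "\<And>x. x \<le> 0 \<Longrightarrow> B x = 0" "\<And>x. x \<ge> 1 \<Longrightarrow> B x = (1::real)"
    and Cle: "\<And>x. \<bar>C x\<bar> \<le> \<bar>x\<bar>" and C01: "\<And>x. x \<le> 0 \<Longrightarrow> C x = 0" "\<And>x. x \<ge> 1 \<Longrightarrow> C x = x - c"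
    by (rule smooth_ramp_exists) blast
  \<comment> \<open>\<open>R d n\<close> smooths \<open>max 0 (x - d)\<close>. Each kink contributes
    an approximate identity to the second derivative, so \<open>deriv (deriv (\<phi> n))\<close>
    concentrates at the three nodes with weights \<open>l1\<close>, -1 and
    \<open>l2\<close>.\<close>
  define R where "R d n x = C (real n * (x - d)) / real n" for n :: nat and d x
  define \<phi> where "\<phi> n x = l1 * R a n x - R y n x + l2 * R b n x" for n :: nat and x
  define \<psi> where "\<psi> d n x = real n * \<rho> (real n * (x - d))" for n :: nat and d x
  define \<theta> where "\<theta> n x = l1 * B (real n * (x - a)) - B (real n * (x - y)) + l2 * B (real n * (x - b))" for n :: nat and x
  have lin: "((\<lambda>x. real n * (x - d)) has_real_derivative real n) (at x)" for n d x
    by (auto intro!: derivative_eq_intros)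
  have dB: "((\<lambda>x. B (real n * (x - d))) has_real_derivative \<psi> d n x) (at x)" for n d x
    using DERIV_chain2[OF B lin] by (simp add: \<psi>_def mult.commute)
  have dR: "(R d n has_real_derivative B (real n * (x - d))) (at x)" if "n > 0" for n d x
  proof -
    have "((\<lambda>x. C (real n * (x - d)) / real n) has_real_derivative B (real n * (x - d)) * real n / real n) (at x)"
      by (intro DERIV_cdivide DERIV_chain2[OF C(2) lin])
    then show ?thesis using that by (simp add: R_def[abs_def])
  qed
  have "(\<phi> n has_real_derivative \<theta> n x) (at x)" if "n > 0" for n x
    unfolding \<phi>_def[abs_def] \<theta>_def by (intro DERIV_add DERIV_diff DERIV_cmult dR that)
  then have d1: "deriv (\<phi> n) = \<theta> n" if "n > 0" for n
    using that DERIV_imp_deriv by blast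
  have "(\<theta> n has_real_derivative l1 * \<psi> a n x - \<psi> y n x + l2 * \<psi> b n x) (at x)" for n x
    unfolding \<theta>_def[abs_def] by (intro DERIV_add DERIV_diff DERIV_cmult dB)
  then have deriv: "deriv (deriv (\<phi> n)) x = l1 * \<psi> a n x - \<psi> y n x + l2 * \<psi> b n x" if "n > 0" for n x
    using d1[OF that] DERIV_imp_deriv by metis
  have s\<phi>: "smooth (\<phi> n)" for n
  proof -
    have "smooth (\<lambda>x. r * R d n x)" for r d
      using smooth_affine_compose[OF C(1), of "r / real n" "real n" "- real n * d"]
      by (simp add: R_def algebra_simps)
    from smooth_add[OF smooth_add[OF this[of l1 a] this[of "-1" y]] this[of l2 b]] show ?thesis
      by (simp add: \<phi>_def[abs_def])
  qed
  have ev: "eventually (\<lambda>n. n > 0 \<and> 1 / (T - b) < real n) sequentially"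
    using filterlim_real_sequentially eventually_gt_at_top[of 0]
    by (intro eventually_conj) (simp_all add: filterlim_at_top_dense)
  have test: "test_function T (\<phi> n)" if n: "n > 0" "1 / (T - b) < real n" for n
  proof -
    have n0: "0 < real n" using n by simp
    have 1: "b + 1 / real n < T" using n ab n0 by (simp add: field_simps)
    have 2: "\<phi> n x = 0" if x: "x \<notin> {a..b + 1 / real n}" for x
    proof (cases "x < a")
      case True
      then show ?thesis using C01(1) ab n0 by (simp add: \<phi>_def R_def mult_nonneg_nonpos)
    next
      case False
      then have "x - b \<ge> 1 / real n" using x by auto
      then have *: "real n * (x - b) \<ge> 1" using n0 by (simp add: field_simps)
      have "R d n x = x - d - c / real n" if "d \<le> b" for d
      proof -
        have "real n * (x - d) \<ge> real n * (x - b)" using that by (simp add: mult_left_mono)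
        then have "real n * (x - d) \<ge> 1" using * by simp
        then have "C (real n * (x - d)) = real n * (x - d) - c" by (rule C01(2))
        then show ?thesis using n0 by (simp add: R_def diff_divide_distrib)
      qed
      \<comment> \<open>Beyond all transitions every ramp is affine with slope 1 and the same offset
        \<open>c / n\<close>, so the two conditions on \<open>l1\<close> and \<open>l2\<close>
        cancel both the slope and the constant: \<open>\<phi> n\<close> has compact support.\<close>
      then have "\<phi> n x = l1 * (x - a - c / real n) - (x - y - c / real n) + l2 * (x - b - c / real n)"
        using ab by (simp add: \<phi>_def)
      also have "\<dots> = (l1 + l2 - 1) * (x - c / real n) - (l1 * a + l2 * b - y)"
        by (simp add: algebra_simps add_divide_distrib)
      finally show ?thesis using l by simp
    qed
    show ?thesis
      unfolding test_function_iff_smooth using s\<phi> 1 2 ab by blast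
  qed
  have sm: "continuous_on A (\<lambda>x. \<psi> d n x)" for A d n
  proof -
    have "continuous_on A (\<lambda>x. \<rho> (real n * (x - d)))"
      by (intro continuous_at_imp_continuous_on ballI isCont_o2[OF _ smooth_isCont[OF \<rho>(1)]] continuous_intros)
    then show ?thesis
      unfolding \<psi>_def by (intro continuous_on_mult continuous_on_const)
  qed
  have lim1: "(\<lambda>n. integral {0<..<T} (\<lambda>x. \<psi> d n x * f x)) \<longlonglongrightarrow> f d" if "0 < d" "d < T" for d
    unfolding \<psi>_def by (rule bump_integral_tendsto[OF f that smooth_isCont[OF \<rho>(1)] \<rho>(2,3) B B01])
  have int1: "(\<lambda>x. r * (\<psi> d n x * f x)) integrable_on {0<..<T}" for d n r
  proof -
    have "(\<lambda>x. r * (\<psi> d n x * f x)) integrable_on {0..T}"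
      by (intro integrable_continuous_real continuous_on_mult continuous_on_const f sm)
    then show ?thesis by (simp add: integrable_on_open_interval_real)
  qed
  define hat where "hat x = l1 * max 0 (x - a) - max 0 (x - y) + l2 * max 0 (x - b)" for x
  define M where "M = (\<bar>l1\<bar> + 1 + \<bar>l2\<bar>) * T"
  have lim2: "(\<lambda>n. integral {0<..<T} (\<lambda>x. \<phi> n x * q x)) \<longlonglongrightarrow> integral {0<..<T} (\<lambda>x. hat x * q x)"
  proof (rule dominated_convergence(2))
    have "continuous_on A (\<phi> n)" for A n
      using smooth_isCont[OF s\<phi>] by (intro continuous_at_imp_continuous_on) auto
    then have "\<phi> n \<in> borel_measurable (lebesgue_on {0<..<T})" for n
      by (simp add: continuous_imp_measurable_on_sets_lebesgue)
    then have m: "(\<lambda>x. \<phi> n x * q x) \<in> borel_measurable (lebesgue_on {0<..<T})" for n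
      using q(1) by measurable
    have b: "\<bar>\<phi> n x * q x\<bar> \<le> M * K" if "x \<in> {0<..<T}" for n x
    proof -
      \<comment> \<open>Since \<open>C\<close> grows no faster than the identity, the ramps are
        bounded uniformly in \<open>n\<close>, as dominated convergence requires.\<close>
      have R: "\<bar>R d n x\<bar> \<le> T" if "0 < d" "d < T" for d
      proof (cases "n = 0")
        case False
        have "\<bar>R d n x\<bar> \<le> \<bar>x - d\<bar>"
          using Cle[of "real n * (x - d)"] False by (simp add: R_def abs_mult divide_le_eq mult.commute)
        then show ?thesis using that \<open>x \<in> {0<..<T}\<close> by auto
      qed (use ab in \<open>simp add: R_def\<close>)
      have "\<bar>\<phi> n x\<bar> \<le> \<bar>l1\<bar> * \<bar>R a n x\<bar> + \<bar>R y n x\<bar> + \<bar>l2\<bar> * \<bar>R b n x\<bar>"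
        unfolding \<phi>_def abs_mult[symmetric] by linarith
      also have "\<dots> \<le> \<bar>l1\<bar> * T + T + \<bar>l2\<bar> * T"
        using ab by (intro add_mono mult_left_mono R) auto
      finally have "\<bar>\<phi> n x\<bar> \<le> M" by (simp add: M_def algebra_simps)
      then show ?thesis
        using q(2)[OF that] mult_mono[of "\<bar>\<phi> n x\<bar>" M "\<bar>q x\<bar>" K] by (simp add: abs_mult)
    qed
    show "(\<lambda>x. \<phi> n x * q x) integrable_on {0<..<T}" for n
      by (rule bounded_measurable_integrable_on[OF m b])
    show "(\<lambda>x. M * K) integrable_on {0<..<T}"
      using integrable_const_ivl[of "M * K" 0 T] integrable_on_open_interval_real[of "\<lambda>x. M * K" 0 T] by auto
    show "norm (\<phi> n x * q x) \<le> M * K" if "x \<in> {0<..<T}" for n x using b[OF that] by simp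
    have R: "(\<lambda>n. R d n x) \<longlonglongrightarrow> max 0 (x - d)" for x d
    proof (cases "x > d")
      case True
      have "eventually (\<lambda>n. 1 / (x - d) < real n) sequentially"
        using filterlim_real_sequentially by (simp add: filterlim_at_top_dense)
      then have "eventually (\<lambda>n. (x - d) - c * inverse (real n) = R d n x) sequentially"
      proof eventually_elim
        case (elim n)
        have "0 < 1 / (x - d)" using True by simp
        then have "real n > 0" using elim by linarith
        moreover have "C (real n * (x - d)) = real n * (x - d) - c"
          by (rule C01(2)) (use elim True in \<open>simp add: field_simps\<close>)
        ultimately show ?case by (simp add: R_def diff_divide_distrib inverse_eq_divide)
      qed
      moreover have "(\<lambda>n. (x - d) - c * inverse (real n)) \<longlonglongrightarrow> (x - d) - c * 0"
        by (intro tendsto_intros lim_inverse_n)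
      ultimately show ?thesis using True Lim_transform_eventually by fastforce
    qed (use C01(1) in \<open>auto simp: R_def mult_nonneg_nonpos\<close>)
    show "(\<lambda>n. \<phi> n x * q x) \<longlonglongrightarrow> hat x * q x" for x
      unfolding \<phi>_def hat_def by (intro tendsto_intros R)
  qed
  have "(\<lambda>n. l1 * integral {0<..<T} (\<lambda>x. \<psi> a n x * f x) - integral {0<..<T} (\<lambda>x. \<psi> y n x * f x)
     + l2 * integral {0<..<T} (\<lambda>x. \<psi> b n x * f x)) \<longlonglongrightarrow> l1 * f a - f y + l2 * f b"
    using ab by (intro tendsto_add tendsto_diff tendsto_mult_left lim1) auto
  moreover have "eventually (\<lambda>n. l1 * integral {0<..<T} (\<lambda>x. \<psi> a n x * f x) - integral {0<..<T} (\<lambda>x. \<psi> y n x * f x)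
     + l2 * integral {0<..<T} (\<lambda>x. \<psi> b n x * f x)
      = integral {0<..<T} (\<lambda>x. \<phi> n x * q x)) sequentially"
    using ev
  proof eventually_elim
    case (elim n)
    have "integral {0<..<T} (\<lambda>x. deriv (deriv (\<phi> n)) x * f x)
       = integral {0<..<T} (\<lambda>x. l1 * (\<psi> a n x * f x) - 1 * (\<psi> y n x * f x) + l2 * (\<psi> b n x * f x))"
    proof (rule integral_cong)
      fix x
      have "deriv (deriv (\<phi> n)) x = l1 * \<psi> a n x - \<psi> y n x + l2 * \<psi> b n x"
        using deriv elim by blast
      then show "deriv (deriv (\<phi> n)) x * f x = l1 * (\<psi> a n x * f x) - 1 * (\<psi> y n x * f x) + l2 * (\<psi> b n x * f x)"
        by (simp only:) (simp add: algebra_simps)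
    qed
    also have "\<dots> = l1 * integral {0<..<T} (\<lambda>x. \<psi> a n x * f x) - integral {0<..<T} (\<lambda>x. \<psi> y n x * f x)
     + l2 * integral {0<..<T} (\<lambda>x. \<psi> b n x * f x)"
      using int1[of 1] by (subst integral_add integral_diff; (intro int1 integrable_diff)?)+ simp
    finally show ?case using weak[OF test] elim by simp
  qed
  ultimately have "(\<lambda>n. integral {0<..<T} (\<lambda>x. \<phi> n x * q x)) \<longlonglongrightarrow> l1 * f a - f y + l2 * f b"
    by (rule Lim_transform_eventually)
  then show ?thesis
    unfolding hat_def[symmetric] by (rule LIMSEQ_unique[OF _ lim2])
qed

text \<open>With \<open>a\<close> and \<open>b\<close> fixed and the middle node \<open>y\<close>
  moving, the hat identity expresses \<open>f y\<close> as the double primitive of \<open>q\<close>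
  plus an affine function of \<open>y\<close>. Both are differentiable, the former with the
  primitive of \<open>q\<close> as derivative.\<close>

theorem weak_second_derivative_imp_C1:
  fixes f q :: "real \<Rightarrow> real"
  assumes f: "continuous_on {0..T} f"
    and q: "q \<in> borel_measurable (lebesgue_on {0<..<T})" "\<And>x. x \<in> {0<..<T} \<Longrightarrow> \<bar>q x\<bar> \<le> K"
    and weak: "\<And>\<phi>. test_function T \<phi> \<Longrightarrow>
       integral {0<..<T} (\<lambda>x. deriv (deriv \<phi>) x * f x) = integral {0<..<T} (\<lambda>x. \<phi> x * q x)"
    and ab: "0 < a" "a < b" "b < T"
  obtains f' where "\<And>t. t \<in> {a<..<b} \<Longrightarrow> (f has_real_derivative f' t) (at t)"
    "\<And>s t. a < s \<Longrightarrow> s \<le> t \<Longrightarrow> t < b \<Longrightarrow> f' t - f' s = integral {s..t} q"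
proof -
  have q_int: "q integrable_on {c..d}" if "{c..d} \<subseteq> {a..b}" for c d
    using integrable_on_subinterval[OF bounded_measurable_integrable_on[OF q], of c d] that ab by force
  have xq_int: "(\<lambda>x. x * q x) integrable_on {c..d}" if "{c..d} \<subseteq> {a..b}" for c d
  proof (rule integrable_on_subinterval[OF bounded_measurable_integrable_on])
    show "(\<lambda>x. x * q x) \<in> borel_measurable (lebesgue_on {0<..<T})"
      by (intro borel_measurable_times q(1) continuous_imp_measurable_on_sets_lebesgue continuous_on_id) simp
    show "\<bar>x * q x\<bar> \<le> T * K" if "x \<in> {0<..<T}" for x
      using that q(2)[OF that] by (auto simp: abs_mult intro!: mult_mono)
    show "{c..d} \<subseteq> {0<..<T}" using that ab by force
  qed
  define L where "L y = integral {a..y} (\<lambda>x. (y - x) * q x)" for y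
  define P where "P = integral {a..b} (\<lambda>x. x * q x)"
  define Q where "Q = integral {a..b} q"
  define r where "r = (P - a * Q) / (b - a)"
  \<comment> \<open>Collects everything in the hat identity that is affine in \<open>y\<close>: the
    interpolation of \<open>f\<close> between the nodes and the terms from the moments
    \<open>P\<close>, \<open>Q\<close> of \<open>q\<close>.\<close>
  define A where "A y = (b - y) * (f a / (b - a)) + (y - a) * (f b / (b - a))
     - (b - y) * r + (P - y * Q)" for y
  have fL: "f y = L y + A y" if y: "y \<in> {a..b}" for y
  proof -
    define l1 l2 where "l1 = (b - y) / (b - a)" and "l2 = (y - a) / (b - a)"
    have "l1 + l2 = ((b - y) + (y - a)) / (b - a)" "l1 * a + l2 * b = y * (b - a) / (b - a)"
      unfolding l1_def l2_def by (simp_all only: add_divide_distrib[symmetric] times_divide_eq_left) (simp add: algebra_simps)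
    then have l: "l1 + l2 = 1" "l1 * a + l2 * b = y" using ab by simp_all
    have int: "(\<lambda>x. (z - x) * q x) integrable_on {c..d}" if "{c..d} \<subseteq> {a..b}" for z c d
      using integrable_diff[OF integrable_on_cmult_left[OF q_int[OF that], of z] xq_int[OF that]]
      by (simp add: left_diff_distrib)
    have int': "(\<lambda>x. (x - z) * q x) integrable_on {c..d}" if "{c..d} \<subseteq> {a..b}" for z c d
      using integrable_neg[OF int[OF that, of z]] by (simp add: algebra_simps)
    have Pz: "integral {a..b} (\<lambda>x. (x - z) * q x) = P - z * Q" for z
      using integral_diff[OF xq_int[of a b] integrable_on_cmult_left[OF q_int[of a b], of z]]
      by (simp add: P_def Q_def left_diff_distrib)
    have "l1 * f a - f y + l2 * f b
      = integral {0<..<T} (\<lambda>x. (l1 * max 0 (x - a) - max 0 (x - y) + l2 * max 0 (x - b)) * q x)"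
      by (rule weak_second_derivative_hat[OF f q weak]) (use ab y l in auto)
    also have "\<dots> = integral {a..b} (\<lambda>x. (l1 * max 0 (x - a) - max 0 (x - y) + l2 * max 0 (x - b)) * q x)"
    proof (rule integral_eq_on_support)
      fix x assume "x \<notin> {a..b}"
      then consider "x < a" | "x > b" by fastforce
      then have "l1 * max 0 (x - a) - max 0 (x - y) + l2 * max 0 (x - b) = 0"
      proof cases
        case 2
        then have "l1 * max 0 (x - a) - max 0 (x - y) + l2 * max 0 (x - b) = (l1 + l2 - 1) * x - (l1 * a + l2 * b - y)"
          using y by (simp add: algebra_simps)
        then show ?thesis using l by simp
      qed (use y in auto)
      then show "(l1 * max 0 (x - a) - max 0 (x - y) + l2 * max 0 (x - b)) * q x = 0" by simp
    qed (use ab in auto)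
    \<comment> \<open>On \<open>{a..b}\<close> the kink at \<open>y\<close> is rewritten by
      \<open>max 0 (x - y) = (x - y) + max 0 (y - x)\<close>: the first part leads to a term affine
      in \<open>y\<close>, the second is the integrand of \<open>L y\<close>. The ramp at
      \<open>b\<close> vanishes.\<close>
    also have "\<dots> = integral {a..b} (\<lambda>x. l1 * ((x - a) * q x) - (x - y) * q x - (if x \<in> {a..y} then (y - x) * q x else 0))"
      by (rule integral_cong) (auto simp: max_def algebra_simps)
    also have "\<dots> = l1 * (P - a * Q) - (P - y * Q) - L y"
    proof -
      have i3: "((\<lambda>x. if x \<in> {a..y} then (y - x) * q x else 0) has_integral L y) {a..b}"
        unfolding L_def using has_integral_restrict_closed_subinterval[of "\<lambda>x. (y - x) * q x" _ a y a b]
          integrable_integral[OF int[of a y y]] y by (simp add: subset_iff)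
      have i1: "((\<lambda>x. (x - z) * q x) has_integral (P - z * Q)) {a..b}" for z
        using integrable_integral[OF int'[of a b z]] Pz by simp
      show ?thesis
        by (intro integral_unique has_integral_diff has_integral_mult_right i1 i3)
    qed
    finally show ?thesis by (simp add: A_def l1_def l2_def r_def)
  qed
  obtain m where m: "(A has_real_derivative m) (at y)" for y
  proof
    show "(A has_real_derivative (f b / (b - a) - f a / (b - a) + r - Q)) (at y)" for y
      unfolding A_def[abs_def] using ab by (auto intro!: derivative_eq_intros)
  qed
  show thesis
  proof
    fix t assume t: "t \<in> {a<..<b}"
    have "((\<lambda>y. L y + A y) has_real_derivative integral {a..t} q + m) (at t)"
      unfolding L_def
      by (intro DERIV_add m double_primitive_DERIV[OF q_int _ xq_int, of a b K]) (use ab t q(2) in auto)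
    then show "(f has_real_derivative integral {a..t} q + m) (at t)"
      by (rule has_field_derivative_transform_within_open[of _ _ _ "{a<..<b}"]) (use t fL in auto)
  next
    fix s t assume "a < s" "s \<le> t" "t < b"
    then have "integral {a..s} q + integral {s..t} q = integral {a..t} q"
      by (intro Henstock_Kurzweil_Integration.integral_combine q_int) auto
    then show "integral {a..t} q + m - (integral {a..s} q + m) = integral {s..t} q" by simp
  qed
qed

text \<open>Reduced to second order: the primitive \<open>h\<close> of \<open>f\<close> has weak
  second derivative \<open>p\<close>, so the increments of its derivative are integrals of
  \<open>p\<close>, and by continuity of \<open>f\<close> that derivative is
  \<open>f\<close>.\<close>

corollary weak_derivative_imp_integral:
  fixes f p :: "real \<Rightarrow> real"
  assumes f: "continuous_on {0..T} f"
    and p: "p \<in> borel_measurable (lebesgue_on {0<..<T})" "\<And>x. x \<in> {0<..<T} \<Longrightarrow> \<bar>p x\<bar> \<le> K"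
    and weak: "\<And>\<phi>. test_function T \<phi> \<Longrightarrow>
       integral {0<..<T} (\<lambda>x. deriv \<phi> x * f x) = - integral {0<..<T} (\<lambda>x. \<phi> x * p x)"
    and st: "0 < s" "s \<le> t" "t < T"
  shows "f t - f s = integral {s..t} p"
proof -
  define h where "h x = integral {0..x} f" for x
  have h: "(h has_real_derivative f x) (at x within {0..T})" if "x \<in> {0..T}" for x
    unfolding h_def using integral_has_real_derivative[OF f that] .
  have hc: "continuous_on {0..T} h"
    using h DERIV_continuous_on by blast
  have weak2: "integral {0<..<T} (\<lambda>x. deriv (deriv \<phi>) x * h x) = integral {0<..<T} (\<lambda>x. \<phi> x * p x)"
    if \<phi>: "test_function T \<phi>" for \<phi>
  proof -
    have s: "smooth (deriv \<phi>)" "smooth (deriv (deriv \<phi>))"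
      using \<phi> by (auto simp: test_function_iff_smooth intro: smooth_deriv)
    obtain a b where ab: "0 < a" "b < T" and z: "\<And>t. t \<notin> {a..b} \<Longrightarrow> deriv \<phi> t = 0"
      using test_function_deriv[OF \<phi>] by (auto simp: test_function_iff_smooth)
    \<comment> \<open>The boundary terms vanish, so integrating the derivative of
      \<open>deriv \<phi> x * h x\<close> moves one derivative from the test function to
      \<open>h\<close>.\<close>
    have "deriv \<phi> 0 = 0" "deriv \<phi> T = 0" by (rule z, use ab in simp)+
    moreover have "((\<lambda>x. deriv \<phi> x * f x + deriv (deriv \<phi>) x * h x) has_integral
      deriv \<phi> T * h T - deriv \<phi> 0 * h 0) {0..T}"
    proof (rule fundamental_theorem_of_calculus[of 0 T "\<lambda>x. deriv \<phi> x * h x"])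
      show "((\<lambda>x. deriv \<phi> x * h x) has_vector_derivative deriv \<phi> x * f x + deriv (deriv \<phi>) x * h x)
        (at x within {0..T})" if "x \<in> {0..T}" for x
        unfolding has_real_derivative_iff_has_vector_derivative[symmetric]
        by (rule DERIV_mult'[OF has_field_derivative_at_within[OF smooth_imp_differentiable[OF s(1)]] h[OF that]])
    qed (use st in simp)
    moreover have "(\<lambda>x. deriv \<phi> x * f x) integrable_on {0..T}" "(\<lambda>x. deriv (deriv \<phi>) x * h x) integrable_on {0..T}"
      by (intro integrable_continuous_real continuous_on_mult f hc continuous_at_imp_continuous_on ballI smooth_isCont s)+
    ultimately have "integral {0..T} (\<lambda>x. deriv \<phi> x * f x) + integral {0..T} (\<lambda>x. deriv (deriv \<phi>) x * h x) = 0"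
      by (simp add: integral_add[symmetric] integral_unique)
    then show ?thesis using weak[OF \<phi>] by (simp add: integral_open_interval_real)
  qed
  obtain h' where h': "\<And>x. x \<in> {s/2<..<(t + T)/2} \<Longrightarrow> (h has_real_derivative h' x) (at x)"
    "\<And>a b. s/2 < a \<Longrightarrow> a \<le> b \<Longrightarrow> b < (t + T)/2 \<Longrightarrow> h' b - h' a = integral {a..b} p"
    by (rule weak_second_derivative_imp_C1[OF hc p weak2, of "s/2" "(t+T)/2"]) (use st in auto)
  have "h' x = f x" if "x \<in> {s, t}" for x
  proof (rule DERIV_unique)
    show "(h has_real_derivative h' x) (at x)" using that st by (intro h'(1)) auto
    show "(h has_real_derivative f x) (at x)"
      using h[of x] that st by (auto simp: at_within_Icc_at)
  qed
  then show ?thesis using h'(2)[of s t] st by auto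
qed

section \<open>Strong measurability\<close>

lemma borel_measurable_AE_limit:
  fixes f :: "real \<Rightarrow> real"
  assumes S: "S \<in> sets lebesgue" and h: "\<And>n::nat. h n \<in> borel_measurable (lebesgue_on S)"
    and lim: "AE t in lebesgue_on S. (\<lambda>n. h n t) \<longlonglongrightarrow> f t"
  shows "f \<in> borel_measurable (lebesgue_on S)"
proof -
  obtain N where N: "N \<in> null_sets (lebesgue_on S)" "\<And>t. t \<in> S - N \<Longrightarrow> (\<lambda>n. h n t) \<longlonglongrightarrow> f t"
    using AE_E3[OF lim] by auto
  have "f \<in> borel_measurable (lebesgue_on (S - N))"
  proof (rule borel_measurable_LIMSEQ_real)
    show "\<And>t. t \<in> space (lebesgue_on (S - N)) \<Longrightarrow> (\<lambda>n. h n t) \<longlonglongrightarrow> f t" using N(2) by auto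
    show "\<And>n. h n \<in> borel_measurable (lebesgue_on (S - N))"
      using h N(1) S by (simp add: borel_measurable_diff_null)
  qed
  then show ?thesis using N(1) S by (simp add: borel_measurable_diff_null)
qed

text \<open>For simple \<open>w\<close> only finitely many values of \<open>y\<close> occur, and
  continuity in \<open>y\<close> carries measurability through the pointwise limit. The integrands
  below that combine two trajectories are handled this way.\<close>

lemma strongly_measurable_Caratheodory:
  fixes w :: "real \<Rightarrow> 'b::real_normed_vector" and \<Phi> :: "'b \<Rightarrow> real \<Rightarrow> real"
  assumes S: "S \<in> sets lebesgue" and w: "strongly_measurable (lebesgue_on S) w"
    and m: "\<And>y. \<Phi> y \<in> borel_measurable (lebesgue_on S)"
    and c: "\<And>y t. isCont (\<lambda>y. \<Phi> y t) y"
  shows "(\<lambda>t. \<Phi> (w t) t) \<in> borel_measurable (lebesgue_on S)"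
proof -
  obtain s where s: "\<And>n::nat. simple_function (lebesgue_on S) (s n)"
    and lim: "AE t in lebesgue_on S. (\<lambda>n. s n t) \<longlonglongrightarrow> w t"
    using w unfolding strongly_measurable_def by auto
  have m': "(\<lambda>t. \<Phi> (s n t) t) \<in> borel_measurable (lebesgue_on S)" for n
  proof (rule measurable_compose_countable'[where I = "s n ` S"])
    show "s n \<in> measurable (lebesgue_on S) (count_space (s n ` S))"
      using simple_functionD[OF s[of n]] by (subst measurable_count_space_eq2) auto
    show "countable (s n ` S)" using simple_functionD(1)[OF s[of n]] by (auto intro: countable_finite)
  qed (use m in auto)
  have lim': "AE t in lebesgue_on S. (\<lambda>n. \<Phi> (s n t) t) \<longlonglongrightarrow> \<Phi> (w t) t"
    using lim
  proof eventually_elim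
    case (elim t)
    show ?case by (rule isCont_tendsto_compose[OF c elim])
  qed
  show ?thesis
    by (rule borel_measurable_AE_limit[where h = "\<lambda>n t. \<Phi> (s n t) t", OF S m' lim'])
qed

lemma strongly_measurable_compose:
  fixes w :: "real \<Rightarrow> 'b::real_normed_vector" and \<Phi> :: "'b \<Rightarrow> real"
  assumes "S \<in> sets lebesgue" "strongly_measurable (lebesgue_on S) w" "\<And>y. isCont \<Phi> y"
  shows "(\<lambda>t. \<Phi> (w t)) \<in> borel_measurable (lebesgue_on S)"
  using strongly_measurable_Caratheodory[of S w "\<lambda>y t. \<Phi> y"] assms by auto

lemma strongly_measurable_pairing:
  fixes w :: "real \<Rightarrow> 'b::real_normed_vector" and z :: "real \<Rightarrow> 'b \<Rightarrow>\<^sub>L real"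
  assumes S: "S \<in> sets lebesgue" and w: "strongly_measurable (lebesgue_on S) w"
    and z: "strongly_measurable (lebesgue_on S) z"
  shows "(\<lambda>t. blinfun_apply (z t) (w t)) \<in> borel_measurable (lebesgue_on S)"
proof (rule strongly_measurable_Caratheodory[OF S w, of "\<lambda>y t. blinfun_apply (z t) y"])
  show "(\<lambda>t. blinfun_apply (z t) y) \<in> borel_measurable (lebesgue_on S)" for y
    by (rule strongly_measurable_compose[OF S z]) (auto intro!: continuous_intros)
qed (auto intro!: continuous_intros)

lemma strongly_measurable_AE_cong:
  assumes "strongly_measurable M f" "AE t in M. f t = g t"
  shows "strongly_measurable M g"
proof -
  obtain s where s: "\<And>n::nat. simple_function M (s n)" "AE t in M. (\<lambda>n. s n t) \<longlonglongrightarrow> f t"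
    using assms(1) unfolding strongly_measurable_def by auto
  have "AE t in M. (\<lambda>n. s n t) \<longlonglongrightarrow> g t" using s(2) assms(2) by eventually_elim auto
  then show ?thesis using s(1) unfolding strongly_measurable_def by blast
qed

text \<open>The images under \<open>l\<close> of the approximating simple functions approximate
  \<open>l (f t)\<close>. Through this lemma the weak derivatives, given by Bochner integrals in V
  or V', become statements about integrals of real functions.\<close>

lemma bochner_has_integral_bounded_linear:
  fixes l :: "'b::real_normed_vector \<Rightarrow> real" and S :: "real set"
  assumes S: "S \<in> sets lebesgue" and l: "bounded_linear l"
    and f: "bochner_has_integral (lebesgue_on S) f I"
  shows "has_bochner_integral (lebesgue_on S) (\<lambda>t. l (f t)) (l I)"
proof -
  let ?M = "lebesgue_on S"
  interpret l: bounded_linear l by fact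
  obtain s where sm: "strongly_measurable ?M f"
    and s: "\<And>n::nat. Bochner_Integration.simple_bochner_integrable ?M (s n)"
    and lim: "(\<lambda>n. \<integral>\<^sup>+ t. ennreal (norm (f t - s n t)) \<partial>?M) \<longlonglongrightarrow> 0"
    and limI: "(\<lambda>n. Bochner_Integration.simple_bochner_integral ?M (s n)) \<longlonglongrightarrow> I"
    using f unfolding bochner_has_integral_def by blast
  obtain K where K: "K > 0" "\<And>x. norm (l x) \<le> norm x * K" using l.pos_bounded by blast
  show ?thesis
  proof (rule has_bochner_integral.intros[of _ _ "\<lambda>n t. l (s n t)"])
    show "(\<lambda>t. l (f t)) \<in> borel_measurable ?M"
      by (rule strongly_measurable_compose[OF S sm]) (simp add: l.isCont)
    show "Bochner_Integration.simple_bochner_integrable ?M (\<lambda>t. l (s n t))" for n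
      by (rule simple_bochner_integrable_compose2[of "\<lambda>x y. l x", OF _ s s]) (simp add: l.zero)
    have "(\<lambda>n. Bochner_Integration.simple_bochner_integral ?M (\<lambda>t. l (s n t))) = (\<lambda>n. l (Bochner_Integration.simple_bochner_integral ?M (s n)))"
      by (intro ext simple_bochner_integral_linear s l.linear)
    then show "(\<lambda>n. Bochner_Integration.simple_bochner_integral ?M (\<lambda>t. l (s n t))) \<longlonglongrightarrow> l I"
      using l.tendsto[OF limI] by simp
    have le: "(\<integral>\<^sup>+ t. ennreal (norm (l (f t) - l (s n t))) \<partial>?M) \<le> ennreal K * (\<integral>\<^sup>+ t. ennreal (norm (f t - s n t)) \<partial>?M)" for n
    proof -
      have sn: "strongly_measurable ?M (\<lambda>t. s n t)"
        unfolding strongly_measurable_def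
        by (rule exI[of _ "\<lambda>_. s n"]) (use s[of n] in \<open>auto elim: simple_bochner_integrable.cases\<close>)
      have m: "(\<lambda>t. norm (f t - s n t)) \<in> borel_measurable ?M"
      proof (rule strongly_measurable_Caratheodory[OF S sm, of "\<lambda>y t. norm (y - s n t)"])
        show "(\<lambda>t. norm (y - s n t)) \<in> borel_measurable ?M" for y
          by (rule strongly_measurable_compose[OF S sn, of "\<lambda>v. norm (y - v)"]) (auto intro!: continuous_intros)
      qed (auto intro!: continuous_intros)
      have "(\<integral>\<^sup>+ t. ennreal (norm (l (f t) - l (s n t))) \<partial>?M) \<le> (\<integral>\<^sup>+ t. ennreal K * ennreal (norm (f t - s n t)) \<partial>?M)"
        using K by (intro nn_integral_mono)
          (simp add: l.diff[symmetric] ennreal_mult''[symmetric] mult.commute ennreal_leI)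
      also have "\<dots> = ennreal K * (\<integral>\<^sup>+ t. ennreal (norm (f t - s n t)) \<partial>?M)"
        by (intro nn_integral_cmult measurable_compose[OF m measurable_ennreal])
      finally show ?thesis .
    qed
    have "(\<lambda>n. ennreal K * (\<integral>\<^sup>+ t. ennreal (norm (f t - s n t)) \<partial>?M)) \<longlonglongrightarrow> ennreal K * 0"
      by (rule tendsto_mult_ennreal[OF tendsto_const lim]) auto
    then have lim0: "(\<lambda>n. ennreal K * (\<integral>\<^sup>+ t. ennreal (norm (f t - s n t)) \<partial>?M)) \<longlonglongrightarrow> 0" by simp
    show "(\<lambda>n. \<integral>\<^sup>+ t. ennreal (norm (l (f t) - l (s n t))) \<partial>?M) \<longlonglongrightarrow> 0"
      by (rule tendsto_sandwich[OF _ _ tendsto_const lim0]) (use le in auto)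
  qed
qed

lemma bochner_has_integral_imp_integral:
  fixes l :: "'b::real_normed_vector \<Rightarrow> real" and T :: real
  assumes "bounded_linear l" "bochner_has_integral (lebesgue_on {0<..<T}) f I"
  shows "integral {0<..<T} (\<lambda>t. l (f t)) = l I"
proof -
  have b: "has_bochner_integral (lebesgue_on {0<..<T}) (\<lambda>t. l (f t)) (l I)"
    by (rule bochner_has_integral_bounded_linear[of _ l f I]) (use assms in auto)
  then show ?thesis
    using lebesgue_integral_eq_integral[of "{0<..<T}" "\<lambda>t. l (f t)"]
    by (simp add: has_bochner_integral_iff)
qed

lemma weak_derivative_bounded_linear:
  fixes l :: "'b::real_normed_vector \<Rightarrow> real"
  assumes l: "bounded_linear l" and "weak_derivative T f f'" "test_function T \<phi>"
  shows "integral {0<..<T} (\<lambda>t. deriv \<phi> t * l (f t)) = - integral {0<..<T} (\<lambda>t. \<phi> t * l (f' t))"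
proof -
  interpret l: bounded_linear l by fact
  obtain I where I: "bochner_has_integral (lebesgue_on {0<..<T}) (\<lambda>t. deriv \<phi> t *\<^sub>R f t) I"
    "bochner_has_integral (lebesgue_on {0<..<T}) (\<lambda>t. \<phi> t *\<^sub>R f' t) (- I)"
    using assms(2,3) unfolding weak_derivative_def by blast
  show ?thesis
    using bochner_has_integral_imp_integral[OF l I(1)] bochner_has_integral_imp_integral[OF l I(2)]
    by (simp add: l.scaleR l.neg)
qed

section \<open>Continuous approximation of strongly measurable functions\<close>

lemma simple_function_measurable_on:
  fixes s :: "real \<Rightarrow> 'b::real_normed_vector"
  assumes S: "S \<in> sets lebesgue" and s: "simple_function (lebesgue_on S) s"
  shows "s measurable_on S"
proof -
  have fin: "finite (s ` S)" using simple_functionD(1)[OF s] by simp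
  have "(\<lambda>t. \<Sum>y\<in>s ` S. indicat_real (s -` {y} \<inter> S) t *\<^sub>R y) measurable_on UNIV"
  proof (intro measurable_on_sum fin measurable_on_scaleR indicator_measurable_on)
    show "s -` {y} \<inter> S \<in> sets lebesgue" for y
      using simple_functionD(2)[OF s, of "{y}"] S by (simp add: sets_restrict_space_iff)
    show "(\<lambda>t. y) measurable_on UNIV" for y :: 'b by (rule measurable_on_const_UNIV)
  qed
  moreover have "(\<Sum>y\<in>s ` S. indicat_real (s -` {y} \<inter> S) t *\<^sub>R y) = (if t \<in> S then s t else 0)" for t
  proof (cases "t \<in> S")
    case True
    have "(\<Sum>y\<in>s ` S. indicat_real (s -` {y} \<inter> S) t *\<^sub>R y) = (\<Sum>y\<in>{s t}. indicat_real (s -` {y} \<inter> S) t *\<^sub>R y)"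
      by (rule sum.mono_neutral_right) (use True fin in \<open>auto simp: indicator_def\<close>)
    then show ?thesis using True by simp
  qed (auto simp: indicator_def)
  ultimately show ?thesis by (simp add: measurable_on_UNIV)
qed

lemma bounded_tendsto_integral_0:
  fixes h :: "nat \<Rightarrow> real \<Rightarrow> real"
  assumes m: "\<And>n. h n \<in> borel_measurable (lebesgue_on {0<..<T})"
    and b: "\<And>n t. t \<in> {0<..<T} \<Longrightarrow> \<bar>h n t\<bar> \<le> K"
    and lim: "AE t in lebesgue_on {0<..<T}. (\<lambda>n. h n t) \<longlonglongrightarrow> 0"
  shows "(\<lambda>n. integral {0<..<T} (h n)) \<longlonglongrightarrow> 0"
proof -
  let ?M = "lebesgue_on {0<..<T}"
  interpret finite_measure ?M
    by (rule finite_measure_lebesgue_on) auto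
  have bAE: "AE t in ?M. norm (h n t) \<le> K" for n
    using b by (intro AE_I2) auto
  have "(\<lambda>n. integral\<^sup>L ?M (h n)) \<longlonglongrightarrow> integral\<^sup>L ?M (\<lambda>t. 0)"
    by (rule integral_dominated_convergence[OF _ m _ lim bAE]) auto
  moreover have "integral\<^sup>L ?M (h n) = integral {0<..<T} (h n)" for n
    using integrable_const_bound[OF bAE m] by (intro lebesgue_integral_eq_integral) auto
  ultimately show ?thesis by simp
qed

text \<open>Two approximations in the mean are chained, \<open>w\<close> by a simple function and
  that one by a continuous one. Each is at first only an almost everywhere limit, so everything is
  cut off at radius \<open>R\<close> to make bounded convergence apply.\<close>

lemma strongly_measurable_approx_continuous:
  fixes w :: "real \<Rightarrow> 'b::real_normed_vector"
  assumes w: "strongly_measurable (lebesgue_on {0<..<T}) w"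
    and C: "\<And>t. t \<in> {0<..<T} \<Longrightarrow> norm (w t) \<le> C" and \<eta>: "\<eta> > 0"
  obtains c where "continuous_on UNIV c" "\<And>t. norm (c t) \<le> \<bar>C\<bar> + 1"
    "(\<lambda>t. norm (w t - c t)) \<in> borel_measurable (lebesgue_on {0<..<T})"
    "integral {0<..<T} (\<lambda>t. norm (w t - c t)) < \<eta>"
proof -
  let ?M = "lebesgue_on {0<..<T}"
  have S: "{0<..<T} \<in> sets lebesgue" by simp
  define R where "R = \<bar>C\<bar> + 1"
  have R: "R > 0" by (simp add: R_def)
  \<comment> \<open>Radial retraction onto the ball of radius \<open>R\<close>: continuous, and the
    identity at the values of \<open>w\<close>, which lie in that ball.\<close>
  define P :: "'b \<Rightarrow> 'b" where "P v = (R / max R (norm v)) *\<^sub>R v" for v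
  have Pc: "continuous_on UNIV P"
    unfolding P_def[abs_def] using R by (intro continuous_intros) auto
  then have Plim: "(\<lambda>n. P (f n)) \<longlonglongrightarrow> P l" if "f \<longlonglongrightarrow> l" for f :: "nat \<Rightarrow> 'b" and l
    using that by (auto intro: continuous_on_tendsto_compose)
  have PR: "norm (P v) \<le> R" for v
    using R by (auto simp: P_def max_def divide_simps)
  have Pw: "P (w t) = w t" if "t \<in> {0<..<T}" for t
  proof -
    have "max R (norm (w t)) = R" using C[OF that] by (simp add: R_def)
    then show ?thesis using R by (simp add: P_def)
  qed
  have bound: "\<bar>norm (x - P y)\<bar> \<le> 2 * R" if "norm x \<le> R" for x y
    using norm_triangle_ineq4[of x "P y"] PR[of y] that by simp
  have wR: "norm (w t) \<le> R" if "t \<in> {0<..<T}" for t using C[OF that] by (simp add: R_def)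
  obtain s where s: "\<And>n::nat. simple_function ?M (s n)" "AE t in ?M. (\<lambda>n. s n t) \<longlonglongrightarrow> w t"
    using w unfolding strongly_measurable_def by auto
  have Ps: "strongly_measurable ?M (\<lambda>t. P (s n t))" for n
    unfolding strongly_measurable_def
    by (rule exI[of _ "\<lambda>_ t. P (s n t)"]) (use simple_function_compose1[OF s(1)] in auto)
  have meas: "(\<lambda>t. norm (v t - f t)) \<in> borel_measurable ?M"
    if "strongly_measurable ?M v" "\<And>y. (\<lambda>t. norm (y - f t)) \<in> borel_measurable ?M" for v f :: "real \<Rightarrow> 'b"
    by (rule strongly_measurable_Caratheodory[OF S that(1), of "\<lambda>y t. norm (y - f t)"])
      (auto intro!: that(2) continuous_intros)
  have mc: "(\<lambda>t. norm (v t - c t)) \<in> borel_measurable ?M"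
    if "strongly_measurable ?M v" "continuous_on UNIV c" for v c :: "real \<Rightarrow> 'b"
  proof (rule meas[OF that(1)])
    have "continuous_on {0<..<T} (\<lambda>t. norm (y - c t))" for y
      by (intro continuous_intros continuous_on_subset[OF that(2)]) auto
    then show "(\<lambda>t. norm (y - c t)) \<in> borel_measurable ?M" for y
      using S by (rule continuous_imp_measurable_on_sets_lebesgue)
  qed
  have ms: "(\<lambda>t. norm (w t - P (s n t))) \<in> borel_measurable ?M" for n
    by (intro meas[OF w] strongly_measurable_compose[OF S Ps]) (intro continuous_intros)
  have "(\<lambda>n. integral {0<..<T} (\<lambda>t. norm (w t - P (s n t)))) \<longlonglongrightarrow> 0"
  proof (rule bounded_tendsto_integral_0[OF ms bound[OF wR]])
    show "AE t in ?M. (\<lambda>n. norm (w t - P (s n t))) \<longlonglongrightarrow> 0"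
      using s(2) AE_space
    proof eventually_elim
      case (elim t)
      have "(\<lambda>n. norm (w t - P (s n t))) \<longlonglongrightarrow> norm (w t - P (w t))"
        by (intro tendsto_intros Plim elim(1))
      then show ?case using Pw[of t] elim(2) by simp
    qed
  qed
  then obtain n where n: "integral {0<..<T} (\<lambda>t. norm (w t - P (s n t))) < \<eta> / 2"
    using eventually_happens'[OF sequentially_bot order_tendstoD(2)[of _ 0 _ "\<eta> / 2"]] \<eta> by auto
  obtain N g where N: "negligible N" and g: "\<And>k::nat. continuous_on UNIV (g k)"
    and glim: "\<And>t. t \<notin> N \<Longrightarrow> (\<lambda>k. g k t) \<longlonglongrightarrow> (if t \<in> {0<..<T} then s n t else 0)"
    using simple_function_measurable_on[OF S s(1)[of n]] unfolding measurable_on_def by blast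
  have Nae: "AE t in ?M. t \<notin> N"
  proof -
    have "AE t in lebesgue. t \<notin> N" using N by (simp add: negligible_iff_null_sets AE_not_in)
    then have "AE t in lebesgue. t \<in> {0<..<T} \<longrightarrow> t \<notin> N" by (rule eventually_mono) simp
    then show ?thesis by (simp add: AE_restrict_space_iff)
  qed
  have cc: "continuous_on UNIV (\<lambda>t. P (g k t))" for k
    by (rule continuous_on_compose2[OF Pc g]) auto
  have "(\<lambda>k. integral {0<..<T} (\<lambda>t. norm (P (s n t) - P (g k t)))) \<longlonglongrightarrow> 0"
  proof (rule bounded_tendsto_integral_0[OF mc[OF Ps cc] bound[OF PR]])
    show "AE t in ?M. (\<lambda>k. norm (P (s n t) - P (g k t))) \<longlonglongrightarrow> 0"
      using Nae AE_space
    proof eventually_elim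
      case (elim t)
      have "(\<lambda>k. norm (P (s n t) - P (g k t))) \<longlonglongrightarrow> norm (P (s n t) - P (s n t))"
        using glim[OF elim(1)] elim(2) by (intro tendsto_intros Plim) auto
      then show ?case by simp
    qed
  qed
  then obtain k where k: "integral {0<..<T} (\<lambda>t. norm (P (s n t) - P (g k t))) < \<eta> / 2"
    using eventually_happens'[OF sequentially_bot order_tendstoD(2)[of _ 0 _ "\<eta> / 2"]] \<eta> by auto
  have int1: "(\<lambda>t. norm (w t - P (s n t))) integrable_on {0<..<T}"
    by (rule bounded_measurable_integrable_on[OF ms bound[OF wR]])
  have int2: "(\<lambda>t. norm (P (s n t) - P (g k t))) integrable_on {0<..<T}"
    by (rule bounded_measurable_integrable_on[OF mc[OF Ps cc] bound[OF PR]])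
  have "integral {0<..<T} (\<lambda>t. norm (w t - P (g k t)))
    \<le> integral {0<..<T} (\<lambda>t. norm (w t - P (s n t)) + norm (P (s n t) - P (g k t)))"
  proof (rule integral_le)
    show "(\<lambda>t. norm (w t - P (g k t))) integrable_on {0<..<T}"
      by (rule bounded_measurable_integrable_on[OF mc[OF w cc] bound[OF wR]])
    show "norm (w t - P (g k t)) \<le> norm (w t - P (s n t)) + norm (P (s n t) - P (g k t))" for t
      using norm_triangle_ineq[of "w t - P (s n t)" "P (s n t) - P (g k t)"] by simp
  qed (intro integrable_add int1 int2)
  also have "\<dots> < \<eta>" using integral_add[OF int1 int2] n k by simp
  finally show thesis
    using that[OF cc _ mc[OF w cc]] PR unfolding R_def by blast
qed

section \<open>Trajectories with bounded weak derivatives\<close>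

text \<open>The function \<open>A x - integral {s..x} p\<close> has derivative zero at every
  \<open>x\<close>, even if \<open>p\<close> is merely integrable. Only short intervals containing
  \<open>x\<close> have to be estimated, so one factor of the integrand can be frozen there; three
  identities below rest on this.\<close>

lemma has_integral_if_additive_approximation:
  fixes A p :: "real \<Rightarrow> real"
  assumes "s \<le> t" and p: "p integrable_on {s..t}"
    and approx: "\<And>x e. x \<in> {s..t} \<Longrightarrow> e > 0 \<Longrightarrow>
       \<exists>d>0. \<forall>a b. s \<le> a \<longrightarrow> a \<le> x \<longrightarrow> x \<le> b \<longrightarrow> b \<le> t \<longrightarrow> b - a < d \<longrightarrow>
         \<bar>A b - A a - integral {a..b} p\<bar> \<le> e * (b - a)"
  shows "A t - A s = integral {s..t} p"
proof -
  define P where "P x = A x - integral {s..x} p" for x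
  have P: "P b - P a = A b - A a - integral {a..b} p" if "s \<le> a" "a \<le> b" "b \<le> t" for a b
  proof -
    have "integral {s..a} p + integral {a..b} p = integral {s..b} p"
      by (rule Henstock_Kurzweil_Integration.integral_combine)
        (use that integrable_on_subinterval[OF p] in auto)
    then show ?thesis by (simp add: P_def)
  qed
  have "(P has_derivative (\<lambda>h. 0)) (at x within {s..t})" if x: "x \<in> {s..t}" for x
    unfolding has_derivative_within_alt
  proof (intro conjI allI impI)
    fix e :: real assume "0 < e"
    then obtain d where d: "d > 0" "\<And>a b. s \<le> a \<Longrightarrow> a \<le> x \<Longrightarrow> x \<le> b \<Longrightarrow> b \<le> t \<Longrightarrow> b - a < d \<Longrightarrow>
         \<bar>A b - A a - integral {a..b} p\<bar> \<le> e * (b - a)"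
      using approx[OF x, of e] by metis
    have "norm (P y - P x - 0) \<le> e * norm (y - x)" if y: "y \<in> {s..t}" "norm (y - x) < d" for y
    proof (cases "x \<le> y")
      case True
      then show ?thesis using d(2)[of x y] P[of x y] x y by auto
    next
      case False
      then show ?thesis using d(2)[of y x] P[of y x] x y by auto
    qed
    then show "\<exists>d>0. \<forall>y\<in>{s..t}. norm (y - x) < d \<longrightarrow> norm (P y - P x - 0) \<le> e * norm (y - x)"
      using d(1) by blast
  qed simp
  then obtain c where "\<And>x. x \<in> {s..t} \<Longrightarrow> P x = c"
    using has_derivative_zero_constant[of "{s..t}" P] by auto
  then have "P t - P s = 0" using \<open>s \<le> t\<close> by auto
  then show ?thesis by (simp add: P_def)
qed

lemma continuous_measurable:
  fixes f :: "real \<Rightarrow> real"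
  shows "continuous_on {0<..<T} f \<Longrightarrow> f \<in> borel_measurable (lebesgue_on {0<..<T})"
  by (rule continuous_imp_measurable_on_sets_lebesgue) auto

lemma integral_abs_bound:
  fixes p :: "real \<Rightarrow> real"
  assumes "p integrable_on {a..b}" "\<And>x. x \<in> {a..b} \<Longrightarrow> \<bar>p x\<bar> \<le> B" "a \<le> b"
  shows "\<bar>integral {a..b} p\<bar> \<le> B * (b - a)"
proof -
  have "norm (integral {a..b} p) \<le> integral {a..b} (\<lambda>x. B)"
    by (rule integral_norm_bound_integral) (use assms in auto)
  then show ?thesis using assms(3) by (simp add: mult.commute)
qed

lemma primitive_DERIV:
  fixes f :: "real \<Rightarrow> real"
  assumes "continuous_on {a..b} f" "a < x" "x < b"
  shows "((\<lambda>x. integral {a..x} f) has_real_derivative f x) (at x)"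
proof -
  have "((\<lambda>x. integral {a..x} f) has_real_derivative f x) (at x within {a..b})"
    by (rule integral_has_real_derivative) (use assms in auto)
  then show ?thesis using assms by (simp add: at_within_Icc_at)
qed

lemma abs_increment_le_if_abs_deriv_le:
  fixes G H :: "real \<Rightarrow> real"
  assumes "s \<le> t" "\<And>x. x \<in> {s..t} \<Longrightarrow> (G has_real_derivative g x) (at x)"
    "\<And>x. x \<in> {s..t} \<Longrightarrow> (H has_real_derivative h x) (at x)" "\<And>x. x \<in> {s..t} \<Longrightarrow> \<bar>g x\<bar> \<le> h x"
  shows "\<bar>G t - G s\<bar> \<le> H t - H s"
proof -
  have "H s - G s \<le> H t - G t"
  proof (rule DERIV_nonneg_imp_nondecreasing[OF assms(1)])
    fix x assume "s \<le> x" "x \<le> t"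
    then show "\<exists>y. ((\<lambda>x. H x - G x) has_real_derivative y) (at x) \<and> 0 \<le> y"
      using DERIV_diff[OF assms(3) assms(2), of x] assms(4)[of x] by (intro exI[of _ "h x - g x"]) auto
  qed
  moreover have "H s + G s \<le> H t + G t"
  proof (rule DERIV_nonneg_imp_nondecreasing[OF assms(1)])
    fix x assume "s \<le> x" "x \<le> t"
    then show "\<exists>y. ((\<lambda>x. H x + G x) has_real_derivative y) (at x) \<and> 0 \<le> y"
      using DERIV_add[OF assms(3) assms(2), of x] assms(4)[of x] by (intro exI[of _ "h x + g x"]) auto
  qed
  ultimately show ?thesis by linarith
qed

text \<open>\<open>w\<close> and \<open>z\<close> stand for \<open>u'\<close> in V and
  \<open>u''\<close> in V', known only through tested identities: \<open>weak1\<close> tests with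
  functionals on V, \<open>weak2\<close> with elements of V. The bounds hold at every point of the
  interval, which is a matter of choosing the representatives.\<close>

locale weak_trajectory =
  fixes T C K :: real
    and i :: "'v::{real_inner,complete_space} \<Rightarrow>\<^sub>L 'h::{real_inner,complete_space}"
    and u w :: "real \<Rightarrow> 'v" and z :: "real \<Rightarrow> 'v \<Rightarrow>\<^sub>L real"
  assumes u_cont: "continuous_on {0..T} u"
    and w_meas: "strongly_measurable (lebesgue_on {0<..<T}) w"
    and z_meas: "strongly_measurable (lebesgue_on {0<..<T}) z"
    and w_bound: "\<And>t. t \<in> {0<..<T} \<Longrightarrow> norm (w t) \<le> C"
    and z_bound: "\<And>t. t \<in> {0<..<T} \<Longrightarrow> norm (z t) \<le> K"
    and weak1: "\<And>(l::'v \<Rightarrow> real) \<phi>. bounded_linear l \<Longrightarrow> test_function T \<phi> \<Longrightarrow>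
       integral {0<..<T} (\<lambda>t. deriv \<phi> t * l (u t)) = - integral {0<..<T} (\<lambda>t. \<phi> t * l (w t))"
    and weak2: "\<And>e \<phi>. test_function T \<phi> \<Longrightarrow>
       integral {0<..<T} (\<lambda>t. deriv \<phi> t * (i (w t) \<bullet> i e)) = - integral {0<..<T} (\<lambda>t. \<phi> t * z t e)"
begin

section \<open>Tested identities and the Lipschitz bound in V\<close>

lemma bounded_measurable_integrable:
  fixes p :: "real \<Rightarrow> real"
  assumes "p \<in> borel_measurable (lebesgue_on {0<..<T})" "\<And>x. x \<in> {0<..<T} \<Longrightarrow> \<bar>p x\<bar> \<le> B"
    and "0 < a" "b < T"
  shows "p integrable_on {a..b}"
  by (rule integrable_on_subinterval[OF bounded_measurable_integrable_on[OF assms(1,2)]])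
    (use assms in auto)

lemma w_compose_integrable:
  fixes \<Phi> :: "'v \<Rightarrow> real"
  assumes "\<And>y. isCont \<Phi> y" "\<And>t. t \<in> {0<..<T} \<Longrightarrow> \<bar>\<Phi> (w t)\<bar> \<le> B" "0 < a" "b < T"
  shows "(\<lambda>t. \<Phi> (w t)) integrable_on {a..b}"
  by (rule bounded_measurable_integrable[OF strongly_measurable_compose])
    (use assms w_meas in auto)

lemma abs_functional_w_le:
  fixes l :: "'v \<Rightarrow> real"
  assumes "bounded_linear l" "t \<in> {0<..<T}"
  shows "\<bar>l (w t)\<bar> \<le> onorm l * C"
  using onorm[OF assms(1), of "w t"] w_bound[OF assms(2)] onorm_pos_le[OF assms(1)]
  by (simp add: mult_left_mono order_trans)

lemma functional_w_integrable:
  fixes l :: "'v \<Rightarrow> real"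
  assumes "bounded_linear l" "0 < a" "b < T"
  shows "(\<lambda>t. l (w t)) integrable_on {a..b}"
  by (rule w_compose_integrable[of l "onorm l * C"])
    (use assms abs_functional_w_le in \<open>auto intro: bounded_linear.isCont\<close>)

lemma abs_z_le: "t \<in> {0<..<T} \<Longrightarrow> \<bar>z t e\<bar> \<le> K * norm e"
  using norm_blinfun[of "z t" e] z_bound[of t] mult_right_mono[of "norm (z t)" K "norm e"] by simp

lemma z_measurable: "(\<lambda>t. z t e) \<in> borel_measurable (lebesgue_on {0<..<T})"
  by (rule strongly_measurable_compose[OF _ z_meas]) (auto intro!: continuous_intros)

lemma z_integrable: "0 < a \<Longrightarrow> b < T \<Longrightarrow> (\<lambda>t. z t e) integrable_on {a..b}"
  by (rule bounded_measurable_integrable[OF z_measurable abs_z_le])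

lemma functional_increment:
  fixes l :: "'v \<Rightarrow> real"
  assumes l: "bounded_linear l" and "0 < s" "s \<le> t" "t < T"
  shows "l (u t) - l (u s) = integral {s..t} (\<lambda>r. l (w r))"
proof (rule weak_derivative_imp_integral[where K = "onorm l * C" and T = T])
  show "continuous_on {0..T} (\<lambda>t. l (u t))"
    using bounded_linear.continuous_on[OF l u_cont] .
  show "(\<lambda>t. l (w t)) \<in> borel_measurable (lebesgue_on {0<..<T})"
    by (rule strongly_measurable_compose[OF _ w_meas]) (use l in \<open>auto intro: bounded_linear.isCont\<close>)
qed (use assms weak1 abs_functional_w_le in auto)

lemma C_nonneg: "T > 0 \<Longrightarrow> C \<ge> 0"
  using order_trans[OF norm_ge_zero w_bound[of "T / 2"]] by simp

lemma K_nonneg: "T > 0 \<Longrightarrow> K \<ge> 0"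
  using order_trans[OF norm_ge_zero z_bound[of "T / 2"]] by simp

text \<open>Testing with the increment \<open>u t - u s\<close> itself recovers its norm from a real
  integral; one factor of the norm then cancels.\<close>

lemma u_lipschitz_le:
  assumes "0 < s" "s \<le> t" "t < T"
  shows "norm (u t - u s) \<le> C * (t - s)"
proof -
  define e where "e = u t - u s"
  have "norm e * norm e = e \<bullet> u t - e \<bullet> u s"
    by (simp add: e_def inner_diff_right[symmetric] power2_norm_eq_inner[symmetric] power2_eq_square)
  also have "\<dots> = integral {s..t} (\<lambda>r. e \<bullet> w r)"
    by (rule functional_increment[OF bounded_linear_inner_right assms])
  also have "\<dots> \<le> norm e * C * (t - s)"
  proof (rule abs_le_D1, rule integral_abs_bound)
    show "(\<lambda>r. e \<bullet> w r) integrable_on {s..t}"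
      by (rule functional_w_integrable) (use assms bounded_linear_inner_right in auto)
    show "\<bar>e \<bullet> w x\<bar> \<le> norm e * C" if "x \<in> {s..t}" for x
      using Cauchy_Schwarz_ineq2[of e "w x"] w_bound[of x] that assms
        mult_left_mono[of "norm (w x)" C "norm e"] by auto
  qed fact
  finally have "norm e * norm e \<le> norm e * (C * (t - s))" by (simp add: mult.assoc)
  moreover have "C * (t - s) \<ge> 0" using C_nonneg assms by simp
  ultimately show ?thesis unfolding e_def[symmetric] using mult_le_cancel_left_pos by (cases "norm e = 0") auto
qed

lemma u_lipschitz:
  assumes "0 < s" "s < T" "0 < t" "t < T"
  shows "norm (u t - u s) \<le> C * \<bar>t - s\<bar>"
  using u_lipschitz_le[of s t] u_lipschitz_le[of t s] assms
  by (cases "s \<le> t") (auto simp: norm_minus_commute)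

text \<open>Using \<open>weak1\<close> with the test function \<open>deriv \<phi>\<close> and then
  \<open>weak2\<close> with \<open>\<phi>\<close> shows that \<open>f\<close> has the bounded weak
  second derivative \<open>z r e\<close>, so the theorem on real functions applies.\<close>

lemma pairing_C1:
  fixes e :: 'v
  defines "f \<equiv> \<lambda>t. i (u t) \<bullet> i e"
  shows "0 < t \<Longrightarrow> t < T \<Longrightarrow> (f has_real_derivative deriv f t) (at t)"
    and "0 < s \<Longrightarrow> s \<le> t \<Longrightarrow> t < T \<Longrightarrow> deriv f t - deriv f s = integral {s..t} (\<lambda>r. z r e)"
proof -
  have bl: "bounded_linear (\<lambda>v. i v \<bullet> i e)"
    by (intro bounded_linear_compose[OF bounded_linear_inner_left] blinfun.bounded_linear_right)
  have weak: "integral {0<..<T} (\<lambda>x. deriv (deriv \<phi>) x * f x) = integral {0<..<T} (\<lambda>x. \<phi> x * z x e)"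
    if "test_function T \<phi>" for \<phi>
    using weak1[OF bl test_function_deriv[OF that]] weak2[OF that, of e] by (simp add: f_def)
  have fc: "continuous_on {0..T} f"
    unfolding f_def using bounded_linear.continuous_on[OF bl u_cont] .
  have main: "(f has_real_derivative deriv f s) (at s) \<and> (f has_real_derivative deriv f t) (at t) \<and>
      deriv f t - deriv f s = integral {s..t} (\<lambda>r. z r e)" if st: "0 < s" "s \<le> t" "t < T" for s t
  proof -
    obtain f' where f': "\<And>x. x \<in> {s/2<..<(t + T)/2} \<Longrightarrow> (f has_real_derivative f' x) (at x)"
      "\<And>a b. s/2 < a \<Longrightarrow> a \<le> b \<Longrightarrow> b < (t + T)/2 \<Longrightarrow> f' b - f' a = integral {a..b} (\<lambda>r. z r e)"
      by (rule weak_second_derivative_imp_C1[OF fc z_measurable abs_z_le weak, of "s/2" "(t+T)/2"])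
        (use st in auto)
    have "(f has_real_derivative f' s) (at s)" "(f has_real_derivative f' t) (at t)"
      using st by (auto intro!: f'(1))
    moreover from this have "deriv f s = f' s" "deriv f t = f' t" by (auto intro: DERIV_imp_deriv)
    ultimately show ?thesis using f'(2)[of s t] st by auto
  qed
  show "0 < t \<Longrightarrow> t < T \<Longrightarrow> (f has_real_derivative deriv f t) (at t)" using main[of t t] by auto
  show "0 < s \<Longrightarrow> s \<le> t \<Longrightarrow> t < T \<Longrightarrow> deriv f t - deriv f s = integral {s..t} (\<lambda>r. z r e)"
    using main[of s t] by auto
qed

lemma pairing_deriv_lipschitz:
  assumes "0 < s" "s < T" "0 < t" "t < T"
  shows "\<bar>deriv (\<lambda>t. i (u t) \<bullet> i e) t - deriv (\<lambda>t. i (u t) \<bullet> i e) s\<bar> \<le> K * norm e * \<bar>t - s\<bar>"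
proof -
  have *: "\<bar>deriv (\<lambda>t. i (u t) \<bullet> i e) t - deriv (\<lambda>t. i (u t) \<bullet> i e) s\<bar> \<le> K * norm e * (t - s)"
    if "0 < s" "s \<le> t" "t < T" for s t
    unfolding pairing_C1(2)[OF that]
    by (rule integral_abs_bound) (use that z_integrable abs_z_le in auto)
  show ?thesis
    using *[of s t] *[of t s] assms by (cases "s \<le> t") auto
qed

section \<open>The velocity in H: existence and Hoelder continuity\<close>

definition dquot :: "real \<Rightarrow> real \<Rightarrow> 'v" where
  "dquot h t = (1 / h) *\<^sub>R (u (t + h) - u t)"

lemma norm_dquot: "0 < t \<Longrightarrow> t < T \<Longrightarrow> 0 < t + h \<Longrightarrow> t + h < T \<Longrightarrow> norm (dquot h t) \<le> C"
  using u_lipschitz[of t "t + h"] C_nonneg by (cases "h = 0") (auto simp: dquot_def divide_simps mult.commute)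

text \<open>By the mean value theorem the quotient is the derivative at a point within
  \<open>\<bar>h\<bar>\<close> of \<open>t\<close>, and that derivative is Lipschitz.\<close>

lemma pairing_dquot:
  assumes "0 < t" "t < T" "0 < t + h" "t + h < T" "h \<noteq> 0"
  shows "\<bar>i (dquot h t) \<bullet> i e - deriv (\<lambda>t. i (u t) \<bullet> i e) t\<bar> \<le> K * norm e * \<bar>h\<bar>"
proof -
  define f where "f = (\<lambda>t. i (u t) \<bullet> i e)"
  have d: "(f has_real_derivative deriv f x) (at x)" if "0 < x" "x < T" for x
    using pairing_C1(1)[OF that, of e] by (simp add: f_def)
  have eq: "i (dquot h t) \<bullet> i e = (f (t + h) - f t) / h"
    by (simp add: dquot_def f_def blinfun.diff_right blinfun.scaleR_right inner_diff_left)
  obtain x where x: "\<bar>x - t\<bar> \<le> \<bar>h\<bar>" "0 < x" "x < T" "f (t + h) - f t = h * deriv f x"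
  proof (cases "h > 0")
    case True
    then obtain x where "t < x" "x < t + h" "f (t + h) - f t = (t + h - t) * deriv f x"
      using MVT2[of t "t + h" f "deriv f"] d assms by force
    then show thesis using that[of x] assms by auto
  next
    case False
    then obtain x where "t + h < x" "x < t" "f t - f (t + h) = (t - (t + h)) * deriv f x"
      using MVT2[of "t + h" t f "deriv f"] d assms by force
    then show thesis using that[of x] assms by auto
  qed
  have "\<bar>i (dquot h t) \<bullet> i e - deriv f t\<bar> = \<bar>deriv f x - deriv f t\<bar>"
    using x(4) eq assms by simp
  also have "\<dots> \<le> K * norm e * \<bar>x - t\<bar>"
    unfolding f_def by (rule pairing_deriv_lipschitz) (use assms x in auto)
  also have "\<dots> \<le> K * norm e * \<bar>h\<bar>"
    using x(1) K_nonneg assms(1,2) by (intro mult_left_mono) auto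
  finally show ?thesis by (simp add: f_def)
qed

text \<open>Interpolation: \<open>\<bar>i e\<bar>\<^sup>2\<close> is the pairing of \<open>e\<close> with its image in the dual, so a bound on \<open>e\<close> in
  \<open>V\<close> and a Lipschitz bound in the dual give a Hoelder bound in \<open>H\<close>.\<close>

lemma dquot_cauchy:
  assumes "0 < t" "t < T" "0 < t + h" "t + h < T" "h \<noteq> 0" "0 < t + k" "t + k < T" "k \<noteq> 0"
  shows "(norm (i (dquot h t) - i (dquot k t)))\<^sup>2 \<le> 2 * C * K * (\<bar>h\<bar> + \<bar>k\<bar>)"
proof -
  define e where "e = dquot h t - dquot k t"
  have "norm e \<le> 2 * C"
    using norm_triangle_ineq4[of "dquot h t" "dquot k t"] norm_dquot[of t h] norm_dquot[of t k] assms by (simp add: e_def)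
  have "(norm (i (dquot h t) - i (dquot k t)))\<^sup>2 = i (dquot h t) \<bullet> i e - i (dquot k t) \<bullet> i e"
    by (simp add: e_def power2_norm_eq_inner blinfun.diff_right inner_diff_left)
  also have "\<dots> \<le> K * norm e * \<bar>h\<bar> + K * norm e * \<bar>k\<bar>"
    using pairing_dquot[of t h e] pairing_dquot[of t k e] assms by (auto simp: abs_le_iff)
  also have "\<dots> = norm e * (K * (\<bar>h\<bar> + \<bar>k\<bar>))" by (simp add: algebra_simps)
  also have "\<dots> \<le> 2 * C * (K * (\<bar>h\<bar> + \<bar>k\<bar>))"
    using \<open>norm e \<le> 2 * C\<close> K_nonneg assms by (intro mult_right_mono) auto
  finally show ?thesis by (simp add: mult.assoc)
qed

definition v :: "real \<Rightarrow> 'h" where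
  "v t = vector_derivative (\<lambda>s. i (u s)) (at t)"

text \<open>Difference quotients along steps tending to 0 form a Cauchy sequence, so completeness of
  H supplies the limit. Letting one of the two steps in \<open>dquot_cauchy\<close> tend to 0 then
  gives the rate for every \<open>h\<close>.\<close>

lemma has_velocity_with_rate:
  assumes t: "0 < t" "t < T"
  shows "((\<lambda>s. i (u s)) has_vector_derivative v t) (at t) \<and>
    (\<forall>h. 0 < t + h \<longrightarrow> t + h < T \<longrightarrow> h \<noteq> 0 \<longrightarrow> (norm (i (dquot h t) - v t))\<^sup>2 \<le> 2 * C * K * \<bar>h\<bar>)"
proof -
  define \<delta> where "\<delta> = (T - t) / 2"
  have \<delta>: "0 < \<delta>" "t + \<delta> < T" using t by (auto simp: \<delta>_def field_simps)
  define x where "x n = i (dquot (\<delta> / real (Suc n)) t)" for n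
  have ok: "0 < t + \<delta> / real (Suc n)" "0 < \<delta> / real (Suc n)" "\<delta> / real (Suc n) \<le> \<delta>" "t + \<delta> / real (Suc n) < T" for n
  proof -
    show 1: "\<delta> / real (Suc n) \<le> \<delta>" using \<delta> by (simp add: divide_le_eq)
    then show "t + \<delta> / real (Suc n) < T" using \<delta> by linarith
  qed (use \<delta> t in \<open>simp_all add: add_pos_pos\<close>)
  define M where "M = 2 * C * K"
  have M: "M \<ge> 0" using C_nonneg K_nonneg t by (simp add: M_def)
  have lim\<delta>: "(\<lambda>n. \<delta> / real (Suc n)) \<longlonglongrightarrow> 0"
    using tendsto_mult[OF tendsto_const[of \<delta>] LIMSEQ_inverse_real_of_nat] by (simp add: divide_inverse)
  have "Cauchy x"
  proof (rule metric_CauchyI)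
    fix e :: real assume e: "0 < e"
    have "(\<lambda>n. M * (\<delta> / real (Suc n) + \<delta> / real (Suc n))) \<longlonglongrightarrow> M * (0 + 0)"
      by (intro tendsto_intros lim\<delta>)
    then have "eventually (\<lambda>n. M * (\<delta> / real (Suc n) + \<delta> / real (Suc n)) < e\<^sup>2) sequentially"
      using order_tendstoD(2)[of _ "M * (0 + 0)" sequentially "e\<^sup>2"] e by simp
    then obtain N where N: "M * (\<delta> / real (Suc N) + \<delta> / real (Suc N)) < e\<^sup>2"
      using eventually_happens'[OF sequentially_bot] by blast
    have "dist (x m) (x n) < e" if "m \<ge> N" "n \<ge> N" for m n
    proof -
      have le: "\<delta> / real (Suc m) \<le> \<delta> / real (Suc N)" if "m \<ge> N" for m
        using \<delta> that by (intro divide_left_mono) auto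
      have "(norm (x m - x n))\<^sup>2 \<le> M * (\<bar>\<delta> / real (Suc m)\<bar> + \<bar>\<delta> / real (Suc n)\<bar>)"
        unfolding x_def M_def using ok[of m] ok[of n] t by (intro dquot_cauchy) auto
      also have "\<dots> \<le> M * (\<delta> / real (Suc N) + \<delta> / real (Suc N))"
        using le[OF that(1)] le[OF that(2)] \<delta> M by (intro mult_left_mono add_mono) auto
      also have "\<dots> < e\<^sup>2" by (rule N)
      finally show ?thesis using e by (simp add: dist_norm power_less_imp_less_base)
    qed
    then show "\<exists>N. \<forall>m\<ge>N. \<forall>n\<ge>N. dist (x m) (x n) < e" by blast
  qed
  then obtain V where V: "x \<longlonglongrightarrow> V" using Cauchy_convergent_iff convergent_def by blast
  have bd: "(norm (i (dquot h t) - V))\<^sup>2 \<le> M * \<bar>h\<bar>" if h: "0 < t + h" "t + h < T" "h \<noteq> 0" for h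
  proof (rule LIMSEQ_le)
    show "(\<lambda>n. (norm (i (dquot h t) - x n))\<^sup>2) \<longlonglongrightarrow> (norm (i (dquot h t) - V))\<^sup>2"
      by (intro tendsto_intros V)
    have "(\<lambda>n. M * (\<bar>h\<bar> + \<bar>\<delta> / real (Suc n)\<bar>)) \<longlonglongrightarrow> M * (\<bar>h\<bar> + \<bar>0\<bar>)"
      by (intro tendsto_intros lim\<delta>)
    then show "(\<lambda>n. M * (\<bar>h\<bar> + \<bar>\<delta> / real (Suc n)\<bar>)) \<longlonglongrightarrow> M * \<bar>h\<bar>" by simp
    have "(norm (i (dquot h t) - x n))\<^sup>2 \<le> M * (\<bar>h\<bar> + \<bar>\<delta> / real (Suc n)\<bar>)" for n
      unfolding x_def M_def using ok[of n] t h by (intro dquot_cauchy) auto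
    then show "\<exists>N. \<forall>n\<ge>N. (norm (i (dquot h t) - x n))\<^sup>2 \<le> M * (\<bar>h\<bar> + \<bar>\<delta> / real (Suc n)\<bar>)" by blast
  qed
  have der: "((\<lambda>s. i (u s)) has_vector_derivative V) (at t)"
    unfolding has_vector_derivative_def has_derivative_at_alt
  proof (intro conjI allI impI)
    fix e :: real assume e: "0 < e"
    \<comment> \<open>Makes \<open>M * \<bar>h\<bar> \<le> e\<^sup>2\<close>, since the rate
      controls the square of the norm.\<close>
    define d where "d = min (min t (T - t)) (e\<^sup>2 / (M + 1))"
    have d: "d > 0" using t e M by (simp add: d_def)
    have "norm (i (u y) - i (u t) - (y - t) *\<^sub>R V) \<le> e * norm (y - t)" if y: "norm (y - t) < d" for y
    proof (cases "y = t")
      case False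
      define h where "h = y - t"
      have h: "h \<noteq> 0" "0 < t + h" "t + h < T" using False y by (auto simp: h_def d_def abs_less_iff)
      have "\<bar>h\<bar> * (M + 1) \<le> e\<^sup>2" using y M by (simp add: h_def d_def field_simps)
      then have "M * \<bar>h\<bar> \<le> e\<^sup>2" by (simp add: algebra_simps)
      then have "(norm (i (dquot h t) - V))\<^sup>2 \<le> e\<^sup>2"
        using bd[OF h(2,3,1)] by linarith
      then have "norm (i (dquot h t) - V) \<le> e"
        by (rule power2_le_imp_le) (use e in simp)
      moreover have "i (u y) - i (u t) - (y - t) *\<^sub>R V = h *\<^sub>R (i (dquot h t) - V)"
        using h(1) by (simp add: h_def dquot_def blinfun.diff_right blinfun.scaleR_right scaleR_diff_right)
      moreover have "\<bar>h\<bar> * norm (i (dquot h t) - V) \<le> \<bar>h\<bar> * e"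
        using calculation(1) by (rule mult_left_mono) simp
      ultimately show ?thesis by (simp add: h_def[symmetric] mult.commute)
    qed simp
    then show "\<exists>d>0. \<forall>y. norm (y - t) < d \<longrightarrow> norm (i (u y) - i (u t) - (y - t) *\<^sub>R V) \<le> e * norm (y - t)"
      using d by blast
  qed (simp add: bounded_linear_scaleR_left)
  then have "v t = V" unfolding v_def by (rule vector_derivative_at)
  then show ?thesis using der bd by (simp add: M_def)
qed

lemma has_velocity: "0 < t \<Longrightarrow> t < T \<Longrightarrow> ((\<lambda>s. i (u s)) has_vector_derivative v t) (at t)"
  using has_velocity_with_rate by blast

lemma eventually_shift_mem:
  assumes "0 < t" "t < T"
  shows "eventually (\<lambda>h. 0 < t + h \<and> t + h < T \<and> h \<noteq> 0) (at (0::real))"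
proof -
  have "eventually (\<lambda>h. h \<in> {-t<..<T - t}) (nhds (0::real))"
    by (rule eventually_nhds_in_open) (use assms in auto)
  then show ?thesis
    unfolding eventually_at_filter by (rule eventually_mono) auto
qed

lemma dquot_tendsto_velocity:
  assumes t: "0 < t" "t < T"
  shows "((\<lambda>h. i (dquot h t)) \<longlongrightarrow> v t) (at 0)"
proof (rule Lim_null[THEN iffD2], rule Lim_null_comparison)
  show "eventually (\<lambda>h. norm (i (dquot h t) - v t) \<le> sqrt (2 * C * K * \<bar>h\<bar>)) (at 0)"
    using eventually_shift_mem[OF t]
    by eventually_elim (use has_velocity_with_rate[OF t] in \<open>auto intro: real_le_rsqrt\<close>)
  have "((\<lambda>h. sqrt (2 * C * K * \<bar>h\<bar>)) \<longlongrightarrow> sqrt (2 * C * K * \<bar>0\<bar>)) (at 0)"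
    by (intro tendsto_intros)
  then show "((\<lambda>h. sqrt (2 * C * K * \<bar>h\<bar>)) \<longlongrightarrow> 0) (at 0)" by simp
qed

lemma velocity_increment:
  assumes st: "0 < s" "s \<le> t" "t < T"
  shows "(v t - v s) \<bullet> i e = integral {s..t} (\<lambda>r. z r e)"
proof -
  have *: "deriv (\<lambda>t. i (u t) \<bullet> i e) x = v x \<bullet> i e" if "0 < x" "x < T" for x
  proof (rule DERIV_imp_deriv)
    show "((\<lambda>t. i (u t) \<bullet> i e) has_real_derivative v x \<bullet> i e) (at x)"
      unfolding has_real_derivative_iff_has_vector_derivative
      by (rule bounded_linear.has_vector_derivative[OF bounded_linear_inner_left has_velocity[OF that]])
  qed
  show ?thesis
    using pairing_C1(2)[OF st, of e] *[of s] *[of t] st by (simp add: inner_diff_left)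
qed

text \<open>The increment \<open>v t - v s\<close> lies only in H, so
  \<open>velocity_increment\<close> cannot be applied with it as test element. The increment of
  \<open>dquot h\<close> replaces it: it lies in V with norm at most \<open>2 * C\<close>, uniformly
  in \<open>h\<close>, and its image in H tends to \<open>v t - v s\<close>.\<close>

lemma velocity_hoelder:
  assumes "0 < s" "s \<le> t" "t < T"
  shows "(norm (v t - v s))\<^sup>2 \<le> 2 * C * K * (t - s)"
proof (rule tendsto_upperbound)
  have t: "0 < t" "s < T" using assms by auto
  show "((\<lambda>h. (v t - v s) \<bullet> (i (dquot h t) - i (dquot h s))) \<longlongrightarrow> (norm (v t - v s))\<^sup>2) (at 0)"
    unfolding power2_norm_eq_inner using assms t by (intro tendsto_intros dquot_tendsto_velocity)
  show "eventually (\<lambda>h. (v t - v s) \<bullet> (i (dquot h t) - i (dquot h s)) \<le> 2 * C * K * (t - s)) (at 0)"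
    using eventually_shift_mem[OF t(1) assms(3)] eventually_shift_mem[OF assms(1) t(2)]
  proof eventually_elim
    case (elim h)
    define e where "e = dquot h t - dquot h s"
    have ne: "norm e \<le> 2 * C"
      using norm_triangle_ineq4[of "dquot h t" "dquot h s"] norm_dquot[of t h] norm_dquot[of s h] elim assms by (simp add: e_def)
    have "(v t - v s) \<bullet> (i (dquot h t) - i (dquot h s)) = integral {s..t} (\<lambda>r. z r e)"
      using velocity_increment[OF assms, of e] by (simp add: e_def blinfun.diff_right)
    also have "\<dots> \<le> K * norm e * (t - s)"
      by (rule abs_le_D1, rule integral_abs_bound) (use assms z_integrable abs_z_le in auto)
    also have "\<dots> = norm e * (K * (t - s))" by simp
    also have "\<dots> \<le> 2 * C * (K * (t - s))"
      using ne K_nonneg assms by (intro mult_right_mono) auto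
    finally show ?case by (simp add: mult.assoc)
  qed
qed simp

lemma uniformly_continuous_on_velocity: "uniformly_continuous_on {0<..<T} v"
  unfolding uniformly_continuous_on_def
proof (intro allI impI)
  fix e :: real assume e: "0 < e"
  define M where "M = 2 * C * K"
  have *: "norm (v t - v s) < e" if "0 < s" "s \<le> t" "t < T" "t - s < e\<^sup>2 / (M + 1)" for s t
  proof -
    have M: "M \<ge> 0" using C_nonneg K_nonneg that by (simp add: M_def)
    then have "(t - s) * (M + 1) < e\<^sup>2" using that by (simp add: pos_less_divide_eq)
    then have "M * (t - s) < e\<^sup>2" using that by (simp add: algebra_simps)
    then have "(norm (v t - v s))\<^sup>2 < e\<^sup>2" using velocity_hoelder[OF that(1-3)] by (simp add: M_def)
    then show ?thesis using e by (simp add: power2_less_imp_less)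
  qed
  show "\<exists>d>0. \<forall>s\<in>{0<..<T}. \<forall>t\<in>{0<..<T}. dist t s < d \<longrightarrow> dist (v t) (v s) < e"
  proof (cases "T > 0")
    case True
    have "dist (v t) (v s) < e"
      if "s \<in> {0<..<T}" "t \<in> {0<..<T}" "dist t s < e\<^sup>2 / (M + 1)" for s t
      using *[of s t] *[of t s] that
      by (cases "s \<le> t") (auto simp: dist_norm norm_minus_commute)
    moreover have "e\<^sup>2 / (M + 1) > 0" using e True C_nonneg K_nonneg by (simp add: M_def add_nonneg_pos)
    ultimately show ?thesis by blast
  qed (auto intro: exI[of _ 1])
qed

lemma continuous_on_velocity: "continuous_on {0<..<T} v"
  by (rule uniformly_continuous_imp_continuous[OF uniformly_continuous_on_velocity])

lemma norm_velocity_le: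
  assumes t: "0 < t" "t < T"
  shows "norm (v t) \<le> norm i * C"
proof (rule tendsto_upperbound)
  show "((\<lambda>h. norm (i (dquot h t))) \<longlongrightarrow> norm (v t)) (at 0)"
    by (intro tendsto_norm dquot_tendsto_velocity t)
  show "eventually (\<lambda>h. norm (i (dquot h t)) \<le> norm i * C) (at 0)"
    using eventually_shift_mem[OF t]
  proof eventually_elim
    case (elim h)
    then show ?case
      using norm_blinfun[of i "dquot h t"] mult_left_mono[OF norm_dquot[of t h], of "norm i"] t by auto
  qed
qed simp

section \<open>Comparison of the velocity with the weak derivative\<close>

lemma norm_i_w_le: "t \<in> {0<..<T} \<Longrightarrow> norm (i (w t)) \<le> norm i * C"
  using norm_blinfun[of i "w t"] w_bound[of t] mult_left_mono[of "norm (w t)" C "norm i"] by auto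

lemma velocity_w_integrable:
  assumes "0 < a" "b < T"
  shows "(\<lambda>r. v r \<bullet> i (w r)) integrable_on {a..b}"
proof (rule bounded_measurable_integrable[OF _ _ assms])
  show "(\<lambda>r. v r \<bullet> i (w r)) \<in> borel_measurable (lebesgue_on {0<..<T})"
  proof (rule strongly_measurable_Caratheodory[OF _ w_meas, of "\<lambda>y t. v t \<bullet> i y"])
    show "(\<lambda>t. v t \<bullet> i y) \<in> borel_measurable (lebesgue_on {0<..<T})" for y
      by (intro continuous_measurable continuous_intros continuous_on_velocity)
  qed (auto intro!: continuous_intros)
  show "\<bar>v x \<bullet> i (w x)\<bar> \<le> (norm i * C) * (norm i * C)" if "x \<in> {0<..<T}" for x
    using Cauchy_Schwarz_ineq2[of "v x" "i (w x)"] norm_velocity_le[of x] norm_i_w_le[OF that] that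
      mult_mono[of "norm (v x)" "norm i * C" "norm (i (w x))" "norm i * C"] C_nonneg by auto
qed

lemma velocity_sq_integrable:
  assumes "0 < a" "b < T"
  shows "(\<lambda>r. (norm (v r))\<^sup>2) integrable_on {a..b}"
  by (intro integrable_continuous_real continuous_intros continuous_on_subset[OF continuous_on_velocity])
    (use assms in auto)

lemma norm_i_w_sq_integrable:
  assumes "0 < a" "b < T"
  shows "(\<lambda>r. (norm (i (w r)))\<^sup>2) integrable_on {a..b}"
proof (rule w_compose_integrable[where \<Phi> = "\<lambda>y. (norm (i y))\<^sup>2" and B = "(norm i * C)\<^sup>2"])
  show "\<bar>(norm (i (w t)))\<^sup>2\<bar> \<le> (norm i * C)\<^sup>2" if "t \<in> {0<..<T}" for t
    using norm_i_w_le[OF that] by (simp add: power_mono)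
qed (use assms in \<open>auto intro!: continuous_intros\<close>)

lemma pairing_velocity_has_integral:
  assumes ab: "0 < a" "a \<le> b" "b < T"
  shows "((\<lambda>r. y \<bullet> i (w r)) has_integral y \<bullet> (i (u b) - i (u a))) {a..b}"
proof -
  have l: "bounded_linear (\<lambda>x. y \<bullet> i x)"
    by (intro bounded_linear_compose[OF bounded_linear_inner_right] blinfun.bounded_linear_right)
  show ?thesis
    using functional_increment[OF l ab] functional_w_integrable[OF l ab(1,3)]
    by (simp add: has_integral_integrable_integral inner_diff_right)
qed

text \<open>The continuous representative \<open>v\<close> agrees with \<open>i w\<close> almost everywhere; only the two
  integrated consequences below are needed.\<close>

lemma integral_velocity_sq:
  assumes st: "0 < s" "s \<le> t" "t < T"
  shows "integral {s..t} (\<lambda>r. (norm (v r))\<^sup>2) = integral {s..t} (\<lambda>r. v r \<bullet> i (w r))"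
proof -
  define A where "A x = integral {s..x} (\<lambda>r. (norm (v r))\<^sup>2)" for x
  define L where "L = norm i * C"
  have L: "L \<ge> 0" using C_nonneg st by (simp add: L_def)
  have "A t - A s = integral {s..t} (\<lambda>r. v r \<bullet> i (w r))"
  proof (rule has_integral_if_additive_approximation)
    show "(\<lambda>r. v r \<bullet> i (w r)) integrable_on {s..t}" using velocity_w_integrable st by simp
    fix x e :: real assume x: "x \<in> {s..t}" and e: "0 < e"
    define \<epsilon> where "\<epsilon> = e / (2 * L + 1)"
    have \<epsilon>: "\<epsilon> > 0" using e L by (simp add: \<epsilon>_def)
    obtain d where d: "d > 0" "\<And>x y. x \<in> {0<..<T} \<Longrightarrow> y \<in> {0<..<T} \<Longrightarrow> dist y x < d \<Longrightarrow> dist (v y) (v x) < \<epsilon>"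
      using uniformly_continuous_on_velocity \<epsilon> unfolding uniformly_continuous_on_def by meson
    have "\<bar>A b - A a - integral {a..b} (\<lambda>r. v r \<bullet> i (w r))\<bar> \<le> e * (b - a)"
      if ab: "s \<le> a" "a \<le> x" "x \<le> b" "b \<le> t" "b - a < d" for a b
    proof -
      have ab': "0 < a" "a \<le> b" "b < T" using ab st by auto
      have Ainc: "A b - A a = integral {a..b} (\<lambda>r. (norm (v r))\<^sup>2)"
        using Henstock_Kurzweil_Integration.integral_combine[of s a b "\<lambda>r. (norm (v r))\<^sup>2"]
          velocity_sq_integrable[of s b] ab st ab' by (simp add: A_def)
      \<comment> \<open>With \<open>v\<close> frozen at \<open>x\<close> in one factor, replacing
        \<open>v r\<close> by \<open>i (w r)\<close> in the other does not change the integral: both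
        give the pairing with the increment of \<open>i (u r)\<close>. Only the variation of
        \<open>v\<close> on the short interval contributes an error.\<close>
      have vx: "((\<lambda>r. v x \<bullet> v r) has_integral v x \<bullet> (i (u b) - i (u a))) {a..b}"
      proof -
        have "((\<lambda>r. v x \<bullet> i (u r)) has_vector_derivative v x \<bullet> v r) (at r within {a..b})" if "r \<in> {a..b}" for r
          by (rule has_vector_derivative_at_within,
              rule bounded_linear.has_vector_derivative[OF bounded_linear_inner_right has_velocity])
            (use that ab' in auto)
        then show ?thesis
          unfolding inner_diff_right by (rule fundamental_theorem_of_calculus[OF ab'(2)])
      qed
      note wx = pairing_velocity_has_integral[OF ab', of "v x"]
      have D: "((\<lambda>r. ((norm (v r))\<^sup>2 - v r \<bullet> i (w r)) - (v x \<bullet> v r - v x \<bullet> i (w r))) has_integral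
         (integral {a..b} (\<lambda>r. (norm (v r))\<^sup>2) - integral {a..b} (\<lambda>r. v r \<bullet> i (w r))) -
         (v x \<bullet> (i (u b) - i (u a)) - v x \<bullet> (i (u b) - i (u a)))) {a..b}"
        by (intro has_integral_diff vx wx integrable_integral velocity_sq_integrable velocity_w_integrable ab')
      have "\<bar>integral {a..b} (\<lambda>r. ((norm (v r))\<^sup>2 - v r \<bullet> i (w r)) - (v x \<bullet> v r - v x \<bullet> i (w r)))\<bar> \<le> \<epsilon> * (2 * L) * (b - a)"
      proof (rule integral_abs_bound[OF has_integral_integrable[OF D]])
        show "\<bar>((norm (v r))\<^sup>2 - v r \<bullet> i (w r)) - (v x \<bullet> v r - v x \<bullet> i (w r))\<bar> \<le> \<epsilon> * (2 * L)" if r: "r \<in> {a..b}" for r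
        proof -
          have "((norm (v r))\<^sup>2 - v r \<bullet> i (w r)) - (v x \<bullet> v r - v x \<bullet> i (w r)) = (v r - v x) \<bullet> (v r - i (w r))"
            by (simp add: power2_norm_eq_inner inner_diff_left inner_diff_right)
          also have "\<bar>\<dots>\<bar> \<le> norm (v r - v x) * norm (v r - i (w r))" by (rule Cauchy_Schwarz_ineq2)
          also have "\<dots> \<le> \<epsilon> * (2 * L)"
          proof (rule mult_mono)
            have "\<bar>r - x\<bar> < d" using r ab unfolding atLeastAtMost_iff by linarith
            then show "norm (v r - v x) \<le> \<epsilon>"
              using d(2)[of x r] r ab st x by (auto simp: dist_norm)
            show "norm (v r - i (w r)) \<le> 2 * L"
              using norm_triangle_ineq4[of "v r" "i (w r)"] norm_velocity_le[of r] norm_i_w_le[of r] r ab'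
              by (auto simp: L_def)
          qed (use \<epsilon> in auto)
          finally show ?thesis .
        qed
      qed fact
      also have "\<epsilon> * (2 * L) * (b - a) \<le> e * (b - a)"
      proof (rule mult_right_mono)
        have "\<epsilon> * (2 * L + 1) = e" using L by (simp add: \<epsilon>_def)
        then show "\<epsilon> * (2 * L) \<le> e" using \<epsilon> by (simp add: distrib_left)
      qed (use ab' in auto)
      finally show ?thesis using Ainc integral_unique[OF D] by simp
    qed
    then show "\<exists>d>0. \<forall>a b. s \<le> a \<longrightarrow> a \<le> x \<longrightarrow> x \<le> b \<longrightarrow> b \<le> t \<longrightarrow> b - a < d \<longrightarrow>
       \<bar>A b - A a - integral {a..b} (\<lambda>r. v r \<bullet> i (w r))\<bar> \<le> e * (b - a)"
      using d(1) by blast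
  qed (use st in auto)
  then show ?thesis by (simp add: A_def)
qed

text \<open>Expand the square of \<open>v r - i (w r)\<close> under the integral and replace the
  mixed term by \<open>integral_velocity_sq\<close>. The direction matters: the dissipation controls
  norms of \<open>w\<close>, and the kinetic term has to be bounded by them.\<close>

lemma integral_velocity_sq_le:
  assumes st: "0 < s" "s \<le> t" "t < T"
  shows "integral {s..t} (\<lambda>r. (norm (v r))\<^sup>2) \<le> integral {s..t} (\<lambda>r. (norm (i (w r)))\<^sup>2)"
proof -
  have "0 \<le> integral {s..t} (\<lambda>r. (norm (v r))\<^sup>2 - v r \<bullet> i (w r) - (v r \<bullet> i (w r) - (norm (i (w r)))\<^sup>2))"
    by (intro integral_nonneg integrable_diff velocity_sq_integrable velocity_w_integrable norm_i_w_sq_integrable st)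
      (simp_all add: st less_le_trans[OF st(1)] power2_norm_eq_inner inner_commute
        flip: inner_diff_left inner_diff_right)
  also have "\<dots> = (integral {s..t} (\<lambda>r. (norm (v r))\<^sup>2) - integral {s..t} (\<lambda>r. v r \<bullet> i (w r)))
     - (integral {s..t} (\<lambda>r. v r \<bullet> i (w r)) - integral {s..t} (\<lambda>r. (norm (i (w r)))\<^sup>2))"
    by (intro integral_unique has_integral_diff integrable_integral velocity_sq_integrable
        velocity_w_integrable norm_i_w_sq_integrable st)
  finally show ?thesis using integral_velocity_sq[OF st] by simp
qed

section \<open>Virial and potential energy identities\<close>

lemma u_bounded: obtains U where "\<And>t. t \<in> {0<..<T} \<Longrightarrow> norm (u t) \<le> U"
proof -
  have "compact (u ` {0..T})" by (rule compact_continuous_image[OF u_cont]) simp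
  then have "bounded (u ` {0..T})" by (rule compact_imp_bounded)
  then obtain U where "\<forall>x\<in>u ` {0..T}. norm x \<le> U" unfolding bounded_iff by blast
  then show thesis by (intro that[of U]) auto
qed

lemma u_continuous: "continuous_on {0<..<T} u"
  by (rule continuous_on_subset[OF u_cont]) auto

lemma z_u_integrable:
  assumes "0 < a" "b < T"
  shows "(\<lambda>r. z r (u r)) integrable_on {a..b}"
proof -
  obtain U where U: "\<And>t. t \<in> {0<..<T} \<Longrightarrow> norm (u t) \<le> U" by (rule u_bounded) blast
  show ?thesis
  proof (rule bounded_measurable_integrable[OF _ _ assms])
    show "(\<lambda>r. z r (u r)) \<in> borel_measurable (lebesgue_on {0<..<T})"
    proof (rule strongly_measurable_Caratheodory[OF _ z_meas, of "\<lambda>y t. blinfun_apply y (u t)"])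
      show "(\<lambda>t. blinfun_apply y (u t)) \<in> borel_measurable (lebesgue_on {0<..<T})" for y :: "'v \<Rightarrow>\<^sub>L real"
        by (rule continuous_measurable) (intro continuous_intros u_continuous)
    qed (auto intro!: continuous_intros)
    show "\<bar>z x (u x)\<bar> \<le> K * U" if "x \<in> {0<..<T}" for x
      using abs_z_le[OF that, of "u x"] U[OF that] K_nonneg that
        mult_left_mono[of "norm (u x)" U K] by auto
  qed
qed

text \<open>A product rule, although only the pairings of \<open>v\<close> with fixed elements of V
  are known to be primitives. On a short interval the increment equals \<open>v b \<bullet> (i (u b)
  - i (u a)) + (v b - v a) \<bullet> i (u a)\<close>, an exact integral with \<open>v\<close> and
  \<open>u\<close> frozen at end points; uniform continuity of \<open>v\<close> and the Lipschitz
  bound of \<open>u\<close> control the freezing.\<close>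

lemma virial_identity:
  assumes st: "0 < s" "s \<le> t" "t < T"
  shows "v t \<bullet> i (u t) - v s \<bullet> i (u s)
    = integral {s..t} (\<lambda>r. v r \<bullet> i (w r)) + integral {s..t} (\<lambda>r. z r (u r))"
proof -
  define L where "L = norm i * C"
  have L: "L \<ge> 0" using C_nonneg st by (simp add: L_def)
  have CK: "C * K \<ge> 0" using C_nonneg K_nonneg st by simp
  have pint: "(\<lambda>r. v r \<bullet> i (w r) + z r (u r)) integrable_on {a..b}" if "0 < a" "b < T" for a b
    by (intro integrable_add velocity_w_integrable z_u_integrable that)
  have "v t \<bullet> i (u t) - v s \<bullet> i (u s) = integral {s..t} (\<lambda>r. v r \<bullet> i (w r) + z r (u r))"
  proof (rule has_integral_if_additive_approximation)
    show "(\<lambda>r. v r \<bullet> i (w r) + z r (u r)) integrable_on {s..t}" using pint st by simp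
    fix x e :: real assume x: "x \<in> {s..t}" and e: "0 < e"
    define \<epsilon> where "\<epsilon> = e / 2 / (L + 1)"
    have \<epsilon>: "\<epsilon> > 0" using e L by (simp add: \<epsilon>_def)
    obtain d where d: "d > 0" "\<And>x y. x \<in> {0<..<T} \<Longrightarrow> y \<in> {0<..<T} \<Longrightarrow> dist y x < d \<Longrightarrow> dist (v y) (v x) < \<epsilon>"
      using uniformly_continuous_on_velocity \<epsilon> unfolding uniformly_continuous_on_def by meson
    \<comment> \<open>Half of \<open>e\<close> is reserved for freezing \<open>v\<close>, through
      \<open>d\<close>, and half for freezing \<open>u\<close>, whose error is at most
      \<open>K * (C * d')\<close>.\<close>
    define d' where "d' = min d (e / 2 / (C * K + 1))"
    have d': "d' > 0" using d(1) e CK by (simp add: d'_def)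
    have "\<bar>v b \<bullet> i (u b) - v a \<bullet> i (u a) - integral {a..b} (\<lambda>r. v r \<bullet> i (w r) + z r (u r))\<bar> \<le> e * (b - a)"
      if ab: "s \<le> a" "a \<le> x" "x \<le> b" "b \<le> t" "b - a < d'" for a b
    proof -
      have ab': "0 < a" "a \<le> b" "b < T" using ab st by auto
      note wx = pairing_velocity_has_integral[OF ab', of "v b"]
      have zx: "((\<lambda>r. z r (u a)) has_integral (v b - v a) \<bullet> i (u a)) {a..b}"
        using velocity_increment[OF ab', of "u a"] z_integrable[of a b "u a"] ab'
        by (simp add: has_integral_integrable_integral)
      have D: "((\<lambda>r. v b \<bullet> i (w r) + z r (u a) - (v r \<bullet> i (w r) + z r (u r))) has_integral
         v b \<bullet> (i (u b) - i (u a)) + (v b - v a) \<bullet> i (u a) - integral {a..b} (\<lambda>r. v r \<bullet> i (w r) + z r (u r))) {a..b}"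
        by (intro has_integral_diff has_integral_add wx zx integrable_integral pint ab')
      have "\<bar>integral {a..b} (\<lambda>r. v b \<bullet> i (w r) + z r (u a) - (v r \<bullet> i (w r) + z r (u r)))\<bar>
          \<le> (\<epsilon> * L + K * (C * d')) * (b - a)"
      proof (rule integral_abs_bound[OF has_integral_integrable[OF D]])
        show "\<bar>v b \<bullet> i (w r) + z r (u a) - (v r \<bullet> i (w r) + z r (u r))\<bar> \<le> \<epsilon> * L + K * (C * d')" if r: "r \<in> {a..b}" for r
        proof -
          have rT: "r \<in> {0<..<T}" using r ab' by auto
          have "v b \<bullet> i (w r) + z r (u a) - (v r \<bullet> i (w r) + z r (u r)) = (v b - v r) \<bullet> i (w r) + z r (u a - u r)"
            by (simp add: inner_diff_left blinfun.diff_right)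
          moreover have "\<bar>(v b - v r) \<bullet> i (w r)\<bar> \<le> \<epsilon> * L"
          proof -
            have "d' \<le> d" by (simp add: d'_def)
            then have "\<bar>b - r\<bar> < d" using r ab(5) unfolding atLeastAtMost_iff by linarith
            then have "norm (v b - v r) \<le> \<epsilon>" using d(2)[of r b] r ab' by (auto simp: dist_norm)
            then show ?thesis
              using Cauchy_Schwarz_ineq2[of "v b - v r" "i (w r)"] norm_i_w_le[OF rT] \<epsilon>
                mult_mono[of "norm (v b - v r)" \<epsilon> "norm (i (w r))" L] by (auto simp: L_def)
          qed
          moreover have "\<bar>z r (u a - u r)\<bar> \<le> K * (C * d')"
          proof -
            have "norm (u a - u r) \<le> C * d'"
              using u_lipschitz[of r a] mult_left_mono[of "\<bar>a - r\<bar>" d' C] C_nonneg r ab ab' by auto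
            then show ?thesis
              using abs_z_le[OF rT, of "u a - u r"] mult_left_mono[of "norm (u a - u r)" "C * d'" K] K_nonneg rT by auto
          qed
          ultimately show ?thesis by linarith
        qed
      qed fact
      also have "(\<epsilon> * L + K * (C * d')) * (b - a) \<le> e * (b - a)"
      proof (rule mult_right_mono)
        have "e / 2 / (L + 1) = \<epsilon>" by (simp only: \<epsilon>_def)
        then have "\<epsilon> * (L + 1) = e / 2" using L by (subst (asm) nonzero_divide_eq_eq) auto
        then have 1: "\<epsilon> * L \<le> e / 2" using \<epsilon> by (simp add: distrib_left)
        have "d' * (C * K + 1) \<le> e / 2 / (C * K + 1) * (C * K + 1)"
          using CK by (intro mult_right_mono) (auto simp: d'_def)
        also have "\<dots> = e / 2"
          by (rule nonzero_divide_eq_eq[THEN iffD1, symmetric]) (use CK in auto)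
        finally have "K * (C * d') \<le> e / 2" using d' by (simp add: algebra_simps)
        then show "\<epsilon> * L + K * (C * d') \<le> e" using 1 by linarith
      qed (use ab' in auto)
      finally show ?thesis
        using integral_unique[OF D] by (simp add: inner_diff_left inner_diff_right)
    qed
    then show "\<exists>d>0. \<forall>a b. s \<le> a \<longrightarrow> a \<le> x \<longrightarrow> x \<le> b \<longrightarrow> b \<le> t \<longrightarrow> b - a < d \<longrightarrow>
       \<bar>v b \<bullet> i (u b) - v a \<bullet> i (u a) - integral {a..b} (\<lambda>r. v r \<bullet> i (w r) + z r (u r))\<bar> \<le> e * (b - a)"
      using d' by blast
  qed (use st in auto)
  then show ?thesis
    using integral_add[OF velocity_w_integrable[of s t] z_u_integrable[of s t]] st by simp
qed

lemma continuous_dual_w_integrable: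
  fixes G :: "real \<Rightarrow> 'v \<Rightarrow>\<^sub>L real"
  assumes G: "continuous_on {0<..<T} G" and B: "\<And>t. t \<in> {0<..<T} \<Longrightarrow> norm (G t) \<le> B"
    and ab: "0 < a" "b < T"
  shows "(\<lambda>r. G r (w r)) integrable_on {a..b}"
proof (rule bounded_measurable_integrable[OF _ _ ab])
  show "(\<lambda>r. G r (w r)) \<in> borel_measurable (lebesgue_on {0<..<T})"
  proof (rule strongly_measurable_Caratheodory[OF _ w_meas, of "\<lambda>y t. blinfun_apply (G t) y"])
    show "(\<lambda>t. blinfun_apply (G t) y) \<in> borel_measurable (lebesgue_on {0<..<T})" for y
      by (rule continuous_measurable) (intro continuous_intros G)
  qed (auto intro!: continuous_intros)
  show "\<bar>G x (w x)\<bar> \<le> B * C" if "x \<in> {0<..<T}" for x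
    using norm_blinfun[of "G x" "w x"] mult_mono[OF B[OF that] w_bound[OF that]] order_trans[OF norm_ge_zero B[OF that]]
    by simp
qed

lemma potential_energy_identity:
  fixes F :: "'v \<Rightarrow> real" and dF :: "'v \<Rightarrow> 'v \<Rightarrow>\<^sub>L real"
  assumes F: "\<And>x. (F has_derivative blinfun_apply (dF x)) (at x)" and dF: "continuous_on UNIV dF"
    and st: "0 < s" "s \<le> t" "t < T"
  shows "F (u t) - F (u s) = integral {s..t} (\<lambda>r. dF (u r) (w r))"
    and "(\<lambda>r. dF (u r) (w r)) integrable_on {s..t}"
proof -
  have cG: "continuous_on {0..T} (\<lambda>r. dF (u r))"
    by (rule continuous_on_compose2[OF dF u_cont]) auto
  then have "compact ((\<lambda>r. dF (u r)) ` {0..T})" by (intro compact_continuous_image) auto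
  then have "bounded ((\<lambda>r. dF (u r)) ` {0..T})" by (rule compact_imp_bounded)
  then obtain B where B: "\<forall>x\<in>(\<lambda>r. dF (u r)) ` {0..T}. norm x \<le> B"
    unfolding bounded_iff by blast
  have cG': "continuous_on {0<..<T} (\<lambda>r. dF (u r))" by (rule continuous_on_subset[OF cG]) auto
  have int: "(\<lambda>r. dF (u r) (w r)) integrable_on {a..b}" if "0 < a" "b < T" for a b
    by (rule continuous_dual_w_integrable[OF cG' _ that, of B]) (use B in auto)
  then show "(\<lambda>r. dF (u r) (w r)) integrable_on {s..t}" using st by simp
  have C: "C \<ge> 0" using C_nonneg st by simp
  show "F (u t) - F (u s) = integral {s..t} (\<lambda>r. dF (u r) (w r))"
  proof (rule has_integral_if_additive_approximation)
    show "(\<lambda>r. dF (u r) (w r)) integrable_on {s..t}" using int st by simp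
    fix x e :: real assume x: "x \<in> {s..t}" and e: "0 < e"
    define \<epsilon> where "\<epsilon> = e / (2 * C + 1)"
    have \<epsilon>: "\<epsilon> > 0" using e C by (simp add: \<epsilon>_def)
    obtain \<rho> where \<rho>: "\<rho> > 0" "\<And>y. norm (y - u x) < \<rho> \<Longrightarrow> \<bar>F y - F (u x) - dF (u x) (y - u x)\<bar> \<le> \<epsilon> * norm (y - u x)"
      using F[of "u x"] \<epsilon> unfolding has_derivative_at_alt real_norm_def by meson
    have "x \<in> {0<..<T}" using x st by auto
    then obtain d2 where d2: "d2 > 0" "\<And>r. r \<in> {0<..<T} \<Longrightarrow> dist r x < d2 \<Longrightarrow> dist (dF (u r)) (dF (u x)) < \<epsilon>"
      using cG' \<epsilon> unfolding continuous_on_iff by meson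
    define d where "d = min d2 (\<rho> / (C + 1))"
    have d: "d > 0" using d2 \<rho> C by (simp add: d_def)
    have "\<bar>F (u b) - F (u a) - integral {a..b} (\<lambda>r. dF (u r) (w r))\<bar> \<le> e * (b - a)"
      if ab: "s \<le> a" "a \<le> x" "x \<le> b" "b \<le> t" "b - a < d" for a b
    proof -
      have ab': "0 < a" "a \<le> b" "b < T" using ab st by auto
      have lin: "\<bar>F (u y) - F (u x) - dF (u x) (u y - u x)\<bar> \<le> \<epsilon> * (C * \<bar>y - x\<bar>)" if y: "y \<in> {a..b}" for y
      proof -
        have l: "norm (u y - u x) \<le> C * \<bar>y - x\<bar>"
          using y x st ab' by (intro u_lipschitz) auto
        have "\<bar>y - x\<bar> < \<rho> / (C + 1)" using y ab by (auto simp: d_def)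
        then have "\<bar>y - x\<bar> * (C + 1) < \<rho>" using C by (simp add: pos_less_divide_eq)
        moreover have "C * \<bar>y - x\<bar> \<le> \<bar>y - x\<bar> * (C + 1)" by (simp add: algebra_simps)
        ultimately have "norm (u y - u x) < \<rho>" using l by linarith
        then have "\<bar>F (u y) - F (u x) - dF (u x) (u y - u x)\<bar> \<le> \<epsilon> * norm (u y - u x)" by (rule \<rho>(2))
        also have "\<dots> \<le> \<epsilon> * (C * \<bar>y - x\<bar>)" using l \<epsilon> by (intro mult_left_mono) auto
        finally show ?thesis .
      qed
      have 1: "\<bar>F (u b) - F (u a) - dF (u x) (u b - u a)\<bar> \<le> \<epsilon> * C * (b - a)"
      proof -
        have "F (u b) - F (u a) - dF (u x) (u b - u a)
          = (F (u b) - F (u x) - dF (u x) (u b - u x)) - (F (u a) - F (u x) - dF (u x) (u a - u x))"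
          by (simp add: blinfun.diff_right)
        moreover have "\<epsilon> * C * (b - a) = \<epsilon> * (C * \<bar>b - x\<bar>) + \<epsilon> * (C * \<bar>a - x\<bar>)"
          using ab by (simp add: algebra_simps)
        ultimately show ?thesis using lin[of b] lin[of a] ab ab' by auto
      qed
      have wx: "((\<lambda>r. dF (u x) (w r)) has_integral dF (u x) (u b - u a)) {a..b}"
        using functional_increment[OF blinfun.bounded_linear_right ab', of "dF (u x)"]
          functional_w_integrable[OF blinfun.bounded_linear_right, of a b "dF (u x)"] ab'
        by (simp add: has_integral_integrable_integral blinfun.diff_right)
      have D: "((\<lambda>r. dF (u x) (w r) - dF (u r) (w r)) has_integral
         dF (u x) (u b - u a) - integral {a..b} (\<lambda>r. dF (u r) (w r))) {a..b}"
        by (intro has_integral_diff wx integrable_integral int ab')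
      have "\<bar>integral {a..b} (\<lambda>r. dF (u x) (w r) - dF (u r) (w r))\<bar> \<le> (\<epsilon> * C) * (b - a)"
      proof (rule integral_abs_bound[OF has_integral_integrable[OF D]])
        show "\<bar>dF (u x) (w r) - dF (u r) (w r)\<bar> \<le> \<epsilon> * C" if r: "r \<in> {a..b}" for r
        proof -
          have rT: "r \<in> {0<..<T}" using r ab' by auto
          have "norm (dF (u x) - dF (u r)) \<le> \<epsilon>"
          proof -
            have "b - a < d2" using ab by (simp add: d_def)
            then have "dist r x < d2" using r ab(2,3) unfolding dist_real_def atLeastAtMost_iff by linarith
            then show ?thesis using d2(2)[OF rT] by (simp add: dist_norm norm_minus_commute)
          qed
          then show ?thesis
            using norm_blinfun[of "dF (u x) - dF (u r)" "w r"] w_bound[OF rT] \<epsilon>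
              mult_mono[of "norm (dF (u x) - dF (u r))" \<epsilon> "norm (w r)" C]
            by (simp add: blinfun.diff_left)
        qed
      qed fact
      then have "\<bar>F (u b) - F (u a) - integral {a..b} (\<lambda>r. dF (u r) (w r))\<bar> \<le> \<epsilon> * C * (b - a) + \<epsilon> * C * (b - a)"
        using 1 integral_unique[OF D] by linarith
      also have "\<dots> = (\<epsilon> * (2 * C)) * (b - a)" by (simp add: algebra_simps)
      also have "\<dots> \<le> e * (b - a)"
      proof (rule mult_right_mono)
        have "\<epsilon> * (2 * C + 1) = e" using C by (simp add: \<epsilon>_def)
        then show "\<epsilon> * (2 * C) \<le> e" using \<epsilon> by (simp add: distrib_left)
      qed (use ab' in auto)
      finally show ?thesis .
    qed
    then show "\<exists>d>0. \<forall>a b. s \<le> a \<longrightarrow> a \<le> x \<longrightarrow> x \<le> b \<longrightarrow> b \<le> t \<longrightarrow> b - a < d \<longrightarrow>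
       \<bar>F (u b) - F (u a) - integral {a..b} (\<lambda>r. dF (u r) (w r))\<bar> \<le> e * (b - a)"
      using d by blast
  qed (use st in auto)
qed

section \<open>Kinetic energy identity\<close>

lemma z_w_integrable:
  assumes "0 < a" "b < T"
  shows "(\<lambda>r. z r (w r)) integrable_on {a..b}"
proof (rule bounded_measurable_integrable[OF _ _ assms])
  show "(\<lambda>r. z r (w r)) \<in> borel_measurable (lebesgue_on {0<..<T})"
    by (rule strongly_measurable_pairing[OF _ w_meas z_meas]) simp
  show "\<bar>z x (w x)\<bar> \<le> K * C" if "x \<in> {0<..<T}" for x
    using abs_z_le[OF that, of "w x"] mult_left_mono[OF w_bound[OF that] K_nonneg] that by auto
qed

text \<open>The functional \<open>z\<close> can only be paired with elements of \<open>V\<close>, so \<open>v\<close> is replaced by the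
  difference quotient \<open>dquot h\<close>, whose image in \<open>H\<close> is differentiable. It is close to \<open>w\<close> in the mean
  because both are close to a continuous approximation \<open>c\<close> of \<open>w\<close>.\<close>

lemma kinetic_energy_estimate:
  assumes st: "0 < s" "s \<le> t" "t < T" and \<eta>: "\<eta> > 0"
  shows "\<bar>(norm (v t))\<^sup>2 / 2 - (norm (v s))\<^sup>2 / 2 - integral {s..t} (\<lambda>r. z r (w r))\<bar> \<le> 2 * K * (\<eta> + \<eta> * T)"
proof -
  have C: "C \<ge> 0" and K: "K \<ge> 0" using C_nonneg K_nonneg st by auto
  obtain c where cc: "continuous_on UNIV c" and cb: "\<And>t. norm (c t) \<le> \<bar>C\<bar> + 1"
    and cm: "(\<lambda>t. norm (w t - c t)) \<in> borel_measurable (lebesgue_on {0<..<T})"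
    and ci: "integral {0<..<T} (\<lambda>t. norm (w t - c t)) < \<eta>"
    by (rule strongly_measurable_approx_continuous[OF w_meas w_bound \<eta>]) blast+
  define \<alpha> where "\<alpha> r = norm (w r - c r)" for r
  have \<alpha>b: "\<bar>\<alpha> r\<bar> \<le> C + (\<bar>C\<bar> + 1)" if "r \<in> {0<..<T}" for r
    using norm_triangle_ineq4[of "w r" "c r"] w_bound[OF that] cb[of r] by (simp add: \<alpha>_def)
  have \<alpha>i: "\<alpha> integrable_on {a..b}" if "0 < a" "b < T" for a b
    by (rule bounded_measurable_integrable[OF _ \<alpha>b that]) (use cm in \<open>simp add: \<alpha>_def\<close>)
  \<comment> \<open>Room on both sides of \<open>{s..t}\<close>, for shifts by a small
    \<open>h\<close> and for derivatives at the end points.\<close>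
  define a where "a = s / 2"
  define b where "b = (t + T) / 2"
  have ab: "0 < a" "a < s" "t < b" "b < T" using st by (auto simp: a_def b_def)
  define R where "R x = integral {a..x} (\<lambda>r. z r (w r))" for x
  define A where "A x = integral {a..x} \<alpha>" for x
  have R: "R y - R x = integral {x..y} (\<lambda>r. z r (w r))" if "a \<le> x" "x \<le> y" "y \<le> b" for x y
    using Henstock_Kurzweil_Integration.integral_combine[of a x y "\<lambda>r. z r (w r)"]
      z_w_integrable[of a y] that ab by (simp add: R_def)
  have A: "A y - A x = integral {x..y} \<alpha>" if "a \<le> x" "x \<le> y" "y \<le> b" for x y
    using Henstock_Kurzweil_Integration.integral_combine[of a x y \<alpha>]
      \<alpha>i[of a y] that ab by (simp add: A_def)
  have Rc: "continuous_on {a..b} R"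
    unfolding R_def by (rule indefinite_integral_continuous_1) (use z_w_integrable ab in auto)
  have Ac: "continuous_on {a..b} A"
    unfolding A_def by (rule indefinite_integral_continuous_1) (use \<alpha>i ab in auto)
  \<comment> \<open>\<open>R\<close> is a primitive of a merely measurable function. Its average
    \<open>(RR (x + h) - RR x) / h\<close> is differentiable at every point concerned and tends to
    \<open>R x\<close>, so it takes the place of \<open>R\<close> for fixed \<open>h\<close>;
    \<open>AA\<close> does the same for the error term \<open>A\<close>.\<close>
  define RR where "RR x = integral {a..x} R" for x
  define AA where "AA x = integral {a..x} A" for x
  have RR: "(RR has_real_derivative R x) (at x)" if "a < x" "x < b" for x
    unfolding RR_def using primitive_DERIV[OF Rc that] .
  have AA: "(AA has_real_derivative A x) (at x)" if "a < x" "x < b" for x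
    unfolding AA_def using primitive_DERIV[OF Ac that] .
  have "uniformly_continuous_on {a..b} c"
    by (rule compact_uniformly_continuous[OF continuous_on_subset[OF cc]]) auto
  then obtain d0 where d0: "d0 > 0" "\<And>x y. x \<in> {a..b} \<Longrightarrow> y \<in> {a..b} \<Longrightarrow> dist y x < d0 \<Longrightarrow> dist (c y) (c x) < \<eta>"
    using \<eta> unfolding uniformly_continuous_on_def by meson
  define G where "G h x = (norm (i (dquot h x)))\<^sup>2 / 2 - (RR (x + h) - RR x) / h" for h x
  define H where "H h x = 2 * K * ((AA (x + h) - AA x) / h + \<eta> * x)" for h x
  have bound: "\<bar>G h t - G h s\<bar> \<le> H h t - H h s" if h: "0 < h" "h < d0" "t + h < b" for h
  proof (rule abs_increment_le_if_abs_deriv_le[OF st(2)])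
    fix x assume x: "x \<in> {s..t}"
    have xh: "0 < x" "x < T" "0 < x + h" "x + h < T" "a < x" "x + h < b" using x h ab st by auto
    have di: "((\<lambda>x. i (dquot h x)) has_vector_derivative (1 / h) *\<^sub>R (v (x + h) - v x)) (at x)"
    proof -
      have "((\<lambda>x. i (u (x + h))) has_vector_derivative 1 *\<^sub>R v (x + h)) (at x)"
      proof (rule vector_diff_chain_at[of "\<lambda>x. x + h" 1 x "\<lambda>x. i (u x)", unfolded o_def])
        show "((\<lambda>x. x + h) has_vector_derivative 1) (at x)"
          unfolding has_real_derivative_iff_has_vector_derivative[symmetric]
          by (auto intro!: derivative_eq_intros)
      qed (use has_velocity xh in auto)
      then have "((\<lambda>x. i (u (x + h)) - i (u x)) has_vector_derivative v (x + h) - v x) (at x)"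
        using has_vector_derivative_diff has_velocity[of x] xh by fastforce
      from bounded_linear.has_vector_derivative[OF bounded_linear_scaleR_right this, of "1 / h"]
      show ?thesis by (simp add: dquot_def blinfun.scaleR_right blinfun.diff_right)
    qed
    have "((\<lambda>x. i (dquot h x) \<bullet> i (dquot h x)) has_vector_derivative
        i (dquot h x) \<bullet> ((1 / h) *\<^sub>R (v (x + h) - v x)) + ((1 / h) *\<^sub>R (v (x + h) - v x)) \<bullet> i (dquot h x)) (at x)"
      by (rule bounded_bilinear.has_vector_derivative[OF bounded_bilinear_inner di di])
    then have "((\<lambda>x. (norm (i (dquot h x)))\<^sup>2) has_real_derivative 2 * ((v (x + h) - v x) \<bullet> i (dquot h x) / h)) (at x)"
      by (simp add: has_real_derivative_iff_has_vector_derivative power2_norm_eq_inner inner_commute)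
    then have dN: "((\<lambda>x. (norm (i (dquot h x)))\<^sup>2 / 2) has_real_derivative (v (x + h) - v x) \<bullet> i (dquot h x) / h) (at x)"
      using DERIV_cdivide[of _ _ _ _ 2] by fastforce
    have shift: "((\<lambda>x. f (x + h)) has_real_derivative f') (at x)"
      if "(f has_real_derivative f') (at (x + h))" for f f'
      using that by (simp add: DERIV_shift)
    show "(G h has_real_derivative (v (x + h) - v x) \<bullet> i (dquot h x) / h - (R (x + h) - R x) / h) (at x)"
      unfolding G_def by (intro DERIV_diff dN DERIV_cdivide shift RR) (use xh h in auto)
    have "((\<lambda>x. \<eta> * x) has_real_derivative \<eta>) (at x)" by (auto intro!: derivative_eq_intros)
    then show "(H h has_real_derivative 2 * K * ((A (x + h) - A x) / h + \<eta>)) (at x)"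
      unfolding H_def by (intro DERIV_cmult DERIV_add DERIV_diff DERIV_cdivide shift AA) (use xh h in auto)
    define S where "S = A (x + h) - A x"
    have S: "S = integral {x..x + h} \<alpha>" using A[of x "x + h"] xh h by (simp add: S_def)
    have cx: "norm (w r - c x) \<le> \<alpha> r + \<eta>" if "r \<in> {x..x + h}" for r
    proof -
      have "dist (c r) (c x) < \<eta>" by (rule d0(2)) (use that xh h in \<open>auto simp: dist_real_def\<close>)
      then show ?thesis using norm_triangle_ineq[of "w r - c r" "c r - c x"] by (simp add: \<alpha>_def dist_norm)
    qed
    have \<alpha>\<eta>: "((\<lambda>r. \<alpha> r + \<eta>) has_integral S + \<eta> * h) {x..x + h}"
      unfolding S using has_integral_add[OF integrable_integral[OF \<alpha>i[of x "x + h"]] has_integral_const_real[of \<eta> x "x + h"]] xh h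
      by (simp add: mult.commute)
    \<comment> \<open>The quotient is in effect the mean of \<open>w\<close> over
      \<open>{x..x + h}\<close>, so its distance from \<open>c x\<close> is at most the mean of
      \<open>\<alpha> r + \<eta>\<close>. Testing with \<open>e\<close> itself proves this by real
      integrals.\<close>
    define e where "e = dquot h x - c x"
    have e: "h * norm e \<le> S + \<eta> * h"
    proof (cases "e = 0")
      case True
      have "0 \<le> S" unfolding S using \<alpha>i[of x "x + h"] xh by (intro integral_nonneg) (auto simp: \<alpha>_def)
      then show ?thesis using True \<eta> h by simp
    next
      case False
      have wi: "((\<lambda>r. e \<bullet> w r) has_integral e \<bullet> u (x + h) - e \<bullet> u x) {x..x + h}"
        using functional_increment[OF bounded_linear_inner_right, of x "x + h" e]
          functional_w_integrable[OF bounded_linear_inner_right, of x "x + h" e] xh h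
        by (simp add: has_integral_integrable_integral)
      have D: "((\<lambda>r. e \<bullet> w r - e \<bullet> c x) has_integral e \<bullet> u (x + h) - e \<bullet> u x - h * (e \<bullet> c x)) {x..x + h}"
        using has_integral_diff[OF wi has_integral_const_real[of "e \<bullet> c x" x "x + h"]] h by simp
      have "h * (norm e * norm e) = e \<bullet> u (x + h) - e \<bullet> u x - h * (e \<bullet> c x)"
      proof -
        have "norm e * norm e = e \<bullet> dquot h x - e \<bullet> c x"
          by (simp add: e_def inner_diff_right[symmetric] power2_norm_eq_inner[symmetric] power2_eq_square)
        then show ?thesis using h by (simp add: dquot_def inner_diff_right field_simps)
      qed
      also have "\<dots> \<le> norm e * (S + \<eta> * h)"
      proof (rule has_integral_le[OF D has_integral_mult_right[OF \<alpha>\<eta>]])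
        fix r assume r: "r \<in> {x..x + h}"
        have "e \<bullet> w r - e \<bullet> c x = e \<bullet> (w r - c x)" by (simp add: inner_diff_right)
        also have "\<dots> \<le> norm e * norm (w r - c x)" by (rule norm_cauchy_schwarz)
        also have "\<dots> \<le> norm e * (\<alpha> r + \<eta>)" using cx[OF r] by (rule mult_left_mono) simp
        finally show "e \<bullet> w r - e \<bullet> c x \<le> norm e * (\<alpha> r + \<eta>)" .
      qed
      finally have "norm e * (h * norm e) \<le> norm e * (S + \<eta> * h)" by (simp add: mult.left_commute)
      then show ?thesis using False by (simp add: mult_le_cancel_left_pos)
    qed
    have zD: "((\<lambda>r. z r (dquot h x)) has_integral (v (x + h) - v x) \<bullet> i (dquot h x)) {x..x + h}"
      using velocity_increment[of x "x + h" "dquot h x"] z_integrable[of x "x + h" "dquot h x"] xh h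
      by (simp add: has_integral_integrable_integral)
    have zw: "((\<lambda>r. z r (w r)) has_integral R (x + h) - R x) {x..x + h}"
      using R[of x "x + h"] z_w_integrable[of x "x + h"] xh h by (simp add: has_integral_integrable_integral)
    have D: "((\<lambda>r. z r (dquot h x) - z r (w r)) has_integral (v (x + h) - v x) \<bullet> i (dquot h x) - (R (x + h) - R x)) {x..x + h}"
      by (rule has_integral_diff[OF zD zw])
    have D2: "((\<lambda>r. K * ((\<alpha> r + \<eta>) + norm e)) has_integral K * (S + \<eta> * h + h * norm e)) {x..x + h}"
      using has_integral_const_real[of "norm e" x "x + h"] h by (intro has_integral_mult_right has_integral_add \<alpha>\<eta>) simp
    have "norm ((v (x + h) - v x) \<bullet> i (dquot h x) - (R (x + h) - R x)) \<le> K * (S + \<eta> * h + h * norm e)"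
    proof (rule integral_norm_bound_integral[OF has_integral_integrable[OF D] has_integral_integrable[OF D2],
          unfolded integral_unique[OF D] integral_unique[OF D2]])
      fix r assume r: "r \<in> {x..x + h}"
      have "norm (z r (dquot h x) - z r (w r)) \<le> K * norm (dquot h x - w r)"
        using abs_z_le[of r "dquot h x - w r"] r xh by (simp add: blinfun.diff_right)
      also have "norm (dquot h x - w r) \<le> (\<alpha> r + \<eta>) + norm e"
        using norm_triangle_ineq4[of "dquot h x - c x" "w r - c x"] cx[OF r] by (simp add: e_def)
      finally show "norm (z r (dquot h x) - z r (w r)) \<le> K * ((\<alpha> r + \<eta>) + norm e)"
        using K by (simp add: mult_left_mono)
    qed
    \<comment> \<open>Both legs of the detour through \<open>c x\<close>, from \<open>w r\<close>
      and from the quotient, cost at most \<open>S + \<eta> * h\<close>, hence the factor 2.\<close>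
    also have "\<dots> \<le> K * (2 * (S + \<eta> * h))" using e K by (intro mult_left_mono) auto
    finally have "\<bar>(v (x + h) - v x) \<bullet> i (dquot h x) - (R (x + h) - R x)\<bar> / h \<le> K * (2 * (S + \<eta> * h)) / h"
      using h by (intro divide_right_mono) auto
    also have "\<dots> = 2 * K * (S / h + \<eta>)" using h by (simp add: field_simps)
    finally show "\<bar>(v (x + h) - v x) \<bullet> i (dquot h x) / h - (R (x + h) - R x) / h\<bar> \<le> 2 * K * ((A (x + h) - A x) / h + \<eta>)"
      using h by (simp add: S_def diff_divide_distrib[symmetric])
  qed
  have lim: "((\<lambda>h. (f (x + h) - f x) / h) \<longlongrightarrow> f') (at_right 0)"
    if "(f has_real_derivative f') (at x)" for f :: "real \<Rightarrow> real" and f' x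
    using that unfolding DERIV_def by (rule tendsto_within_subset) auto
  have limD: "((\<lambda>h. i (dquot h x)) \<longlongrightarrow> v x) (at_right 0)" if "0 < x" "x < T" for x
    using dquot_tendsto_velocity[OF that] by (rule tendsto_within_subset) auto
  have limG: "((\<lambda>h. G h x) \<longlongrightarrow> (norm (v x))\<^sup>2 / 2 - R x) (at_right 0)" if "x \<in> {s, t}" for x
    unfolding G_def using that st ab by (intro tendsto_intros lim RR limD) auto
  have limH: "((\<lambda>h. H h x) \<longlongrightarrow> 2 * K * (A x + \<eta> * x)) (at_right 0)" if "x \<in> {s, t}" for x
    unfolding H_def using that st ab by (intro tendsto_intros lim AA) auto
  have "\<bar>((norm (v t))\<^sup>2 / 2 - R t) - ((norm (v s))\<^sup>2 / 2 - R s)\<bar> \<le> 2 * K * (A t + \<eta> * t) - 2 * K * (A s + \<eta> * s)"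
  proof (rule tendsto_le[OF trivial_limit_at_right_real])
    show "((\<lambda>h. \<bar>G h t - G h s\<bar>) \<longlongrightarrow> \<bar>((norm (v t))\<^sup>2 / 2 - R t) - ((norm (v s))\<^sup>2 / 2 - R s)\<bar>) (at_right 0)"
      by (intro tendsto_intros limG) auto
    show "((\<lambda>h. H h t - H h s) \<longlongrightarrow> 2 * K * (A t + \<eta> * t) - 2 * K * (A s + \<eta> * s)) (at_right 0)"
      by (intro tendsto_diff limH) auto
    have "eventually (\<lambda>h. h \<in> {0<..<min d0 (b - t)}) (at_right 0)"
      by (rule eventually_at_right_real) (use d0 ab in auto)
    then show "eventually (\<lambda>h. \<bar>G h t - G h s\<bar> \<le> H h t - H h s) (at_right 0)"
      by eventually_elim (rule bound, auto)
  qed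
  also have "\<dots> = 2 * K * ((A t - A s) + \<eta> * (t - s))" by (simp add: algebra_simps)
  also have "\<dots> \<le> 2 * K * (\<eta> + \<eta> * T)"
  proof (intro mult_left_mono add_mono)
    have "A t - A s = integral {s..t} \<alpha>" using A[of s t] st ab by simp
    also have "\<dots> \<le> integral {0<..<T} \<alpha>"
    proof (rule integral_subset_le)
      show "\<alpha> integrable_on {0<..<T}"
        by (rule bounded_measurable_integrable_on[OF _ \<alpha>b]) (use cm in \<open>simp add: \<alpha>_def\<close>)
    qed (use st \<alpha>i in \<open>auto simp: \<alpha>_def\<close>)
    finally show "A t - A s \<le> \<eta>" using ci by (simp add: \<alpha>_def[abs_def])
  qed (use st \<eta> K in auto)
  also have "((norm (v t))\<^sup>2 / 2 - R t) - ((norm (v s))\<^sup>2 / 2 - R s)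
     = (norm (v t))\<^sup>2 / 2 - (norm (v s))\<^sup>2 / 2 - integral {s..t} (\<lambda>r. z r (w r))"
    using R[of s t] st ab by simp
  finally show ?thesis .
qed

text \<open>The approximation \<open>c\<close> has disappeared from the estimate, so
  \<open>\<eta>\<close> may tend to 0.\<close>

theorem kinetic_energy_identity:
  assumes st: "0 < s" "s \<le> t" "t < T"
  shows "(norm (v t))\<^sup>2 / 2 - (norm (v s))\<^sup>2 / 2 = integral {s..t} (\<lambda>r. z r (w r))"
proof -
  define x where "x = \<bar>(norm (v t))\<^sup>2 / 2 - (norm (v s))\<^sup>2 / 2 - integral {s..t} (\<lambda>r. z r (w r))\<bar>"
  have "((\<lambda>\<eta>. 2 * K * (\<eta> + \<eta> * T)) \<longlongrightarrow> 2 * K * (0 + 0 * T)) (at_right 0)" by (intro tendsto_intros)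
  moreover have "eventually (\<lambda>\<eta>. x \<le> 2 * K * (\<eta> + \<eta> * T)) (at_right 0)"
    using eventually_at_right_less[of 0]
    by eventually_elim (use kinetic_energy_estimate[OF st] in \<open>simp add: x_def\<close>)
  ultimately have "x \<le> 2 * K * (0 + 0 * T)"
    by (intro tendsto_lowerbound) auto
  then show ?thesis by (simp add: x_def)
qed

end

section \<open>From window lengths to decay\<close>

text \<open>A form of Young's inequality: either \<open>x powr p\<close> is at most
  \<open>\<eta>\<close>, or \<open>x\<close> is bounded below and the higher power dominates with
  the stated factor. It trades the powers 2 and \<alpha>+1 for the dissipated power
  \<alpha>+2.\<close>

lemma powr_interpolation:
  fixes x \<eta> p q :: real
  assumes "0 \<le> x" "0 < \<eta>" "0 < p" "p < q"
  shows "x powr p \<le> \<eta> + \<eta> powr (- (q - p) / p) * x powr q"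
proof (cases "x powr p \<le> \<eta>")
  case True
  then show ?thesis using assms by (intro add_increasing2) auto
next
  case False
  then have x: "x > 0" using assms by (cases "x = 0") auto
  have "(x powr p) powr (- (q - p) / p) \<le> \<eta> powr (- (q - p) / p)"
    using False assms by (intro powr_mono2') (auto simp: divide_le_0_iff)
  then have "x powr (- (q - p)) \<le> \<eta> powr (- (q - p) / p)"
    using assms by (simp add: powr_powr)
  then have "x powr (- (q - p)) * x powr q \<le> \<eta> powr (- (q - p) / p) * x powr q"
    by (rule mult_right_mono) simp
  then have "x powr p \<le> \<eta> powr (- (q - p) / p) * x powr q"
    using x by (simp add: powr_add[symmetric])
  then show ?thesis using assms by linarith
qed

lemma powr_between:
  fixes e p q r :: real
  assumes "e > 0" "min p q \<le> r" "r \<le> max p q"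
  shows "e powr (- r) \<le> e powr (- p) + e powr (- q)"
proof (cases "e \<ge> 1")
  case True
  have "e powr (- r) \<le> e powr (- min p q)" using True assms by (intro powr_mono) auto
  also have "\<dots> \<le> e powr (- p) + e powr (- q)" by (simp add: min_def)
  finally show ?thesis .
next
  case False
  have "e powr (- r) \<le> e powr (- max p q)" using False assms by (intro powr_mono') auto
  also have "\<dots> \<le> e powr (- p) + e powr (- q)" by (simp add: max_def)
  finally show ?thesis .
qed

text \<open>With r = 1/2 - 1/(\<beta>+2), the differences \<alpha>/2 - r and r -
  (\<beta>-\<alpha>)/((\<alpha>+1)(\<beta>+2)) are positive multiples of the same number
  \<open>X\<close>. The exponent -r is what the end values in the virial identity leave after
  division by the energy level.\<close>

lemma exponent_between:
  fixes \<alpha> \<beta> :: real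
  assumes "0 < \<alpha>" "\<alpha> < \<beta>"
  shows "min (\<alpha> / 2) ((\<beta> - \<alpha>) / ((\<alpha> + 1) * (\<beta> + 2))) \<le> 1 / 2 - 1 / (\<beta> + 2)"
    and "1 / 2 - 1 / (\<beta> + 2) \<le> max (\<alpha> / 2) ((\<beta> - \<alpha>) / ((\<alpha> + 1) * (\<beta> + 2)))"
proof -
  define r where "r = 1 / 2 - 1 / (\<beta> + 2)"
  define g where "g = (\<beta> - \<alpha>) / ((\<alpha> + 1) * (\<beta> + 2))"
  define X where "X = \<alpha> * \<beta> + 2 * \<alpha> - \<beta>"
  have 1: "\<alpha> / 2 - r = X / (2 * (\<beta> + 2))"
    using assms by (simp add: r_def X_def field_simps)
  have "r = \<beta> / (2 * (\<beta> + 2))" using assms by (simp add: r_def field_simps)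
  then have r: "r = \<beta> * (\<alpha> + 1) / (2 * ((\<alpha> + 1) * (\<beta> + 2)))" using assms by simp
  have "g = 2 * (\<beta> - \<alpha>) / (2 * ((\<alpha> + 1) * (\<beta> + 2)))"
    unfolding g_def by (rule mult_divide_mult_cancel_left[symmetric]) simp
  then have 2: "r - g = X / (2 * ((\<alpha> + 1) * (\<beta> + 2)))"
    unfolding r by (simp only: diff_divide_distrib[symmetric]) (simp add: X_def algebra_simps)
  have pos: "0 < 2 * (\<beta> + 2)" "0 < 2 * ((\<alpha> + 1) * (\<beta> + 2))" using assms by simp_all
  have "min (\<alpha> / 2) g \<le> r \<and> r \<le> max (\<alpha> / 2) g"
  proof (cases "X \<ge> 0")
    case True
    then have "0 \<le> X / (2 * (\<beta> + 2))" "0 \<le> X / (2 * ((\<alpha> + 1) * (\<beta> + 2)))"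
      using pos by (auto intro: divide_nonneg_pos)
    then show ?thesis using 1 2 by linarith
  next
    case False
    then have "X / (2 * (\<beta> + 2)) \<le> 0" "X / (2 * ((\<alpha> + 1) * (\<beta> + 2))) \<le> 0"
      using pos by (auto intro: divide_nonpos_pos)
    then show ?thesis using 1 2 by linarith
  qed
  then show "min (\<alpha> / 2) ((\<beta> - \<alpha>) / ((\<alpha> + 1) * (\<beta> + 2))) \<le> 1 / 2 - 1 / (\<beta> + 2)"
    and "1 / 2 - 1 / (\<beta> + 2) \<le> max (\<alpha> / 2) ((\<beta> - \<alpha>) / ((\<alpha> + 1) * (\<beta> + 2)))"
    by (auto simp: r_def g_def)
qed

text \<open>\<open>I2\<close> and \<open>I1\<close> stand for the integrals of the second and the
  (\<alpha>+1)-th power of the norm of \<open>u'\<close> in X. Each term on the right is brought to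
  the form e times the sum of a small multiple of \<open>\<Delta>\<close> and a constant multiple of
  the two negative powers; the small multiples are absorbed on the left and e is divided
  out.\<close>

lemma window_length_bound:
  fixes \<alpha> \<beta> \<delta>2 \<delta>3 a b c :: real
  assumes \<alpha>\<beta>: "0 < \<alpha>" "\<alpha> < \<beta>" and pos: "0 < \<delta>2" "0 < \<delta>3" "0 \<le> a" "0 \<le> b" "0 \<le> c"
  defines "m \<equiv> 1 / (\<beta> + 2)"
  obtains M where "M > 0" "\<And>e \<Delta> I1 I2. e > 0 \<Longrightarrow> \<Delta> \<ge> 0 \<Longrightarrow>
     \<delta>2 * (e / 2) * \<Delta> \<le> c * e powr (1 / 2 + m) + a * I2 + b * e powr m * I1 \<Longrightarrow>
     (\<And>\<eta>. \<eta> > 0 \<Longrightarrow> I2 \<le> \<eta> * \<Delta> + \<eta> powr (- \<alpha> / 2) * (e / (2 * \<delta>3))) \<Longrightarrow>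
     (\<And>\<eta>. \<eta> > 0 \<Longrightarrow> I1 \<le> \<eta> * \<Delta> + \<eta> powr (- 1 / (\<alpha> + 1)) * (e / (2 * \<delta>3))) \<Longrightarrow>
     \<Delta> \<le> M * (e powr (- (\<alpha> / 2)) + e powr (- ((\<beta> - \<alpha>) / ((\<alpha> + 1) * (\<beta> + 2)))))"
proof -
  \<comment> \<open>Small enough for the absorbed terms to take at most half of the left side,
    \<open>\<delta>2 / 2 * \<Delta>\<close>; the 1 covers \<open>a = b = 0\<close>.\<close>
  define \<eta> where "\<eta> = \<delta>2 / 4 / (a + b + 1)"
  define A where "A = a * \<eta> powr (- \<alpha> / 2) / (2 * \<delta>3)"
  define B where "B = b * \<eta> powr (- 1 / (\<alpha> + 1)) / (2 * \<delta>3)"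
  define M where "M = 4 / \<delta>2 * (c + A + B + 1)"
  have \<eta>: "\<eta> > 0" using pos by (simp add: \<eta>_def)
  have AB: "A \<ge> 0" "B \<ge> 0" using pos by (auto simp: A_def B_def)
  show thesis
  proof (rule that[of M])
    show "M > 0" using pos AB by (simp add: M_def add_nonneg_pos)
    fix e \<Delta> I1 I2 :: real
    assume e: "e > 0" and \<Delta>: "\<Delta> \<ge> 0"
      and main: "\<delta>2 * (e / 2) * \<Delta> \<le> c * e powr (1 / 2 + m) + a * I2 + b * e powr m * I1"
      and I2: "\<And>\<eta>. \<eta> > 0 \<Longrightarrow> I2 \<le> \<eta> * \<Delta> + \<eta> powr (- \<alpha> / 2) * (e / (2 * \<delta>3))"
      and I1: "\<And>\<eta>. \<eta> > 0 \<Longrightarrow> I1 \<le> \<eta> * \<Delta> + \<eta> powr (- 1 / (\<alpha> + 1)) * (e / (2 * \<delta>3))"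
    define g1 where "g1 = \<alpha> / 2"
    define g2 where "g2 = (\<beta> - \<alpha>) / ((\<alpha> + 1) * (\<beta> + 2))"
    define X where "X = e powr (- g1) + e powr (- g2)"
    have m01: "e powr (1 / 2 + m) = e * e powr (- (1 / 2 - m))"
      using e by (simp add: powr_mult_base)
    have "e powr (- (1 / 2 - m)) \<le> X"
      unfolding X_def m_def g1_def g2_def by (rule powr_between[OF e exponent_between[OF \<alpha>\<beta>]])
    then have t1: "c * e powr (1 / 2 + m) \<le> e * (c * X)"
      unfolding m01 using pos e by (simp add: mult.left_commute mult_left_mono)
    have t2: "a * I2 \<le> e * (a * \<eta> * \<Delta> + A * X)"
    proof -
      \<comment> \<open>The instance at \<open>\<eta> * e\<close> makes the coefficient of
        \<open>\<Delta>\<close> proportional to \<open>e\<close> and leaves the power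
        \<open>- g1\<close> of \<open>e\<close>.\<close>
      have "I2 \<le> (\<eta> * e) * \<Delta> + (\<eta> * e) powr (- \<alpha> / 2) * (e / (2 * \<delta>3))" using \<eta> e by (intro I2) simp
      also have "(\<eta> * e) powr (- \<alpha> / 2) = \<eta> powr (- \<alpha> / 2) * e powr (- g1)"
        using \<eta> e by (simp add: powr_mult g1_def)
      finally have "a * I2 \<le> a * ((\<eta> * e) * \<Delta> + \<eta> powr (- \<alpha> / 2) * e powr (- g1) * (e / (2 * \<delta>3)))"
        using pos(3) by (rule mult_left_mono)
      also have "\<dots> = e * (a * \<eta> * \<Delta> + A * e powr (- g1))"
        by (simp add: A_def algebra_simps)
      also have "\<dots> \<le> e * (a * \<eta> * \<Delta> + A * X)"
        using e AB by (intro mult_left_mono add_left_mono) (auto simp: X_def)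
      finally show ?thesis .
    qed
    have t3: "b * e powr m * I1 \<le> e * (b * \<eta> * \<Delta> + B * X)"
    proof -
      \<comment> \<open>Chosen so that the factor \<open>e powr m\<close> in front of
        \<open>I1\<close> again yields a coefficient proportional to \<open>e\<close>; the power
        left over is \<open>- g2\<close>, as computed in \<open>ex\<close>.\<close>
      define y where "y = \<eta> * e powr (1 - m)"
      have y: "y > 0" using \<eta> e by (simp add: y_def)
      have 1: "e powr m * y = \<eta> * e"
        using e by (simp add: y_def powr_add[symmetric] mult.left_commute)
      have ex: "m + (1 - m) * (- 1 / (\<alpha> + 1)) = - g2"
      proof -
        have "(\<alpha> + 1) * (\<beta> + 2) \<noteq> 0" using \<alpha>\<beta> by auto
        have "m * (\<alpha> + 2) - 1 = - ((\<beta> - \<alpha>) / (\<beta> + 2))"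
          using \<alpha>\<beta> by (simp add: m_def field_simps)
        then have "(m * (\<alpha> + 2) - 1) / (\<alpha> + 1) = - g2"
          by (simp add: g2_def)
        moreover have "m + (1 - m) * (- 1 / (\<alpha> + 1)) = (m * (\<alpha> + 2) - 1) / (\<alpha> + 1)"
          using \<alpha>\<beta> by (simp add: field_simps)
        ultimately show ?thesis by simp
      qed
      have 2: "e powr m * y powr (- 1 / (\<alpha> + 1)) = \<eta> powr (- 1 / (\<alpha> + 1)) * e powr (- g2)"
      proof -
        have "y powr (- 1 / (\<alpha> + 1)) = \<eta> powr (- 1 / (\<alpha> + 1)) * e powr ((1 - m) * (- 1 / (\<alpha> + 1)))"
          unfolding y_def using \<eta> e by (subst powr_mult) (auto simp: powr_powr)
        then show ?thesis unfolding ex[symmetric] powr_add by simp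
      qed
      have "b * e powr m * I1 \<le> b * e powr m * (y * \<Delta> + y powr (- 1 / (\<alpha> + 1)) * (e / (2 * \<delta>3)))"
        using pos I1[OF y] by (intro mult_left_mono) auto
      also have "\<dots> = b * ((e powr m * y) * \<Delta> + (e powr m * y powr (- 1 / (\<alpha> + 1))) * (e / (2 * \<delta>3)))"
        by (simp add: algebra_simps)
      also have "\<dots> = e * (b * \<eta> * \<Delta> + B * e powr (- g2))"
        unfolding 1 2 by (simp add: B_def algebra_simps)
      also have "\<dots> \<le> e * (b * \<eta> * \<Delta> + B * X)"
        using e AB by (intro mult_left_mono add_left_mono) (auto simp: X_def)
      finally show ?thesis .
    qed
    have "e * (\<delta>2 / 2 * \<Delta>) \<le> e * (c * X + (a * \<eta> * \<Delta> + A * X) + (b * \<eta> * \<Delta> + B * X))"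
      using main t1 t2 t3 by (simp add: algebra_simps)
    then have "\<delta>2 / 2 * \<Delta> \<le> c * X + (a * \<eta> * \<Delta> + A * X) + (b * \<eta> * \<Delta> + B * X)"
      using e by (simp only: mult_le_cancel_left_pos)
    then have "\<delta>2 / 2 * \<Delta> \<le> (a + b) * \<eta> * \<Delta> + (c + A + B) * X"
      by (simp add: algebra_simps)
    moreover have "(a + b) * \<eta> * \<Delta> \<le> \<delta>2 / 4 * \<Delta>"
    proof (rule mult_right_mono[OF _ \<Delta>])
      have "\<eta> * (a + b + 1) = \<delta>2 / 4"
        unfolding \<eta>_def by (rule nonzero_divide_eq_eq[THEN iffD1, OF _ refl, symmetric]) (use pos in simp)
      then show "(a + b) * \<eta> \<le> \<delta>2 / 4" using \<eta> by (simp add: algebra_simps)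
    qed
    ultimately have "\<delta>2 / 4 * \<Delta> \<le> (c + A + B) * X" by (simp add: algebra_simps)
    also have "\<dots> \<le> (c + A + B + 1) * X" by (intro mult_right_mono) (auto simp: X_def)
    finally have "\<Delta> \<le> M * X" using pos by (simp add: M_def field_simps)
    then show "\<Delta> \<le> M * (e powr (- (\<alpha> / 2)) + e powr (- ((\<beta> - \<alpha>) / ((\<alpha> + 1) * (\<beta> + 2)))))"
      by (simp add: X_def g1_def g2_def)
  qed
qed

section \<open>Dyadic summation and the decay rate\<close>

lemma dyadic_powr_sum_le:
  fixes e g :: real
  assumes "e > 0" "g > 0"
  shows "(\<Sum>k<N. (2 ^ k * e) powr (- g)) \<le> e powr (- g) / (1 - 2 powr (- g))"
proof -
  define q :: real where "q = 2 powr (- g)"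
  have q: "0 < q" "q < 1" using assms by (auto simp: q_def powr_less_one)
  have "(2 ^ k * e) powr (- g) = q ^ k * e powr (- g)" for k :: nat
  proof -
    have "(2 ^ k :: real) powr (- g) = q ^ k"
      by (simp add: q_def powr_realpow[symmetric] powr_powr mult.commute powr_power)
    then show ?thesis using assms by (simp add: powr_mult)
  qed
  then have "(\<Sum>k<N. (2 ^ k * e) powr (- g)) = (\<Sum>k<N. q ^ k) * e powr (- g)"
    by (simp add: sum_distrib_right)
  also have "(\<Sum>k<N. q ^ k) \<le> 1 / (1 - q)"
    using q by (simp add: sum_gp_strict divide_right_mono)
  finally show ?thesis by (simp add: q_def mult_right_mono)
qed

text \<open>Since each halving of the energy from level \<open>e\<close> takes time at most
  \<open>M (e\<^sup>-\<^sup>g\<^sup>1 + e\<^sup>-\<^sup>g\<^sup>2)\<close>, summing over the dyadic levels above \<open>e\<close> bounds the time needed to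
  come down to \<open>e\<close> from an arbitrarily large energy; this is why the rate does not depend on the
  initial data.\<close>

lemma time_bound_if_halving:
  fixes E :: "real \<Rightarrow> real"
  assumes mono: "\<And>s t. 0 < s \<Longrightarrow> s \<le> t \<Longrightarrow> E t \<le> E s"
    and cont: "\<And>s t. 0 < s \<Longrightarrow> continuous_on {s..t} E"
    and M: "M > 0" and g: "g1 > 0" "g2 > 0"
    and halving: "\<And>s t. 0 < s \<Longrightarrow> s \<le> t \<Longrightarrow> 0 < E s \<Longrightarrow> E s / 2 \<le> E t \<Longrightarrow>
       t - s \<le> M * (E s powr (- g1) + E s powr (- g2))"
    and t: "t > 0" and e: "E t > 0"
  shows "t \<le> M * (1 + 1 / (1 - 2 powr (- g1)) + 1 / (1 - 2 powr (- g2))) * (E t powr (- g1) + E t powr (- g2))"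
proof -
  define h where "h x = x powr (- g1) + x powr (- g2)" for x :: real
  define e where "e = E t"
  have e0: "e > 0" using e by (simp add: e_def)
  \<comment> \<open>\<open>N\<close> counts the dyadic levels between \<open>E s\<close> and
    \<open>e\<close>. The extra \<open>M * h e\<close> pays for the last stretch, where the energy
    has reached \<open>e\<close> and stays there until \<open>t\<close>.\<close>
  have claim: "t - s \<le> M * h e + M * (\<Sum>k<N. h (2 ^ k * e))" if "0 < s" "s \<le> t" "E s \<le> 2 ^ N * e" for N s
    using that
  proof (induction N arbitrary: s)
    case 0
    then have "E s = e" using mono[of s t] by (simp add: e_def)
    then show ?case using halving[of s t] 0 e by (simp add: e_def h_def)
  next
    case (Suc N)
    show ?case
    proof (cases "E s \<le> 2 ^ N * e")
      case True
      have "0 \<le> M * h (2 ^ N * e)" using M by (simp add: h_def)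
      moreover have "M * (\<Sum>k<Suc N. h (2 ^ k * e)) = M * (\<Sum>k<N. h (2 ^ k * e)) + M * h (2 ^ N * e)"
        by (simp add: distrib_left)
      ultimately show ?thesis using Suc.IH[OF Suc.prems(1,2) True] by linarith
    next
      case False
      have "E t \<le> 2 ^ N * e" using e0 by (simp add: e_def)
      \<comment> \<open>At \<open>r\<close> the level \<open>2 ^ N * e\<close> is hit; between
        \<open>s\<close> and \<open>r\<close> the energy at most halves, as
        \<open>E s \<le> 2 ^ Suc N * e\<close>.\<close>
      then obtain r where r: "s \<le> r" "r \<le> t" "E r = 2 ^ N * e"
        using IVT2'[of E t "2 ^ N * e" s] False cont[of s t] Suc.prems by auto
      have "r - s \<le> M * (E s powr (- g1) + E s powr (- g2))"
      proof (rule halving)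
        show "0 < E s" using False e0 by (smt (verit) mult_pos_pos zero_less_power)
        show "E s / 2 \<le> E r" using Suc.prems r by simp
      qed (use Suc.prems r in auto)
      also have "\<dots> \<le> M * h (2 ^ N * e)"
        unfolding h_def using M g e0 False by (intro mult_left_mono add_mono powr_mono2') auto
      finally have "r - s \<le> M * h (2 ^ N * e)" .
      moreover have "t - r \<le> M * h e + M * (\<Sum>k<N. h (2 ^ k * e))"
        by (rule Suc.IH) (use Suc.prems r in auto)
      ultimately show ?thesis by (simp add: distrib_left)
    qed
  qed
  define c1 where "c1 = 1 / (1 - 2 powr (- g1))"
  define c2 where "c2 = 1 / (1 - 2 powr (- g2))"
  have c: "c1 > 0" "c2 > 0" using g by (auto simp: c1_def c2_def powr_less_one)
  have bound: "t - s \<le> M * (1 + c1 + c2) * h e" if s: "0 < s" "s \<le> t" for s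
  proof -
    obtain N :: nat where "E s / e < 2 ^ N" using real_arch_pow[of 2 "E s / e"] by auto
    then have "E s \<le> 2 ^ N * e" using e0 by (simp add: field_simps)
    then have "t - s \<le> M * (h e + (\<Sum>k<N. h (2 ^ k * e)))"
      using claim[OF s] by (simp add: distrib_left)
    also have "\<dots> \<le> M * (h e + (c1 * h e + c2 * h e))"
    proof (intro mult_left_mono add_left_mono)
      have "(\<Sum>k<N. h (2 ^ k * e)) \<le> c1 * e powr (- g1) + c2 * e powr (- g2)"
        unfolding h_def sum.distrib
        using dyadic_powr_sum_le[OF e0 g(1), of N] dyadic_powr_sum_le[OF e0 g(2), of N]
        by (simp add: c1_def c2_def)
      also have "\<dots> \<le> c1 * h e + c2 * h e"
        using c by (intro add_mono mult_left_mono) (auto simp: h_def)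
      finally show "(\<Sum>k<N. h (2 ^ k * e)) \<le> c1 * h e + c2 * h e" .
    qed (use M in auto)
    finally show ?thesis by (simp add: algebra_simps)
  qed
  \<comment> \<open>The halving estimate starts at positive times; letting the starting time tend to
    0 gives the bound on \<open>t\<close> itself.\<close>
  have "t \<le> M * (1 + c1 + c2) * h e + \<epsilon>" if "\<epsilon> > 0" for \<epsilon>
    using bound[of "min \<epsilon> t"] that t by auto
  then have "t \<le> M * (1 + c1 + c2) * h e" by (rule field_le_epsilon)
  then show ?thesis by (simp add: c1_def c2_def h_def e_def)
qed

text \<open>For \<open>e \<le> 1\<close> the larger exponent dominates. For \<open>e > 1\<close> the
  smaller one does, but then \<open>t \<ge> 1\<close> forces \<open>e\<close> below a fixed
  \<open>L\<close>, and on a bounded range the two powers are comparable.\<close>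

lemma decay_if_time_bound:
  fixes M g1 g2 :: real
  assumes M: "M > 0" and g: "g1 > 0" "g2 > 0"
  obtains D where "D \<ge> 0" "\<And>e t. e > 0 \<Longrightarrow> t \<ge> 1 \<Longrightarrow> t \<le> M * (e powr (- g1) + e powr (- g2)) \<Longrightarrow>
     e \<le> D * t powr (- 1 / max g1 g2)"
proof -
  define g where "g = max g1 g2"
  define g' where "g' = min g1 g2"
  have gg: "g > 0" "g' > 0" "g' \<le> g" using g by (auto simp: g_def g'_def)
  define L where "L = max 1 ((2 * M) powr (1 / g'))"
  define Q where "Q = 2 * M * L powr (g - g')"
  have "Q > 0" using M by (simp add: Q_def L_def less_max_iff_disj)
  have L1: "L \<ge> 1" by (simp add: L_def)
  show thesis
  proof (rule that[of "Q powr (1 / g)"])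
    fix e t :: real assume e: "e > 0" and t: "t \<ge> 1" and le: "t \<le> M * (e powr (- g1) + e powr (- g2))"
    have "t \<le> Q * e powr (- g)"
    proof (cases "e \<le> 1")
      case True
      have "e powr (- g1) \<le> e powr (- g)" "e powr (- g2) \<le> e powr (- g)"
        using True e by (auto intro!: powr_mono' simp: g_def)
      then have "t \<le> M * (e powr (- g) + e powr (- g))"
        using le M by (meson add_mono mult_left_mono order_trans less_imp_le)
      also have "\<dots> = 2 * M * 1 * e powr (- g)" by simp
      also have "\<dots> \<le> Q * e powr (- g)"
        unfolding Q_def using M L1 gg by (intro mult_right_mono mult_left_mono ge_one_powr_ge_zero) auto
      finally show ?thesis .
    next
      case False
      have "e powr (- g1) \<le> e powr (- g')" "e powr (- g2) \<le> e powr (- g')"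
        using False by (auto intro!: powr_mono simp: g'_def)
      then have "t \<le> M * (e powr (- g') + e powr (- g'))"
        using le M by (meson add_mono mult_left_mono order_trans less_imp_le)
      then have t': "t \<le> 2 * M * e powr (- g')" by simp
      then have "1 \<le> 2 * M * e powr (- g')" using t by simp
      then have "e powr g' \<le> 2 * M" using e by (simp add: powr_minus field_simps)
      then have "(e powr g') powr (1 / g') \<le> (2 * M) powr (1 / g')" using gg by (intro powr_mono2) auto
      then have eL: "e \<le> L" using gg e by (simp add: powr_powr L_def)
      have "e powr (- g') = e powr (g - g') * e powr (- g)" by (simp add: powr_add[symmetric])
      also have "\<dots> \<le> L powr (g - g') * e powr (- g)"
        using eL e gg by (intro mult_right_mono powr_mono2) auto
      finally have "2 * M * e powr (- g') \<le> 2 * M * (L powr (g - g') * e powr (- g))"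
        using M by (intro mult_left_mono) auto
      then show ?thesis using t' by (simp add: Q_def mult.assoc)
    qed
    then have "e powr g * t \<le> Q" using e by (simp add: powr_minus field_simps)
    then have "e powr g \<le> Q * t powr (- 1)" using t by (simp add: powr_minus field_simps)
    then have "(e powr g) powr (1 / g) \<le> (Q * t powr (- 1)) powr (1 / g)" using gg by (intro powr_mono2) auto
    also have "(Q * t powr (- 1)) powr (1 / g) = Q powr (1 / g) * t powr (- 1 / g)"
    proof -
      have "(Q * t powr (- 1)) powr (1 / g) = Q powr (1 / g) * (t powr (- 1)) powr (1 / g)"
        by (rule powr_mult)
      also have "(t powr (- 1)) powr (1 / g) = t powr (- 1 * (1 / g))" by (rule powr_powr)
      finally show ?thesis by simp
    qed
    finally show "e \<le> Q powr (1 / g) * t powr (- 1 / max g1 g2)" using gg e by (simp add: powr_powr g_def)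
  qed simp
qed

section \<open>Energy estimates for the damped equation\<close>

lemma isCont_norm_powr:
  fixes j :: "'v::real_normed_vector \<Rightarrow>\<^sub>L 'x::real_normed_vector"
  assumes "p > 0"
  shows "isCont (\<lambda>y. norm (j y) powr p) y"
proof -
  have "continuous_on UNIV (\<lambda>y. norm (j y) powr p)"
    by (rule continuous_on_powr') (use assms in \<open>auto intro!: continuous_intros\<close>)
  then show ?thesis by (simp add: continuous_on_eq_continuous_at)
qed

text \<open>\<open>j\<close> is the imbedding of V in X and \<open>G t\<close> the damping along the
  trajectory. The space Y enters through \<open>j_le\<close>, which combines condition (iii) with
  the imbedding of Y in X; there \<open>m\<close> will be 1/(\<beta>+2).\<close>

locale damped_trajectory = weak_trajectory T C K i u w z
  for T C K :: real
    and i :: "'v::{real_inner,complete_space} \<Rightarrow>\<^sub>L 'h::{real_inner,complete_space}"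
    and u w :: "real \<Rightarrow> 'v" and z :: "real \<Rightarrow> 'v \<Rightarrow>\<^sub>L real" +
  fixes j :: "'v \<Rightarrow>\<^sub>L 'x::real_normed_vector"
    and F :: "'v \<Rightarrow> real" and dF :: "'v \<Rightarrow> 'v \<Rightarrow>\<^sub>L real" and G :: "real \<Rightarrow> 'v \<Rightarrow>\<^sub>L real"
    and \<alpha> \<delta>2 \<delta>3 D4 \<iota> \<kappa> m :: real
  assumes F: "\<And>x. (F has_derivative blinfun_apply (dF x)) (at x)" and dF: "continuous_on UNIV dF"
    and eq: "\<And>t. t \<in> {0<..<T} \<Longrightarrow> z t = - dF (u t) - G t"
    and coercive: "\<And>t. t \<in> {0<..<T} \<Longrightarrow> \<delta>3 * norm (j (w t)) powr (\<alpha> + 2) \<le> G t (w t)"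
    and growth: "\<And>t e. t \<in> {0<..<T} \<Longrightarrow> \<bar>G t e\<bar> \<le> D4 * norm (j (w t)) powr (\<alpha> + 1) * norm (j e)"
    and F_nonneg: "\<And>y. 0 \<le> F y" and dF_ge: "\<And>y. \<delta>2 * F y \<le> dF y y"
    and j_le: "\<And>y. norm (j y) \<le> \<kappa> * F y powr m" and i_le: "\<And>y. norm (i y) \<le> \<iota> * norm (j y)"
    and pos: "0 < \<alpha>" "0 < \<delta>2" "0 < \<delta>3" "0 < D4" "0 \<le> \<iota>" "0 \<le> \<kappa>" "0 < m"
begin

definition E :: "real \<Rightarrow> real" where
  "E t = (norm (v t))\<^sup>2 / 2 + F (u t)"

lemma E_nonneg: "0 \<le> E t" and F_le_E: "F (u t) \<le> E t" and velocity_le_E: "(norm (v t))\<^sup>2 \<le> 2 * E t"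
  using F_nonneg[of "u t"] by (simp_all add: E_def)

lemma norm_j_w_powr_integrable:
  assumes "p > 0" "0 < a" "b < T"
  shows "(\<lambda>r. norm (j (w r)) powr p) integrable_on {a..b}"
proof (rule w_compose_integrable[where \<Phi> = "\<lambda>y. norm (j y) powr p" and B = "(norm j * C) powr p"])
  show "isCont (\<lambda>y. norm (j y) powr p) y" for y using assms(1) by (rule isCont_norm_powr)
  show "\<bar>norm (j (w t)) powr p\<bar> \<le> (norm j * C) powr p" if "t \<in> {0<..<T}" for t
    using norm_blinfun[of j "w t"] mult_left_mono[OF w_bound[OF that], of "norm j"] assms(1)
    by (auto intro!: powr_mono2)
qed (use assms in auto)

text \<open>Adding the kinetic and the potential energy identity cancels the gradient contained in
  \<open>z\<close>; what remains is the damping paired with \<open>w\<close>.\<close>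

lemma dissipation:
  assumes st: "0 < s" "s \<le> t" "t < T"
  shows "\<delta>3 * integral {s..t} (\<lambda>r. norm (j (w r)) powr (\<alpha> + 2)) \<le> E s - E t"
proof -
  note P = potential_energy_identity[OF F dF st]
  have zw: "(\<lambda>r. z r (w r)) integrable_on {s..t}" using z_w_integrable st by simp
  have "E t - E s = integral {s..t} (\<lambda>r. z r (w r)) + integral {s..t} (\<lambda>r. dF (u r) (w r))"
    using kinetic_energy_identity[OF st] P(1) by (simp add: E_def)
  also have "\<dots> = integral {s..t} (\<lambda>r. z r (w r) + dF (u r) (w r))"
    using integral_add[OF zw P(2)] by simp
  also have "\<dots> \<le> integral {s..t} (\<lambda>r. - \<delta>3 * norm (j (w r)) powr (\<alpha> + 2))"
  proof (rule integral_le)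
    show "(\<lambda>r. - \<delta>3 * norm (j (w r)) powr (\<alpha> + 2)) integrable_on {s..t}"
      by (intro integrable_on_mult_right norm_j_w_powr_integrable) (use pos st in auto)
    show "z r (w r) + dF (u r) (w r) \<le> - \<delta>3 * norm (j (w r)) powr (\<alpha> + 2)" if "r \<in> {s..t}" for r
      using coercive[of r] eq[of r] that st by (simp add: blinfun.diff_left blinfun.minus_left)
  qed (use zw P(2) integrable_add in auto)
  finally show ?thesis by simp
qed

lemma E_antimono:
  assumes st: "0 < s" "s \<le> t" "t < T"
  shows "E t \<le> E s"
proof -
  have "0 \<le> integral {s..t} (\<lambda>r. norm (j (w r)) powr (\<alpha> + 2))"
    by (intro integral_nonneg norm_j_w_powr_integrable) (use pos st in auto)
  then have "0 \<le> \<delta>3 * integral {s..t} (\<lambda>r. norm (j (w r)) powr (\<alpha> + 2))" using pos by simp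
  then show ?thesis using dissipation[OF st] by linarith
qed

lemma continuous_on_E: "continuous_on {0<..<T} E"
proof -
  have "continuous_on UNIV F"
    using F by (intro continuous_at_imp_continuous_on) (auto intro: has_derivative_continuous)
  then have "continuous_on {0<..<T} (\<lambda>t. F (u t))"
    by (rule continuous_on_compose2[OF _ u_continuous]) auto
  then show ?thesis
    unfolding E_def[abs_def] by (intro continuous_intros continuous_on_velocity) auto
qed

text \<open>Writing \<open>F (u r)\<close> as the energy minus half the squared velocity turns
  condition (iv) into a gain \<open>\<delta>2 * (E s / 2)\<close> at the price of
  \<open>\<delta>2 / 2\<close> times the squared velocity; with the squared velocity of the virial
  identity itself this makes \<open>1 + \<delta>2 / 2\<close>. The factor \<open>2 * sqrt 2\<close>
  comes from the two end values.\<close>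

lemma window_estimate:
  assumes st: "0 < s" "s \<le> t" "t < T" and e: "0 < E s" "E s / 2 \<le> E t"
  shows "\<delta>2 * (E s / 2) * (t - s) \<le> 2 * sqrt 2 * \<iota> * \<kappa> * E s powr (1 / 2 + m)
     + (1 + \<delta>2 / 2) * \<iota>\<^sup>2 * integral {s..t} (\<lambda>r. norm (j (w r)) powr 2)
     + D4 * \<kappa> * E s powr m * integral {s..t} (\<lambda>r. norm (j (w r)) powr (\<alpha> + 1))"
proof -
  define e where "e = E s"
  define U where "U = \<kappa> * e powr m"
  have U0: "U \<ge> 0" using pos by (simp add: U_def)
  have range: "e / 2 \<le> E r" "E r \<le> e" if "r \<in> {s..t}" for r
    using E_antimono[of s r] E_antimono[of r t] that st e by (auto simp: e_def)
  have ju: "norm (j (u r)) \<le> U" if "r \<in> {s..t}" for r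
  proof -
    have "F (u r) powr m \<le> e powr m"
      using F_le_E[of r] range[OF that] F_nonneg pos by (intro powr_mono2) auto
    then show ?thesis using j_le[of "u r"] mult_left_mono[of _ _ \<kappa>] pos unfolding U_def by fastforce
  qed
  have vi: "\<bar>v r \<bullet> i (u r)\<bar> \<le> sqrt 2 * \<iota> * \<kappa> * e powr (1 / 2 + m)" if r: "r \<in> {s..t}" for r
  proof -
    have "norm (v r) \<le> sqrt (2 * e)"
      using velocity_le_E[of r] range[OF r] by (intro real_le_rsqrt) auto
    moreover have "norm (i (u r)) \<le> \<iota> * U"
      using i_le[of "u r"] mult_left_mono[OF ju[OF r] pos(5)] by linarith
    ultimately have "norm (v r) * norm (i (u r)) \<le> sqrt (2 * e) * (\<iota> * U)"
      by (intro mult_mono) (use e in \<open>auto simp: e_def\<close>)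
    then have "\<bar>v r \<bullet> i (u r)\<bar> \<le> sqrt (2 * e) * (\<iota> * U)"
      using Cauchy_Schwarz_ineq2[of "v r" "i (u r)"] by linarith
    also have "\<dots> = sqrt 2 * \<iota> * \<kappa> * e powr (1 / 2 + m)"
      using e by (simp add: U_def e_def real_sqrt_mult powr_add powr_half_sqrt)
    finally show ?thesis .
  qed
  let ?V = "integral {s..t} (\<lambda>r. (norm (v r))\<^sup>2)"
  let ?I2 = "integral {s..t} (\<lambda>r. norm (j (w r)) powr 2)"
  let ?I1 = "integral {s..t} (\<lambda>r. norm (j (w r)) powr (\<alpha> + 1))"
  have Vi: "(\<lambda>r. (norm (v r))\<^sup>2) integrable_on {s..t}" using velocity_sq_integrable st by simp
  have ji: "(\<lambda>r. norm (j (w r)) powr p) integrable_on {s..t}" if "p > 0" for p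
    using norm_j_w_powr_integrable[OF that] st by simp
  have "?V \<le> integral {s..t} (\<lambda>r. (norm (i (w r)))\<^sup>2)" by (rule integral_velocity_sq_le[OF st])
  also have "\<dots> \<le> integral {s..t} (\<lambda>r. \<iota>\<^sup>2 * norm (j (w r)) powr 2)"
  proof (rule integral_le)
    show "(norm (i (w r)))\<^sup>2 \<le> \<iota>\<^sup>2 * norm (j (w r)) powr 2" for r
      using power_mono[OF i_le[of "w r"], of 2] by (simp add: power_mult_distrib)
    show "(\<lambda>r. (norm (i (w r)))\<^sup>2) integrable_on {s..t}"
      by (rule norm_i_w_sq_integrable) (use st in auto)
    show "(\<lambda>r. \<iota>\<^sup>2 * norm (j (w r)) powr 2) integrable_on {s..t}"
      by (intro integrable_on_mult_right ji) simp
  qed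
  finally have V: "?V \<le> \<iota>\<^sup>2 * ?I2" by simp
  have "integral {s..t} (\<lambda>r. z r (u r))
      \<le> integral {s..t} (\<lambda>r. - (\<delta>2 * (e / 2)) + \<delta>2 / 2 * (norm (v r))\<^sup>2 + D4 * U * norm (j (w r)) powr (\<alpha> + 1))"
  proof (rule integral_le)
    show "(\<lambda>r. z r (u r)) integrable_on {s..t}" using z_u_integrable st by simp
    show "(\<lambda>r. - (\<delta>2 * (e / 2)) + \<delta>2 / 2 * (norm (v r))\<^sup>2 + D4 * U * norm (j (w r)) powr (\<alpha> + 1)) integrable_on {s..t}"
      by (intro integrable_add integrable_on_mult_right Vi ji integrable_const_ivl) (use pos in auto)
    fix r assume r: "r \<in> {s..t}"
    have rT: "r \<in> {0<..<T}" using r st by auto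
    have "z r (u r) = - dF (u r) (u r) - G r (u r)"
      by (simp add: eq[OF rT] blinfun.diff_left blinfun.minus_left)
    moreover have "\<delta>2 * (e / 2 - (norm (v r))\<^sup>2 / 2) \<le> dF (u r) (u r)"
    proof -
      have "\<delta>2 * (e / 2 - (norm (v r))\<^sup>2 / 2) \<le> \<delta>2 * F (u r)"
        using range(1)[OF r] pos by (intro mult_left_mono) (auto simp: E_def)
      then show ?thesis using dF_ge[of "u r"] by linarith
    qed
    moreover have "\<bar>G r (u r)\<bar> \<le> D4 * U * norm (j (w r)) powr (\<alpha> + 1)"
    proof -
      have "D4 * norm (j (w r)) powr (\<alpha> + 1) * norm (j (u r)) \<le> D4 * norm (j (w r)) powr (\<alpha> + 1) * U"
        using ju[OF r] pos by (intro mult_left_mono) auto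
      then show ?thesis using growth[OF rT, of "u r"] by (simp add: ac_simps)
    qed
    ultimately show "z r (u r) \<le> - (\<delta>2 * (e / 2)) + \<delta>2 / 2 * (norm (v r))\<^sup>2 + D4 * U * norm (j (w r)) powr (\<alpha> + 1)"
      by (simp add: algebra_simps abs_le_iff)
  qed
  also have "\<dots> = - (\<delta>2 * (e / 2)) * (t - s) + \<delta>2 / 2 * ?V + D4 * U * ?I1"
  proof (rule integral_unique)
    have "((\<lambda>r. - (\<delta>2 * (e / 2))) has_integral - (\<delta>2 * (e / 2)) * (t - s)) {s..t}"
      using has_integral_const_real[of "- (\<delta>2 * (e / 2))" s t] st by (simp add: mult.commute)
    then show "((\<lambda>r. - (\<delta>2 * (e / 2)) + \<delta>2 / 2 * (norm (v r))\<^sup>2 + D4 * U * norm (j (w r)) powr (\<alpha> + 1))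
      has_integral - (\<delta>2 * (e / 2)) * (t - s) + \<delta>2 / 2 * ?V + D4 * U * ?I1) {s..t}"
      by (intro has_integral_add has_integral_mult_right integrable_integral Vi ji) (use pos in auto)
  qed
  finally have Z: "integral {s..t} (\<lambda>r. z r (u r)) \<le> - (\<delta>2 * (e / 2)) * (t - s) + \<delta>2 / 2 * ?V + D4 * U * ?I1" .
  have "v t \<bullet> i (u t) - v s \<bullet> i (u s) = ?V + integral {s..t} (\<lambda>r. z r (u r))"
    using virial_identity[OF st] integral_velocity_sq[OF st] by simp
  then have "\<delta>2 * (e / 2) * (t - s) \<le> \<bar>v s \<bullet> i (u s)\<bar> + \<bar>v t \<bullet> i (u t)\<bar> + (1 + \<delta>2 / 2) * ?V + D4 * U * ?I1"
  proof -
    have "(1 + \<delta>2 / 2) * ?V = ?V + \<delta>2 / 2 * ?V" "- (\<delta>2 * (e / 2)) * (t - s) = - (\<delta>2 * (e / 2) * (t - s))"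
      by (simp_all add: distrib_right)
    then show ?thesis
      using Z \<open>v t \<bullet> i (u t) - v s \<bullet> i (u s) = _\<close> abs_ge_minus_self[of "v s \<bullet> i (u s)"]
        abs_ge_minus_self[of "v t \<bullet> i (u t)"] abs_ge_self[of "v t \<bullet> i (u t)"] abs_ge_self[of "v s \<bullet> i (u s)"]
      by linarith
  qed
  also have "\<dots> \<le> sqrt 2 * \<iota> * \<kappa> * e powr (1 / 2 + m) + sqrt 2 * \<iota> * \<kappa> * e powr (1 / 2 + m)
     + (1 + \<delta>2 / 2) * (\<iota>\<^sup>2 * ?I2) + D4 * U * ?I1"
    using st pos U0 by (intro add_mono vi mult_left_mono V) auto
  finally show ?thesis by (simp add: e_def U_def algebra_simps)
qed

text \<open>Interpolation under the integral; the energy dissipated on the window is at most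
  \<open>E s / 2\<close> because half of \<open>E s\<close> is still left at its end.\<close>

lemma interpolated_integral:
  assumes st: "0 < s" "s \<le> t" "t < T" and e: "E s / 2 \<le> E t" and p: "0 < p" "p < \<alpha> + 2" and \<eta>: "\<eta> > 0"
  shows "integral {s..t} (\<lambda>r. norm (j (w r)) powr p)
    \<le> \<eta> * (t - s) + \<eta> powr (- (\<alpha> + 2 - p) / p) * (E s / (2 * \<delta>3))"
proof -
  have ji: "(\<lambda>r. norm (j (w r)) powr q) integrable_on {s..t}" if "q > 0" for q
    using norm_j_w_powr_integrable[OF that] st by simp
  have I: "((\<lambda>r. \<eta> + \<eta> powr (- (\<alpha> + 2 - p) / p) * norm (j (w r)) powr (\<alpha> + 2)) has_integral
     \<eta> * (t - s) + \<eta> powr (- (\<alpha> + 2 - p) / p) * integral {s..t} (\<lambda>r. norm (j (w r)) powr (\<alpha> + 2))) {s..t}"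
    using has_integral_const_real[of \<eta> s t] st pos
    by (intro has_integral_add has_integral_mult_right integrable_integral ji) (auto simp: mult.commute)
  have "integral {s..t} (\<lambda>r. norm (j (w r)) powr p)
    \<le> \<eta> * (t - s) + \<eta> powr (- (\<alpha> + 2 - p) / p) * integral {s..t} (\<lambda>r. norm (j (w r)) powr (\<alpha> + 2))"
    by (rule has_integral_le[OF integrable_integral[OF ji[OF p(1)]] I])
      (use powr_interpolation[OF norm_ge_zero \<eta> p] in auto)
  also have "\<dots> \<le> \<eta> * (t - s) + \<eta> powr (- (\<alpha> + 2 - p) / p) * (E s / (2 * \<delta>3))"
  proof (intro add_left_mono mult_left_mono)
    have "\<delta>3 * integral {s..t} (\<lambda>r. norm (j (w r)) powr (\<alpha> + 2)) \<le> E s / 2"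
      using dissipation[OF st] e by linarith
    then show "integral {s..t} (\<lambda>r. norm (j (w r)) powr (\<alpha> + 2)) \<le> E s / (2 * \<delta>3)"
      using pos by (simp add: field_simps)
  qed simp
  finally show ?thesis .
qed

end

text \<open>By definition \<open>u''\<close> is only integrable in V'. The equation improves this:
  \<open>dF (u t)\<close> is bounded since \<open>u\<close> runs through a compact set, and the
  damping is bounded by a power of the norm of \<open>j (u' t)\<close>. This gives the bound
  \<open>K\<close>.\<close>

lemma strong_solution_trajectory:
  fixes i :: "'v::{real_inner,complete_space} \<Rightarrow>\<^sub>L 'h::{real_inner,complete_space}"
    and j :: "'v \<Rightarrow>\<^sub>L 'x::real_normed_vector"
  assumes sol: "strong_solution_on i dF g T u" and T: "T > 0" and dF: "continuous_on UNIV dF"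
    and D4: "0 < D4" and \<alpha>: "0 < \<alpha>"
    and damp: "AE t in lebesgue_on {0<..<T}. \<forall>y. \<delta>3 * norm (j y) powr (\<alpha> + 2) \<le> g t y y \<and>
      (\<forall>e. \<bar>g t y e\<bar> \<le> D4 * norm (j y) powr (\<alpha> + 1) * norm (j e))"
  obtains C K w z G where "weak_trajectory T C K i u w z"
    "\<And>t. t \<in> {0<..<T} \<Longrightarrow> z t = - dF (u t) - G t"
    "\<And>t. t \<in> {0<..<T} \<Longrightarrow> \<delta>3 * norm (j (w t)) powr (\<alpha> + 2) \<le> G t (w t)"
    "\<And>t e. t \<in> {0<..<T} \<Longrightarrow> \<bar>G t e\<bar> \<le> D4 * norm (j (w t)) powr (\<alpha> + 1) * norm (j e)"
proof -
  let ?M = "lebesgue_on {0<..<T}"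
  let ?J = "\<lambda>v. hilbert_to_dual i (i v)"
  from sol obtain u' u'' where uc: "continuous_on {0..T} u"
    and Li: "L_infinity ?M u'" and wd: "weak_derivative T u u'" and L1: "L_one ?M u''"
    and wd2: "weak_derivative T (\<lambda>t. ?J (u' t)) u''"
    and eqn: "AE t in ?M. u'' t + dF (u t) + g t (u' t) = 0"
    unfolding strong_solution_on_def Let_def by blast
  obtain C0 where C0: "AE t in ?M. norm (u' t) \<le> C0" and u'm: "strongly_measurable ?M u'"
    using Li unfolding L_infinity_def by blast
  define P where "P t \<longleftrightarrow> norm (u' t) \<le> C0 \<and> u'' t + dF (u t) + g t (u' t) = 0 \<and>
     (\<forall>y. \<delta>3 * norm (j y) powr (\<alpha> + 2) \<le> g t y y \<and> (\<forall>e. \<bar>g t y e\<bar> \<le> D4 * norm (j y) powr (\<alpha> + 1) * norm (j e)))" for t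
  have P: "AE t in ?M. P t" using C0 eqn damp unfolding P_def by eventually_elim blast
  \<comment> \<open>Redefined on a null set, so that all bounds hold everywhere.\<close>
  define w where "w t = (if P t then u' t else 0)" for t
  define G where "G t = (if P t then g t (u' t) else 0)" for t
  \<comment> \<open>Defined through the equation, which then holds at every \<open>t\<close>; by
    \<open>zP\<close> it equals \<open>u''\<close> almost everywhere.\<close>
  define z where "z t = - dF (u t) - G t" for t
  define C where "C = \<bar>C0\<bar>"
  have wP: "w t = u' t" if "P t" for t using that by (simp add: w_def)
  have zP: "z t = u'' t" if "P t" for t
  proof -
    have "u'' t + dF (u t) + g t (u' t) = 0" using that by (simp add: P_def)
    then have "u'' t = - dF (u t) - g t (u' t)" by (metis add_diff_cancel diff_add_eq minus_unique add.commute uminus_add_conv_diff)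
    then show ?thesis using that by (simp add: z_def G_def)
  qed
  have wC: "norm (w t) \<le> C" for t by (auto simp: w_def C_def P_def)
  \<comment> \<open>Off \<open>P\<close> both \<open>w t\<close> and \<open>G t\<close> are 0, and
    \<open>0 powr (\<alpha> + 2)\<close> is 0, so the inequality survives the redefinition.\<close>
  have coer: "\<delta>3 * norm (j (w t)) powr (\<alpha> + 2) \<le> G t (w t)" for t
    using \<alpha> by (auto simp: w_def G_def P_def)
  have grow: "\<bar>G t e\<bar> \<le> D4 * norm (j (w t)) powr (\<alpha> + 1) * norm (j e)" for t e
    by (auto simp: w_def G_def P_def)
  have "continuous_on {0..T} (\<lambda>t. dF (u t))" by (rule continuous_on_compose2[OF dF uc]) auto
  then have "compact ((\<lambda>t. dF (u t)) ` {0..T})" by (intro compact_continuous_image) auto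
  then have "bounded ((\<lambda>t. dF (u t)) ` {0..T})" by (rule compact_imp_bounded)
  then obtain B where B: "\<forall>x\<in>(\<lambda>t. dF (u t)) ` {0..T}. norm x \<le> B" unfolding bounded_iff by blast
  define K where "K = B + D4 * (norm j * C) powr (\<alpha> + 1) * norm j"
  have GK: "norm (G t) \<le> D4 * (norm j * C) powr (\<alpha> + 1) * norm j" for t
  proof (rule norm_blinfun_bound)
    show "0 \<le> D4 * (norm j * C) powr (\<alpha> + 1) * norm j" using D4 by simp
    fix e
    have "norm (j (w t)) \<le> norm j * C"
      using norm_blinfun[of j "w t"] mult_left_mono[OF wC, of "norm j"] by (meson norm_ge_zero order_trans)
    then have "norm (j (w t)) powr (\<alpha> + 1) \<le> (norm j * C) powr (\<alpha> + 1)" using \<alpha> by (intro powr_mono2) auto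
    then have "D4 * norm (j (w t)) powr (\<alpha> + 1) * norm (j e) \<le> D4 * (norm j * C) powr (\<alpha> + 1) * (norm j * norm e)"
      using D4 norm_blinfun[of j e] by (intro mult_mono) auto
    then show "norm (G t e) \<le> D4 * (norm j * C) powr (\<alpha> + 1) * norm j * norm e"
      using grow[of t e] by (simp add: mult.assoc)
  qed
  have zK: "norm (z t) \<le> K" if "t \<in> {0<..<T}" for t
  proof -
    have "norm (dF (u t)) \<le> B" using B that by auto
    then show ?thesis
      using norm_triangle_ineq4[of "- dF (u t)" "G t"] GK[of t] by (simp add: z_def K_def)
  qed
  obtain N where N: "N \<in> null_sets ?M" "\<And>t. t \<in> {0<..<T} - N \<Longrightarrow> P t"
    using AE_E3[OF P] by auto
  have negl: "negligible N"
    using N(1) by (simp add: negligible_iff_null_sets null_sets_restrict_space)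
  have spike: "integral {0<..<T} p = integral {0<..<T} q" if "\<And>t. P t \<Longrightarrow> p t = q t" for p q :: "real \<Rightarrow> real"
    by (rule integral_spike[OF negl]) (use that N(2) in auto)
  have "weak_trajectory T C K i u w z"
  proof
    show "continuous_on {0..T} u" by fact
    show "strongly_measurable ?M w"
      by (rule strongly_measurable_AE_cong[OF u'm]) (use P in eventually_elim, use wP in simp)
    have u''m: "strongly_measurable ?M u''" using L1 by (simp add: L_one_def)
    show "strongly_measurable ?M z"
      by (rule strongly_measurable_AE_cong[OF u''m]) (use P in eventually_elim, use zP in simp)
    show "norm (w t) \<le> C" for t by fact
    show "norm (z t) \<le> K" if "t \<in> {0<..<T}" for t by (rule zK[OF that])
    show "integral {0<..<T} (\<lambda>t. deriv \<phi> t * l (u t)) = - integral {0<..<T} (\<lambda>t. \<phi> t * l (w t))"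
      if "bounded_linear l" "test_function T \<phi>" for l :: "'v \<Rightarrow> real" and \<phi>
      using weak_derivative_bounded_linear[OF that(1) wd that(2)]
        spike[of "\<lambda>t. \<phi> t * l (w t)" "\<lambda>t. \<phi> t * l (u' t)"] wP by simp
    show "integral {0<..<T} (\<lambda>t. deriv \<phi> t * (i (w t) \<bullet> i e)) = - integral {0<..<T} (\<lambda>t. \<phi> t * z t e)"
      if "test_function T \<phi>" for e \<phi>
    proof -
      \<comment> \<open>Evaluation at \<open>e\<close> is a functional on V'; on the image of
        \<open>u'\<close> it gives the inner product with \<open>i e\<close> in H.\<close>
      have "bounded_linear (\<lambda>f :: 'v \<Rightarrow>\<^sub>L real. f e)" by (rule blinfun.bounded_linear_left)
      from weak_derivative_bounded_linear[OF this wd2 that] show ?thesis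
        using spike[of "\<lambda>t. \<phi> t * z t e" "\<lambda>t. \<phi> t * u'' t e"] zP
          spike[of "\<lambda>t. deriv \<phi> t * (i (w t) \<bullet> i e)" "\<lambda>t. deriv \<phi> t * (i (u' t) \<bullet> i e)"] wP
        by (simp add: hilbert_to_dual_def restrict_functional_def blinfun_inner_right.rep_eq)
    qed
  qed
  then show thesis using that[of C K w z G] coer grow by (simp add: z_def)
qed

theorem theorem3p3:
  fixes iVY :: "'v::{real_inner,complete_space} \<Rightarrow>\<^sub>L 'y::banach"
    and iYX :: "'y \<Rightarrow>\<^sub>L 'x::banach"
    and iXH :: "'x \<Rightarrow>\<^sub>L 'h::{real_inner,complete_space}"
    and iVX :: "'v \<Rightarrow>\<^sub>L 'x"
    and iVH :: "'v \<Rightarrow>\<^sub>L 'h"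
    and \<alpha> \<beta> \<gamma> \<delta>1 \<delta>2 \<delta>3 D4 :: real
  assumes chain: "chain_of_spaces iVY iYX iXH"
    and iVX: "iVX = iYX o\<^sub>L iVY"
    and iVH: "iVH = iXH o\<^sub>L iVX"
    and \<alpha>\<beta>: "0 < \<alpha>" "\<alpha> < \<beta>"
    and pos: "0 < \<delta>1" "0 < \<delta>2" "0 < \<delta>3" "0 < D4"
    and \<gamma>: "\<gamma> = max (\<alpha> / 2) ((\<beta> - \<alpha>) / ((\<alpha> + 1) * (\<beta> + 2)))"
  shows "\<exists>D::real. \<forall>(F :: 'v \<Rightarrow> real) (dF :: 'v \<Rightarrow> 'v \<Rightarrow>\<^sub>L real) (g :: real \<Rightarrow> 'v \<Rightarrow> 'v \<Rightarrow>\<^sub>L real).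
    (\<forall>u. (F has_derivative blinfun_apply (dF u)) (at u)) \<and> continuous_on UNIV dF \<and>
    (\<forall>T>0. \<forall>v. L_infinity (lebesgue_on {0<..<T}) v \<longrightarrow>
       L_one (lebesgue_on {0<..<T}) (\<lambda>t. g t (v t))) \<and>
    (\<forall>u. F u \<ge> \<delta>1 * norm (iVY u) powr (\<beta> + 2)) \<and>
    (\<forall>u. blinfun_apply (dF u) u \<ge> \<delta>2 * F u) \<and>
    (AE t in lebesgue_on {0<..}. \<forall>v. blinfun_apply (g t v) v \<ge> \<delta>3 * norm (iVX v) powr (\<alpha> + 2)) \<and>
    (\<forall>t>0. \<forall>v. g t v \<in> range (restrict_functional iVX)) \<and>
    (AE t in lebesgue_on {0<..}. \<forall>v.
       norm (inv (restrict_functional iVX) (g t v)) \<le> D4 * norm (iVX v) powr (\<alpha> + 1))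
    \<longrightarrow> (\<forall>u. strong_solution iVH dF g u \<longrightarrow>
       (\<forall>t\<ge>1. (norm (vector_derivative (\<lambda>s. iVH (u s)) (at t)))\<^sup>2 + F (u t)
              \<le> D * t powr (- 1 / \<gamma>)))"
proof -
  define m where "m = 1 / (\<beta> + 2)"
  define \<iota> where "\<iota> = norm iXH"
  \<comment> \<open>By (iii) the norm in Y is at most \<open>(F y / \<delta>1) powr m\<close>; the
    imbedding of Y in X contributes \<open>norm iYX\<close>.\<close>
  define \<kappa> where "\<kappa> = norm iYX * (1 / \<delta>1) powr m"
  define g1 where "g1 = \<alpha> / 2"
  define g2 where "g2 = (\<beta> - \<alpha>) / ((\<alpha> + 1) * (\<beta> + 2))"
  have g: "g1 > 0" "g2 > 0" using \<alpha>\<beta> by (simp_all add: g1_def g2_def)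
  have \<iota>\<kappa>: "0 \<le> \<iota>" "0 \<le> \<kappa>" by (simp_all add: \<iota>_def \<kappa>_def)
  have m0: "m > 0" using \<alpha>\<beta> by (simp add: m_def)
  obtain M where M: "M > 0" and window: "\<And>e \<Delta> I1 I2. e > 0 \<Longrightarrow> \<Delta> \<ge> 0 \<Longrightarrow>
     \<delta>2 * (e / 2) * \<Delta> \<le> 2 * sqrt 2 * \<iota> * \<kappa> * e powr (1 / 2 + m) + (1 + \<delta>2 / 2) * \<iota>\<^sup>2 * I2 + D4 * \<kappa> * e powr m * I1 \<Longrightarrow>
     (\<And>\<eta>. \<eta> > 0 \<Longrightarrow> I2 \<le> \<eta> * \<Delta> + \<eta> powr (- \<alpha> / 2) * (e / (2 * \<delta>3))) \<Longrightarrow>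
     (\<And>\<eta>. \<eta> > 0 \<Longrightarrow> I1 \<le> \<eta> * \<Delta> + \<eta> powr (- 1 / (\<alpha> + 1)) * (e / (2 * \<delta>3))) \<Longrightarrow>
     \<Delta> \<le> M * (e powr (- g1) + e powr (- g2))"
    unfolding m_def g1_def g2_def
    by (rule window_length_bound[OF \<alpha>\<beta> pos(2,3), of "(1 + \<delta>2 / 2) * \<iota>\<^sup>2" "D4 * \<kappa>" "2 * sqrt 2 * \<iota> * \<kappa>"])
      (use \<iota>\<kappa> pos in auto)
  define M' where "M' = M * (1 + 1 / (1 - 2 powr (- g1)) + 1 / (1 - 2 powr (- g2)))"
  have "1 - 2 powr (- g1) > (0::real)" "1 - 2 powr (- g2) > (0::real)"
    using g by (simp_all add: powr_less_one)
  then have M': "M' > 0" unfolding M'_def using M by (intro mult_pos_pos add_pos_pos divide_pos_pos) auto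
  obtain D where D: "D \<ge> 0" and decay: "\<And>e t. e > 0 \<Longrightarrow> t \<ge> 1 \<Longrightarrow> t \<le> M' * (e powr (- g1) + e powr (- g2)) \<Longrightarrow>
     e \<le> D * t powr (- 1 / max g1 g2)"
    by (rule decay_if_time_bound[OF M' g]) blast
  have \<gamma>': "max g1 g2 = \<gamma>" by (simp add: \<gamma> g1_def g2_def)
  show ?thesis
  \<comment> \<open>The witness is fixed before \<open>F\<close>, \<open>g\<close> and
    \<open>u\<close> are introduced, which gives the uniformity; the factor 2 is due to the halved
    kinetic term in \<open>E\<close>.\<close>
  proof (intro exI[of _ "2 * D"] allI impI, elim conjE)
    fix F :: "'v \<Rightarrow> real" and dF :: "'v \<Rightarrow> 'v \<Rightarrow>\<^sub>L real" and g :: "real \<Rightarrow> 'v \<Rightarrow> 'v \<Rightarrow>\<^sub>L real"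
      and u :: "real \<Rightarrow> 'v" and t :: real
    assume F: "\<forall>u. (F has_derivative blinfun_apply (dF u)) (at u)" and dF: "continuous_on UNIV dF"
      and Fge: "\<forall>u. F u \<ge> \<delta>1 * norm (iVY u) powr (\<beta> + 2)"
      and dFge: "\<forall>u. blinfun_apply (dF u) u \<ge> \<delta>2 * F u"
      and coercive: "AE t in lebesgue_on {0<..}. \<forall>v. blinfun_apply (g t v) v \<ge> \<delta>3 * norm (iVX v) powr (\<alpha> + 2)"
      and range: "\<forall>t>0. \<forall>v. g t v \<in> range (restrict_functional iVX)"
      and growth: "AE t in lebesgue_on {0<..}. \<forall>v.
        norm (inv (restrict_functional iVX) (g t v)) \<le> D4 * norm (iVX v) powr (\<alpha> + 1)"
      and sol: "strong_solution iVH dF g u" and t: "1 \<le> t"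
    define E where "E t = (norm (vector_derivative (\<lambda>s. iVH (u s)) (at t)))\<^sup>2 / 2 + F (u t)" for t
    have F0: "0 \<le> F y" for y
      using Fge[rule_format, of y] pos(1) by (smt (verit) mult_nonneg_nonneg powr_ge_zero)
    have j_le: "norm (iVX y) \<le> \<kappa> * F y powr m" for y
    proof -
      have "norm (iVY y) powr (\<beta> + 2) \<le> 1 / \<delta>1 * F y"
        using Fge[rule_format, of y] pos(1) by (simp add: field_simps)
      then have "(norm (iVY y) powr (\<beta> + 2)) powr m \<le> (1 / \<delta>1 * F y) powr m"
        using m0 by (intro powr_mono2) auto
      also have "(1 / \<delta>1 * F y) powr m = (1 / \<delta>1) powr m * F y powr m" by (rule powr_mult)
      also have "(norm (iVY y) powr (\<beta> + 2)) powr m = norm (iVY y)"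
        using \<alpha>\<beta> by (simp add: powr_powr m_def)
      finally have "norm iYX * norm (iVY y) \<le> norm iYX * ((1 / \<delta>1) powr m * F y powr m)"
        by (rule mult_left_mono) simp
      then show ?thesis
        using norm_blinfun[of iYX "iVY y"] by (simp add: iVX \<kappa>_def mult.assoc)
    qed
    have i_le: "norm (iVH y) \<le> \<iota> * norm (iVX y)" for y
      using norm_blinfun[of iXH "iVX y"] by (simp add: iVH \<iota>_def)
    \<comment> \<open>Condition (vi) read on V: the bound on the norm in X' becomes a bound on the
      pairing with each \<open>e\<close> in V.\<close>
    define damped where "damped t \<longleftrightarrow> (\<forall>y. \<delta>3 * norm (iVX y) powr (\<alpha> + 2) \<le> g t y y \<and>
      (\<forall>e. \<bar>g t y e\<bar> \<le> D4 * norm (iVX y) powr (\<alpha> + 1) * norm (iVX e)))" for t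
    have damp: "AE t in lebesgue_on {0<..<T}. damped t" for T
    proof -
      have "AE t in lebesgue_on {0<..}. damped t"
        using coercive growth AE_space
      proof eventually_elim
        case (elim t)
        have "\<bar>g t y e\<bar> \<le> D4 * norm (iVX y) powr (\<alpha> + 1) * norm (iVX e)" for y e
        proof -
          \<comment> \<open>The functional on X whose restriction to V is
            \<open>g t y\<close>.\<close>
          define f where "f = inv (restrict_functional iVX) (g t y)"
          have f: "restrict_functional iVX f = g t y"
            unfolding f_def by (rule f_inv_into_f) (use range elim(3) in auto)
          have "g t y e = f (iVX e)" unfolding f[symmetric] by (simp add: restrict_functional_def)
          then have "\<bar>g t y e\<bar> \<le> norm f * norm (iVX e)" using norm_blinfun[of f "iVX e"] by simp
          also have "\<dots> \<le> D4 * norm (iVX y) powr (\<alpha> + 1) * norm (iVX e)"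
            unfolding f_def using elim(2) by (intro mult_right_mono) auto
          finally show ?thesis .
        qed
        then show ?case using elim(1) unfolding damped_def by blast
      qed
      then have "AE t in lebesgue. t \<in> {0<..} \<longrightarrow> damped t"
        by (subst (asm) AE_restrict_space_iff) auto
      then have "AE t in lebesgue. t \<in> {0<..<T} \<longrightarrow> damped t"
        by (rule eventually_mono) simp
      then show ?thesis by (subst AE_restrict_space_iff) auto
    qed
    have energy: "0 \<le> E b" "E b \<le> E a" "continuous_on {a..b} E"
      "0 < E a \<Longrightarrow> E a / 2 \<le> E b \<Longrightarrow> b - a \<le> M * (E a powr (- g1) + E a powr (- g2))"
      if ab: "0 < a" "a \<le> b" for a b
    proof -
      \<comment> \<open>The horizon \<open>b + 1\<close> makes \<open>a\<close> and \<open>b\<close>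
        interior points. The bounds \<open>C\<close> and \<open>K\<close> obtained for it vary with
        \<open>b\<close>, but \<open>M\<close> does not involve them.\<close>
      have T: "0 < b + 1" "b < b + 1" using ab by auto
      have "strong_solution_on iVH dF g (b + 1) u" using sol T by (simp add: strong_solution_def)
      then obtain C K w z G where traj: "weak_trajectory (b + 1) C K iVH u w z"
        and G: "\<And>t. t \<in> {0<..<b + 1} \<Longrightarrow> z t = - dF (u t) - G t"
          "\<And>t. t \<in> {0<..<b + 1} \<Longrightarrow> \<delta>3 * norm (iVX (w t)) powr (\<alpha> + 2) \<le> G t (w t)"
          "\<And>t e. t \<in> {0<..<b + 1} \<Longrightarrow> \<bar>G t e\<bar> \<le> D4 * norm (iVX (w t)) powr (\<alpha> + 1) * norm (iVX e)"
        by (rule strong_solution_trajectory[OF _ T(1) dF pos(4) \<alpha>\<beta>(1) damp[unfolded damped_def]]) blast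
      interpret weak_trajectory "b + 1" C K iVH u w z by (rule traj)
      interpret d: damped_trajectory "b + 1" C K iVH u w z iVX F dF G \<alpha> \<delta>2 \<delta>3 D4 \<iota> \<kappa> m
        by unfold_locales (use F dF G F0 dFge j_le i_le \<alpha>\<beta> pos \<iota>\<kappa> m0 in auto)
      \<comment> \<open>The velocity is defined from \<open>iVH\<close> and \<open>u\<close> alone,
        so the energy is the same function for every horizon.\<close>
      have dE: "d.E = E" by (rule ext) (simp add: d.E_def v_def E_def)
      show "0 \<le> E b" using d.E_nonneg by (simp add: dE)
      show "E b \<le> E a" using d.E_antimono[OF ab T(2)] by (simp add: dE)
      show "continuous_on {a..b} E"
        using d.continuous_on_E unfolding dE by (rule continuous_on_subset) (use ab in auto)
      assume e: "0 < E a" "E a / 2 \<le> E b"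
      show "b - a \<le> M * (E a powr (- g1) + E a powr (- g2))"
      proof (rule window[OF e(1)])
        show "\<delta>2 * (E a / 2) * (b - a) \<le> 2 * sqrt 2 * \<iota> * \<kappa> * E a powr (1 / 2 + m)
          + (1 + \<delta>2 / 2) * \<iota>\<^sup>2 * integral {a..b} (\<lambda>r. norm (iVX (w r)) powr 2)
          + D4 * \<kappa> * E a powr m * integral {a..b} (\<lambda>r. norm (iVX (w r)) powr (\<alpha> + 1))"
          using d.window_estimate[OF ab T(2)] e by (simp add: dE)
        show "integral {a..b} (\<lambda>r. norm (iVX (w r)) powr 2)
          \<le> \<eta> * (b - a) + \<eta> powr (- \<alpha> / 2) * (E a / (2 * \<delta>3))" if "\<eta> > 0" for \<eta>
          using d.interpolated_integral[OF ab T(2), of 2 \<eta>] e that \<alpha>\<beta> by (simp add: dE)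
        show "integral {a..b} (\<lambda>r. norm (iVX (w r)) powr (\<alpha> + 1))
          \<le> \<eta> * (b - a) + \<eta> powr (- 1 / (\<alpha> + 1)) * (E a / (2 * \<delta>3))" if "\<eta> > 0" for \<eta>
          using d.interpolated_integral[OF ab T(2), of "\<alpha> + 1" \<eta>] e that \<alpha>\<beta> by (simp add: dE)
      qed (use ab in auto)
    qed
    have cont: "continuous_on {a..b} E" if "0 < a" for a b
      using energy(3)[OF that, of b] by (cases "a \<le> b") auto
    have "E t \<le> D * t powr (- 1 / \<gamma>)"
    \<comment> \<open>The time bound needs positive energy; at zero energy the claim is trivial as
      \<open>D \<ge> 0\<close>.\<close>
    proof (cases "E t = 0")
      case False
      then have Et: "E t > 0" using energy(1)[of t t] t by simp
      have "t \<le> M' * (E t powr (- g1) + E t powr (- g2))"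
        unfolding M'_def
        by (rule time_bound_if_halving[OF energy(2) cont M g energy(4)]) (use t Et in auto)
      then show ?thesis using decay[OF Et t] by (simp add: \<gamma>')
    qed (use D in simp)
    moreover have "(norm (vector_derivative (\<lambda>s. iVH (u s)) (at t)))\<^sup>2 + F (u t) \<le> 2 * E t"
      using F0[of "u t"] by (simp add: E_def)
    ultimately show "(norm (vector_derivative (\<lambda>s. iVH (u s)) (at t)))\<^sup>2 + F (u t)
      \<le> 2 * D * t powr (- 1 / \<gamma>)" by simp
  qed
qed

end
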